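(* Let $0\to A^*\to B^*\to C^*\to 0$ be a short exact sequence of complexes in an abelian category with enough injectives. Then there exist Cartan-Eilenberg resolutions $0\to A^*\to I^{0,*}\to I^{1,*}\to\cdots$, $0\to B^*\to J^{0,*}\to J^{1,*}\to\cdots$, $0\to C^*\to K^{0,*}\to K^{1,*}\to\cdots$ of $A^*,B^*,C^*$ respectively, and chain maps $I^{p,*}\to J^{p,*}\to K^{p,*}$ for all $p\ge 0$, such that: 1. these maps, together with the given maps $A^*\to B^*\to C^*$ and the maps of the three resolutions, form a commutative diagram of complexes (i.e. they commute with the augmentations $A^*\to I^{0,*}$, $B^*\to J^{0,*}$, $C^*\to K^{0,*}$ and with the maps $I^{p,*}\to I^{p+1,*}$, $J^{p,*}\to J^{p+1,*}$, $K^{p,*}\to K^{p+1,*}$); 2. for each $p\ge 0$ the row $0\to I^{p,*}\to J^{p,*}\to K^{p,*}\to 0$ is exact. Moreover, if $A^q=B^q=C^q=0$ for all $q<0$, then the resolutions may be chosen so that in addition $I^{p,q}=J^{p,q}=K^{p,q}=0$ for all $q<0$.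
   Context: Complexes are cochain complexes indexed by the integers (differentials raise degree). Cartan-Eilenberg resolution: for a complex $A^*$ in an abelian category, this is a sequence of complexes $I^{0,*},I^{1,*},I^{2,*},\dots$ with chain maps $I^{p,*}\to I^{p+1,*}$ and an injective chain map $A^*\to I^{0,*}$ such that (i) each object $I^{p,q}$ is injective; (ii) the sequence $0\to A^*\to I^{0,*}\to I^{1,*}\to\cdots$ is exact; (iii) if $Z^q(A)$ denotes the degree $q$ cocycles of $A^*$ and $Z^{p,q}(I)$ the degree $q$ cocycles of $I^{p,*}$, then for each $q$ the induced sequence $Z^q(A)\to Z^{0,q}(I)\to Z^{1,q}(I)\to\cdots$ is an injective resolution of $Z^q(A)$ (in particular each $Z^{p,q}(I)$ is injective); (iv) similarly, for each $q$ the induced sequences on degree $q$ coboundaries and on degree $q$ cohomology are injective resolutions of the degree $q$ coboundaries and the degree $q$ cohomology of $A^*$. *)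

theory Defs
  imports "HOL-Algebra.Group"
begin

section \<open>Abelian categories\<close>

text \<open>
  Objects and arrows form carrier sets inside two types; every arrow knows its domain and codomain,
  so hom-sets are disjoint. Composition \<open>g \<cdot> f\<close> means first \<open>f\<close>, then \<open>g\<close>. The additive
  structure on the hom-sets is part of the data. Values of the operations outside the
  carriers are irrelevant.
\<close>

record ('o, 'm) category =
  Obj :: "'o set"
  Arr :: "'m set"
  Dom :: "'m \<Rightarrow> 'o"
  Cod :: "'m \<Rightarrow> 'o"
  Ident :: "'o \<Rightarrow> 'm"
  Comp :: "'m \<Rightarrow> 'm \<Rightarrow> 'm" (infixl "\<cdot>\<index>" 70)
  Add :: "'m \<Rightarrow> 'm \<Rightarrow> 'm"
  Zero :: "'o \<Rightarrow> 'o \<Rightarrow> 'm"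

definition Hom :: "('o, 'm) category \<Rightarrow> 'o \<Rightarrow> 'o \<Rightarrow> 'm set" where
  "Hom \<A> X Y = {f \<in> Arr \<A>. Dom \<A> f = X \<and> Cod \<A> f = Y}"

definition hom_group :: "('o, 'm) category \<Rightarrow> 'o \<Rightarrow> 'o \<Rightarrow> 'm monoid" where
  "hom_group \<A> X Y = \<lparr>carrier = Hom \<A> X Y, monoid.mult = Add \<A>, one = Zero \<A> X Y\<rparr>"

locale category =
  fixes \<A> :: "('o, 'm) category" (structure)
  assumes Dom_in_Obj: "f \<in> Arr \<A> \<Longrightarrow> Dom \<A> f \<in> Obj \<A>"
    and Cod_in_Obj: "f \<in> Arr \<A> \<Longrightarrow> Cod \<A> f \<in> Obj \<A>"
    and Ident_in_Hom: "X \<in> Obj \<A> \<Longrightarrow> Ident \<A> X \<in> Hom \<A> X X"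
    and Comp_in_Hom: "\<lbrakk>f \<in> Hom \<A> X Y; g \<in> Hom \<A> Y Z\<rbrakk> \<Longrightarrow> g \<cdot> f \<in> Hom \<A> X Z"
    and Comp_Ident: "f \<in> Hom \<A> X Y \<Longrightarrow> f \<cdot> Ident \<A> X = f"
    and Ident_Comp: "f \<in> Hom \<A> X Y \<Longrightarrow> Ident \<A> Y \<cdot> f = f"
    and Comp_assoc: "\<lbrakk>f \<in> Hom \<A> W X; g \<in> Hom \<A> X Y; h \<in> Hom \<A> Y Z\<rbrakk>
      \<Longrightarrow> (h \<cdot> g) \<cdot> f = h \<cdot> (g \<cdot> f)"

locale preadditive_category = category +
  assumes hom_comm_group:
      "\<lbrakk>X \<in> Obj \<A>; Y \<in> Obj \<A>\<rbrakk> \<Longrightarrow> comm_group (hom_group \<A> X Y)"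
    and Comp_Add: "\<lbrakk>f \<in> Hom \<A> X Y; f' \<in> Hom \<A> X Y; g \<in> Hom \<A> Y Z\<rbrakk>
      \<Longrightarrow> g \<cdot> Add \<A> f f' = Add \<A> (g \<cdot> f) (g \<cdot> f')"
    and Add_Comp: "\<lbrakk>f \<in> Hom \<A> X Y; g \<in> Hom \<A> Y Z; g' \<in> Hom \<A> Y Z\<rbrakk>
      \<Longrightarrow> Add \<A> g g' \<cdot> f = Add \<A> (g \<cdot> f) (g' \<cdot> f)"

definition is_zero_object :: "('o, 'm) category \<Rightarrow> 'o \<Rightarrow> bool" where
  "is_zero_object \<A> N \<longleftrightarrow> N \<in> Obj \<A> \<and>
     (\<forall>X\<in>Obj \<A>. (\<exists>!f. f \<in> Hom \<A> N X) \<and> (\<exists>!f. f \<in> Hom \<A> X N))"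

definition is_biproduct ::
    "('o, 'm) category \<Rightarrow> 'o \<Rightarrow> 'o \<Rightarrow> 'o \<Rightarrow> 'm \<Rightarrow> 'm \<Rightarrow> 'm \<Rightarrow> 'm \<Rightarrow> bool" where
  "is_biproduct \<A> X Y S i j p r \<longleftrightarrow>
     i \<in> Hom \<A> X S \<and> j \<in> Hom \<A> Y S \<and> p \<in> Hom \<A> S X \<and> r \<in> Hom \<A> S Y \<and>
     p \<cdot>\<^bsub>\<A>\<^esub> i = Ident \<A> X \<and> r \<cdot>\<^bsub>\<A>\<^esub> j = Ident \<A> Y \<and>
     r \<cdot>\<^bsub>\<A>\<^esub> i = Zero \<A> X Y \<and> p \<cdot>\<^bsub>\<A>\<^esub> j = Zero \<A> Y X \<and>
     Add \<A> (i \<cdot>\<^bsub>\<A>\<^esub> p) (j \<cdot>\<^bsub>\<A>\<^esub> r) = Ident \<A> S"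

definition monic :: "('o, 'm) category \<Rightarrow> 'm \<Rightarrow> bool" where
  "monic \<A> m \<longleftrightarrow> m \<in> Arr \<A> \<and>
     (\<forall>W\<in>Obj \<A>. \<forall>f\<in>Hom \<A> W (Dom \<A> m). \<forall>g\<in>Hom \<A> W (Dom \<A> m).
        m \<cdot>\<^bsub>\<A>\<^esub> f = m \<cdot>\<^bsub>\<A>\<^esub> g \<longrightarrow> f = g)"

definition epic :: "('o, 'm) category \<Rightarrow> 'm \<Rightarrow> bool" where
  "epic \<A> e \<longleftrightarrow> e \<in> Arr \<A> \<and>
     (\<forall>W\<in>Obj \<A>. \<forall>f\<in>Hom \<A> (Cod \<A> e) W. \<forall>g\<in>Hom \<A> (Cod \<A> e) W.
        f \<cdot>\<^bsub>\<A>\<^esub> e = g \<cdot>\<^bsub>\<A>\<^esub> e \<longrightarrow> f = g)"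

definition is_kernel :: "('o, 'm) category \<Rightarrow> 'm \<Rightarrow> 'm \<Rightarrow> bool" where
  "is_kernel \<A> f k \<longleftrightarrow> f \<in> Arr \<A> \<and> k \<in> Arr \<A> \<and> Cod \<A> k = Dom \<A> f \<and>
     f \<cdot>\<^bsub>\<A>\<^esub> k = Zero \<A> (Dom \<A> k) (Cod \<A> f) \<and>
     (\<forall>W\<in>Obj \<A>. \<forall>h\<in>Hom \<A> W (Dom \<A> f). f \<cdot>\<^bsub>\<A>\<^esub> h = Zero \<A> W (Cod \<A> f) \<longrightarrow>
        (\<exists>!u. u \<in> Hom \<A> W (Dom \<A> k) \<and> k \<cdot>\<^bsub>\<A>\<^esub> u = h))"

definition is_cokernel :: "('o, 'm) category \<Rightarrow> 'm \<Rightarrow> 'm \<Rightarrow> bool" where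
  "is_cokernel \<A> f c \<longleftrightarrow> f \<in> Arr \<A> \<and> c \<in> Arr \<A> \<and> Dom \<A> c = Cod \<A> f \<and>
     c \<cdot>\<^bsub>\<A>\<^esub> f = Zero \<A> (Dom \<A> f) (Cod \<A> c) \<and>
     (\<forall>W\<in>Obj \<A>. \<forall>h\<in>Hom \<A> (Cod \<A> f) W. h \<cdot>\<^bsub>\<A>\<^esub> f = Zero \<A> (Dom \<A> f) W \<longrightarrow>
        (\<exists>!u. u \<in> Hom \<A> (Cod \<A> c) W \<and> u \<cdot>\<^bsub>\<A>\<^esub> c = h))"

locale abelian_category = preadditive_category +
  assumes ex_zero_object: "\<exists>N. is_zero_object \<A> N"
    and ex_biproduct:
      "\<lbrakk>X \<in> Obj \<A>; Y \<in> Obj \<A>\<rbrakk> \<Longrightarrow> \<exists>S i j p r. is_biproduct \<A> X Y S i j p r"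
    and ex_kernel: "f \<in> Arr \<A> \<Longrightarrow> \<exists>k. is_kernel \<A> f k"
    and ex_cokernel: "f \<in> Arr \<A> \<Longrightarrow> \<exists>c. is_cokernel \<A> f c"
    and monic_normal: "monic \<A> m \<Longrightarrow> \<exists>f. is_kernel \<A> f m"
    and epic_normal: "epic \<A> e \<Longrightarrow> \<exists>f. is_cokernel \<A> f e"

definition injective_object :: "('o, 'm) category \<Rightarrow> 'o \<Rightarrow> bool" where
  "injective_object \<A> E \<longleftrightarrow> E \<in> Obj \<A> \<and>
     (\<forall>m f. monic \<A> m \<and> f \<in> Hom \<A> (Dom \<A> m) E \<longrightarrow>
        (\<exists>g \<in> Hom \<A> (Cod \<A> m) E. g \<cdot>\<^bsub>\<A>\<^esub> m = f))"

definition enough_injectives :: "('o, 'm) category \<Rightarrow> bool" where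
  "enough_injectives \<A> \<longleftrightarrow>
     (\<forall>X\<in>Obj \<A>. \<exists>E m. injective_object \<A> E \<and> m \<in> Hom \<A> X E \<and> monic \<A> m)"

text \<open>
  Kernels and cokernels are determined only up to unique isomorphism; one of each is chosen for
  every arrow. A kernel is represented by its inclusion and a cokernel by its projection.
\<close>

definition ker_arr :: "('o, 'm) category \<Rightarrow> 'm \<Rightarrow> 'm" where
  "ker_arr \<A> f = (SOME k. is_kernel \<A> f k)"

definition coker_arr :: "('o, 'm) category \<Rightarrow> 'm \<Rightarrow> 'm" where
  "coker_arr \<A> f = (SOME c. is_cokernel \<A> f c)"

definition im_arr :: "('o, 'm) category \<Rightarrow> 'm \<Rightarrow> 'm" where
  "im_arr \<A> f = ker_arr \<A> (coker_arr \<A> f)"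

text \<open>
  Exactness of \<open>X \<rightarrow> Y \<rightarrow> Z\<close> at \<open>Y\<close>: the image of \<open>f\<close> and the kernel of \<open>g\<close> are the same subobject
  of \<open>Y\<close>, i.e. the inclusion of the image is itself a kernel of \<open>g\<close>.
\<close>

definition exact_at :: "('o, 'm) category \<Rightarrow> 'm \<Rightarrow> 'm \<Rightarrow> bool" where
  "exact_at \<A> f g \<longleftrightarrow> f \<in> Arr \<A> \<and> g \<in> Arr \<A> \<and> Cod \<A> f = Dom \<A> g \<and>
     is_kernel \<A> g (im_arr \<A> f)"

text \<open>Exactness of \<open>0 \<rightarrow> X \<rightarrow> E 0 \<rightarrow> E 1 \<rightarrow> \<dots>\<close>.\<close>

definition exact_coresolution ::
    "('o, 'm) category \<Rightarrow> 'o \<Rightarrow> 'm \<Rightarrow> (nat \<Rightarrow> 'o) \<Rightarrow> (nat \<Rightarrow> 'm) \<Rightarrow> bool" where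
  "exact_coresolution \<A> X e E d \<longleftrightarrow>
     e \<in> Hom \<A> X (E 0) \<and> (\<forall>p. d p \<in> Hom \<A> (E p) (E (Suc p))) \<and>
     monic \<A> e \<and> exact_at \<A> e (d 0) \<and> (\<forall>p. exact_at \<A> (d p) (d (Suc p)))"

definition injective_resolution ::
    "('o, 'm) category \<Rightarrow> 'o \<Rightarrow> 'm \<Rightarrow> (nat \<Rightarrow> 'o) \<Rightarrow> (nat \<Rightarrow> 'm) \<Rightarrow> bool" where
  "injective_resolution \<A> X e E d \<longleftrightarrow>
     (\<forall>p. injective_object \<A> (E p)) \<and> exact_coresolution \<A> X e E d"


section \<open>Cochain complexes\<close>

record ('o, 'm) cochain =
  ob :: "int \<Rightarrow> 'o"
  df :: "int \<Rightarrow> 'm"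

definition cochain_complex :: "('o, 'm) category \<Rightarrow> ('o, 'm) cochain \<Rightarrow> bool" where
  "cochain_complex \<A> A \<longleftrightarrow>
     (\<forall>q. ob A q \<in> Obj \<A>) \<and>
     (\<forall>q. df A q \<in> Hom \<A> (ob A q) (ob A (q + 1))) \<and>
     (\<forall>q. df A (q + 1) \<cdot>\<^bsub>\<A>\<^esub> df A q = Zero \<A> (ob A q) (ob A (q + 1 + 1)))"

definition chain_map ::
    "('o, 'm) category \<Rightarrow> ('o, 'm) cochain \<Rightarrow> ('o, 'm) cochain \<Rightarrow> (int \<Rightarrow> 'm) \<Rightarrow> bool" where
  "chain_map \<A> A B f \<longleftrightarrow>
     (\<forall>q. f q \<in> Hom \<A> (ob A q) (ob B q)) \<and>
     (\<forall>q. df B q \<cdot>\<^bsub>\<A>\<^esub> f q = f (q + 1) \<cdot>\<^bsub>\<A>\<^esub> df A q)"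

definition short_exact_complexes ::
    "('o, 'm) category \<Rightarrow> ('o, 'm) cochain \<Rightarrow> (int \<Rightarrow> 'm) \<Rightarrow> ('o, 'm) cochain \<Rightarrow>
     (int \<Rightarrow> 'm) \<Rightarrow> ('o, 'm) cochain \<Rightarrow> bool" where
  "short_exact_complexes \<A> A f B g C \<longleftrightarrow>
     cochain_complex \<A> A \<and> cochain_complex \<A> B \<and> cochain_complex \<A> C \<and>
     chain_map \<A> A B f \<and> chain_map \<A> B C g \<and>
     (\<forall>q. monic \<A> (f q) \<and> exact_at \<A> (f q) (g q) \<and> epic \<A> (g q))"

text \<open>
  The map induced by \<open>h\<close> between the subobjects \<open>m\<close> and \<open>m'\<close>, and the one between the
  quotient objects \<open>c\<close> and \<open>c'\<close>.
\<close>

definition induced_sub :: "('o, 'm) category \<Rightarrow> 'm \<Rightarrow> 'm \<Rightarrow> 'm \<Rightarrow> 'm" where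
  "induced_sub \<A> m m' h =
     (THE u. u \<in> Hom \<A> (Dom \<A> m) (Dom \<A> m') \<and> m' \<cdot>\<^bsub>\<A>\<^esub> u = h \<cdot>\<^bsub>\<A>\<^esub> m)"

definition induced_quot :: "('o, 'm) category \<Rightarrow> 'm \<Rightarrow> 'm \<Rightarrow> 'm \<Rightarrow> 'm" where
  "induced_quot \<A> c c' h =
     (THE u. u \<in> Hom \<A> (Cod \<A> c) (Cod \<A> c') \<and> u \<cdot>\<^bsub>\<A>\<^esub> c = c' \<cdot>\<^bsub>\<A>\<^esub> h)"

definition cocycle_inc :: "('o, 'm) category \<Rightarrow> ('o, 'm) cochain \<Rightarrow> int \<Rightarrow> 'm" where
  "cocycle_inc \<A> A q = ker_arr \<A> (df A q)"

definition cobound_inc :: "('o, 'm) category \<Rightarrow> ('o, 'm) cochain \<Rightarrow> int \<Rightarrow> 'm" where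
  "cobound_inc \<A> A q = im_arr \<A> (df A (q - 1))"

definition cobound_to_cocycle :: "('o, 'm) category \<Rightarrow> ('o, 'm) cochain \<Rightarrow> int \<Rightarrow> 'm" where
  "cobound_to_cocycle \<A> A q =
     induced_sub \<A> (cobound_inc \<A> A q) (cocycle_inc \<A> A q) (Ident \<A> (ob A q))"

definition cohom_proj :: "('o, 'm) category \<Rightarrow> ('o, 'm) cochain \<Rightarrow> int \<Rightarrow> 'm" where
  "cohom_proj \<A> A q = coker_arr \<A> (cobound_to_cocycle \<A> A q)"

definition cocycles :: "('o, 'm) category \<Rightarrow> ('o, 'm) cochain \<Rightarrow> int \<Rightarrow> 'o" where
  "cocycles \<A> A q = Dom \<A> (cocycle_inc \<A> A q)"

definition cobounds :: "('o, 'm) category \<Rightarrow> ('o, 'm) cochain \<Rightarrow> int \<Rightarrow> 'o" where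
  "cobounds \<A> A q = Dom \<A> (cobound_inc \<A> A q)"

definition cohom :: "('o, 'm) category \<Rightarrow> ('o, 'm) cochain \<Rightarrow> int \<Rightarrow> 'o" where
  "cohom \<A> A q = Cod \<A> (cohom_proj \<A> A q)"

definition cocycles_map :: "('o, 'm) category \<Rightarrow> ('o, 'm) cochain \<Rightarrow> ('o, 'm) cochain \<Rightarrow>
    (int \<Rightarrow> 'm) \<Rightarrow> int \<Rightarrow> 'm" where
  "cocycles_map \<A> A B f q = induced_sub \<A> (cocycle_inc \<A> A q) (cocycle_inc \<A> B q) (f q)"

definition cobounds_map :: "('o, 'm) category \<Rightarrow> ('o, 'm) cochain \<Rightarrow> ('o, 'm) cochain \<Rightarrow>
    (int \<Rightarrow> 'm) \<Rightarrow> int \<Rightarrow> 'm" where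
  "cobounds_map \<A> A B f q = induced_sub \<A> (cobound_inc \<A> A q) (cobound_inc \<A> B q) (f q)"

definition cohom_map :: "('o, 'm) category \<Rightarrow> ('o, 'm) cochain \<Rightarrow> ('o, 'm) cochain \<Rightarrow>
    (int \<Rightarrow> 'm) \<Rightarrow> int \<Rightarrow> 'm" where
  "cohom_map \<A> A B f q =
     induced_quot \<A> (cohom_proj \<A> A q) (cohom_proj \<A> B q) (cocycles_map \<A> A B f q)"


section \<open>Cartan-Eilenberg resolutions\<close>

text \<open>
  \<open>cpx R p\<close> is the complex in resolution degree \<open>p\<close>, \<open>aug R\<close> the augmentation from the
  resolved complex to \<open>cpx R 0\<close>, and \<open>step R p\<close> the map from \<open>cpx R p\<close> to
  \<open>cpx R (p + 1)\<close>.
\<close>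

record ('o, 'm) coresolution =
  cpx :: "nat \<Rightarrow> ('o, 'm) cochain"
  aug :: "int \<Rightarrow> 'm"
  step :: "nat \<Rightarrow> int \<Rightarrow> 'm"

definition CE_resolution ::
    "('o, 'm) category \<Rightarrow> ('o, 'm) cochain \<Rightarrow> ('o, 'm) coresolution \<Rightarrow> bool" where
  "CE_resolution \<A> A R \<longleftrightarrow>
     cochain_complex \<A> A \<and> (\<forall>p. cochain_complex \<A> (cpx R p)) \<and>
     chain_map \<A> A (cpx R 0) (aug R) \<and>
     (\<forall>p. chain_map \<A> (cpx R p) (cpx R (Suc p)) (step R p)) \<and>
     (\<forall>p q. injective_object \<A> (ob (cpx R p) q)) \<and>
     (\<forall>q. exact_coresolution \<A> (ob A q) (aug R q) (\<lambda>p. ob (cpx R p) q) (\<lambda>p. step R p q)) \<and>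
     (\<forall>q. injective_resolution \<A> (cocycles \<A> A q)
        (cocycles_map \<A> A (cpx R 0) (aug R) q)
        (\<lambda>p. cocycles \<A> (cpx R p) q)
        (\<lambda>p. cocycles_map \<A> (cpx R p) (cpx R (Suc p)) (step R p) q)) \<and>
     (\<forall>q. injective_resolution \<A> (cobounds \<A> A q)
        (cobounds_map \<A> A (cpx R 0) (aug R) q)
        (\<lambda>p. cobounds \<A> (cpx R p) q)
        (\<lambda>p. cobounds_map \<A> (cpx R p) (cpx R (Suc p)) (step R p) q)) \<and>
     (\<forall>q. injective_resolution \<A> (cohom \<A> A q)
        (cohom_map \<A> A (cpx R 0) (aug R) q)
        (\<lambda>p. cohom \<A> (cpx R p) q)
        (\<lambda>p. cohom_map \<A> (cpx R p) (cpx R (Suc p)) (step R p) q))"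

text \<open>
  A family of chain maps \<open>\<phi> p\<close> between the terms of resolutions \<open>R\<close> and \<open>S\<close>, lying over the
  chain map \<open>f\<close> of the resolved complexes and commuting with all structure maps.
\<close>

definition coresolution_map ::
    "('o, 'm) category \<Rightarrow> (int \<Rightarrow> 'm) \<Rightarrow> ('o, 'm) coresolution \<Rightarrow> ('o, 'm) coresolution \<Rightarrow>
     (nat \<Rightarrow> int \<Rightarrow> 'm) \<Rightarrow> bool" where
  "coresolution_map \<A> f R S \<phi> \<longleftrightarrow>
     (\<forall>p. chain_map \<A> (cpx R p) (cpx S p) (\<phi> p)) \<and>
     (\<forall>q. \<phi> 0 q \<cdot>\<^bsub>\<A>\<^esub> aug R q = aug S q \<cdot>\<^bsub>\<A>\<^esub> f q) \<and>
     (\<forall>p q. \<phi> (Suc p) q \<cdot>\<^bsub>\<A>\<^esub> step R p q = step S p q \<cdot>\<^bsub>\<A>\<^esub> \<phi> p q)"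

end

theory Submission
  imports Defs
begin

text \<open>
  With enough injectives, every exactness statement can be tested on maps into injective objects:
  \<open>X \<rightarrow> Y \<rightarrow> Z\<close> is exact iff the maps \<open>Y \<rightarrow> E\<close> killing \<open>X\<close> are those that factor through \<open>Z\<close>, for all
  injective \<open>E\<close>. Diagrams can therefore be chased with such maps in place of elements.

  A monomorphism \<open>A \<rightarrow> I\<close> of complexes induces short exact sequences on cocycles, coboundaries and
  cohomology as soon as every injective-valued map on \<open>A\<^sup>q\<close> that kills the coboundaries extends to such
  a map on \<open>I\<^sup>q\<close>. If all \<open>I\<^sup>q\<close> are injective and \<open>d s d = d\<close> for some \<open>s\<close>, the cocycles, coboundaries and
  cohomology of \<open>I\<close> are retracts, hence injective. So it suffices to embed the given short exact
  sequence \<open>A \<rightarrow> B \<rightarrow> C\<close> in this sense into a short exact sequence of such complexes, and to iterate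
  with the cokernels. The target is a direct sum of five pieces. Let \<open>S(E)\<close> be a family \<open>E\<close> of injectives with
  zero differential and \<open>D(E)\<close> the contractible complex \<open>E\<^sup>q \<oplus> E\<^sup>q\<^sup>+\<^sup>1\<close>; the pieces are
  \<open>S = S \<rightarrow> 0\<close> with \<open>E\<^sup>q \<supseteq> B\<^sup>q / dB\<^sup>q\<^sup>-\<^sup>1\<close>, \<open>0 \<rightarrow> S = S\<close> with \<open>E\<^sup>q \<supseteq> C\<^sup>q / dC\<^sup>q\<^sup>-\<^sup>1\<close>,
  \<open>D = D \<rightarrow> 0\<close> with \<open>E\<^sup>q \<supseteq> B\<^sup>q\<close>, \<open>0 \<rightarrow> D = D\<close> with \<open>E\<^sup>q \<supseteq> C\<^sup>q\<close>, and
  \<open>S(E) \<rightarrow> D(E) \<rightarrow> S(E[1])\<close> with \<open>E\<^sup>q \<supseteq> B\<^sup>q / dA\<^sup>q\<^sup>-\<^sup>1\<close>. The last three may use \<open>E\<^sup>q = 0\<close> when the sequence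
  vanishes in degree \<open>q - 1\<close>, which makes the target vanish wherever the given sequence does.
\<close>

section \<open>Composition and subtraction of arrows\<close>

text \<open>The obstacle is that a short exact sequence of complexes yields only a long exact
  sequence in cohomology, and its cocycles and coboundaries need not form short exact sequences
  either. All three complexes are embedded at once instead, and the target has to accommodate a
  nonzero connecting homomorphism; the piece S(E) -> D(E) -> S(E[1]) provides it. A map on A^q that
  kills dA^(q-1) extends to B^q, but the extension need not kill dB^(q-1), which is why this piece
  starts from B^q / dA^(q-1). The exception for vanishing degrees has a similar origin. D(E)
  contains E^q in degree q - 1 as well as in degree q, so a nonzero E^q would destroy vanishing in
  degree q - 1. If the sequence vanishes there, every map on degree q kills the coboundaries
  trivially, and the two pieces with zero differential already do all the work.\<close>

lemma Hom_iff: "f \<in> Hom \<A> X Y \<longleftrightarrow> f \<in> Arr \<A> \<and> Dom \<A> f = X \<and> Cod \<A> f = Y"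
  by (auto simp: Hom_def)

context category
begin

lemma Arr_Comp [simp]:
  assumes "f \<in> Arr \<A>" "g \<in> Arr \<A>" "Cod \<A> f = Dom \<A> g"
  shows "g \<cdot> f \<in> Arr \<A>" "Dom \<A> (g \<cdot> f) = Dom \<A> f" "Cod \<A> (g \<cdot> f) = Cod \<A> g"
  using Comp_in_Hom[of f "Dom \<A> f" "Cod \<A> f" g "Cod \<A> g"] assms by (auto simp: Hom_iff)

lemma Arr_Ident [simp]:
  assumes "X \<in> Obj \<A>"
  shows "Ident \<A> X \<in> Arr \<A>" "Dom \<A> (Ident \<A> X) = X" "Cod \<A> (Ident \<A> X) = X"
  using Ident_in_Hom[OF assms] by (auto simp: Hom_iff)

text \<open>Composites are normalised to right-nested form. Equations between composites are
  therefore often restated below with a trailing arrow \<open>h\<close>, as in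
  \<open>biprod_Comp_Comp\<close> and \<open>commute_Comp\<close>, so that they still match inside a
  longer composite.\<close>

lemma assoc [simp]:
  assumes "f \<in> Arr \<A>" "g \<in> Arr \<A>" "h \<in> Arr \<A>" "Cod \<A> f = Dom \<A> g" "Cod \<A> g = Dom \<A> h"
  shows "(h \<cdot> g) \<cdot> f = h \<cdot> (g \<cdot> f)"
  using Comp_assoc assms by (auto simp: Hom_iff)

lemma unit_right [simp]: "\<lbrakk>f \<in> Arr \<A>; Dom \<A> f = X\<rbrakk> \<Longrightarrow> f \<cdot> Ident \<A> X = f"
  using Comp_Ident by (auto simp: Hom_iff)

lemma unit_left [simp]: "\<lbrakk>f \<in> Arr \<A>; Cod \<A> f = X\<rbrakk> \<Longrightarrow> Ident \<A> X \<cdot> f = f"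
  using Ident_Comp by (auto simp: Hom_iff)

lemma Hom_Obj: "f \<in> Hom \<A> X Y \<Longrightarrow> X \<in> Obj \<A>" "f \<in> Hom \<A> X Y \<Longrightarrow> Y \<in> Obj \<A>"
  using Dom_in_Obj Cod_in_Obj by (auto simp: Hom_iff)

end

context preadditive_category
begin

definition neg :: "'b \<Rightarrow> 'b" where
  "neg f = inv\<^bsub>hom_group \<A> (Dom \<A> f) (Cod \<A> f)\<^esub> f"

definition diff :: "'b \<Rightarrow> 'b \<Rightarrow> 'b" where
  "diff f g = Add \<A> f (neg g)"

lemma hom_comm_group': "f \<in> Arr \<A> \<Longrightarrow> comm_group (hom_group \<A> (Dom \<A> f) (Cod \<A> f))"
  by (simp add: hom_comm_group Dom_in_Obj Cod_in_Obj)

lemma Arr_Add [simp]: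
  assumes "f \<in> Arr \<A>" "g \<in> Arr \<A>" "Dom \<A> f = Dom \<A> g" "Cod \<A> f = Cod \<A> g"
  shows "Add \<A> f g \<in> Arr \<A>" "Dom \<A> (Add \<A> f g) = Dom \<A> g" "Cod \<A> (Add \<A> f g) = Cod \<A> g"
proof -
  interpret G: comm_group "hom_group \<A> (Dom \<A> g) (Cod \<A> g)" by (rule hom_comm_group'[OF assms(2)])
  have "Add \<A> f g \<in> Hom \<A> (Dom \<A> g) (Cod \<A> g)"
    using G.m_closed[of f g] assms by (simp add: hom_group_def Hom_iff)
  then show "Add \<A> f g \<in> Arr \<A>" "Dom \<A> (Add \<A> f g) = Dom \<A> g" "Cod \<A> (Add \<A> f g) = Cod \<A> g"
    by (auto simp: Hom_iff)
qed

lemma Arr_Zero [simp]: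
  assumes "X \<in> Obj \<A>" "Y \<in> Obj \<A>"
  shows "Zero \<A> X Y \<in> Arr \<A>" "Dom \<A> (Zero \<A> X Y) = X" "Cod \<A> (Zero \<A> X Y) = Y"
proof -
  interpret G: comm_group "hom_group \<A> X Y" by (rule hom_comm_group[OF assms])
  have "Zero \<A> X Y \<in> Hom \<A> X Y"
    using G.one_closed by (simp add: hom_group_def)
  then show "Zero \<A> X Y \<in> Arr \<A>" "Dom \<A> (Zero \<A> X Y) = X" "Cod \<A> (Zero \<A> X Y) = Y"
    by (auto simp: Hom_iff)
qed

lemma Arr_neg [simp]:
  assumes "f \<in> Arr \<A>"
  shows "neg f \<in> Arr \<A>" "Dom \<A> (neg f) = Dom \<A> f" "Cod \<A> (neg f) = Cod \<A> f"
proof -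
  interpret G: comm_group "hom_group \<A> (Dom \<A> f) (Cod \<A> f)" by (rule hom_comm_group'[OF assms])
  have "neg f \<in> Hom \<A> (Dom \<A> f) (Cod \<A> f)"
    using G.inv_closed[of f] assms by (simp add: hom_group_def Hom_iff neg_def)
  then show "neg f \<in> Arr \<A>" "Dom \<A> (neg f) = Dom \<A> f" "Cod \<A> (neg f) = Cod \<A> f"
    by (auto simp: Hom_iff)
qed

lemma Arr_diff [simp]:
  assumes "f \<in> Arr \<A>" "g \<in> Arr \<A>" "Dom \<A> f = Dom \<A> g" "Cod \<A> f = Cod \<A> g"
  shows "diff f g \<in> Arr \<A>" "Dom \<A> (diff f g) = Dom \<A> g" "Cod \<A> (diff f g) = Cod \<A> g"
  using assms by (simp_all add: diff_def)

lemma Add_assoc: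
  assumes "f \<in> Hom \<A> X Y" "g \<in> Hom \<A> X Y" "h \<in> Hom \<A> X Y"
  shows "Add \<A> (Add \<A> f g) h = Add \<A> f (Add \<A> g h)"
proof -
  interpret G: comm_group "hom_group \<A> X Y" using hom_comm_group Hom_Obj assms by blast
  show ?thesis using G.m_assoc[of f g h] assms by (simp add: hom_group_def)
qed

lemma Add_Zero [simp]:
  assumes "f \<in> Arr \<A>" "Dom \<A> f = X" "Cod \<A> f = Y"
  shows "Add \<A> f (Zero \<A> X Y) = f" "Add \<A> (Zero \<A> X Y) f = f"
proof -
  interpret G: comm_group "hom_group \<A> X Y" using hom_comm_group' assms by blast
  show "Add \<A> f (Zero \<A> X Y) = f" "Add \<A> (Zero \<A> X Y) f = f"
    using G.r_one[of f] G.l_one[of f] assms by (simp_all add: hom_group_def Hom_iff)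
qed

lemma Add_neg [simp]:
  assumes "f \<in> Arr \<A>"
  shows "Add \<A> f (neg f) = Zero \<A> (Dom \<A> f) (Cod \<A> f)"
    "Add \<A> (neg f) f = Zero \<A> (Dom \<A> f) (Cod \<A> f)"
proof -
  interpret G: comm_group "hom_group \<A> (Dom \<A> f) (Cod \<A> f)" by (rule hom_comm_group'[OF assms])
  show "Add \<A> f (neg f) = Zero \<A> (Dom \<A> f) (Cod \<A> f)"
    "Add \<A> (neg f) f = Zero \<A> (Dom \<A> f) (Cod \<A> f)"
    using G.r_inv[of f] G.l_inv[of f] assms by (simp_all add: hom_group_def Hom_iff neg_def)
qed

text \<open>The preadditive axioms speak of sums only. A composite with a zero arrow is zero because
  bilinearity makes it idempotent under \<open>Add\<close>.\<close>

lemma Add_idem_Zero: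
  assumes "f \<in> Hom \<A> X Y" "Add \<A> f f = f"
  shows "f = Zero \<A> X Y"
proof -
  have "Add \<A> (Add \<A> f f) (neg f) = Add \<A> f (Add \<A> f (neg f))"
    using assms(1) by (intro Add_assoc[of _ X Y]) (auto simp: Hom_iff)
  then show ?thesis using assms by (auto simp: Hom_iff)
qed

lemma Comp_Zero [simp]:
  assumes "g \<in> Arr \<A>" "X \<in> Obj \<A>" "Dom \<A> g = Y"
  shows "g \<cdot> Zero \<A> X Y = Zero \<A> X (Cod \<A> g)"
proof -
  have Y: "Y \<in> Obj \<A>" "Cod \<A> g \<in> Obj \<A>" using assms Dom_in_Obj Cod_in_Obj by auto
  have "g \<cdot> Add \<A> (Zero \<A> X Y) (Zero \<A> X Y)
      = Add \<A> (g \<cdot> Zero \<A> X Y) (g \<cdot> Zero \<A> X Y)"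
    using assms Y by (intro Comp_Add[of _ X Y _ _ "Cod \<A> g"]) (auto simp: Hom_iff)
  then show ?thesis using assms Y by (intro Add_idem_Zero) (auto simp: Hom_iff)
qed

lemma Zero_Comp [simp]:
  assumes "f \<in> Arr \<A>" "Z \<in> Obj \<A>" "Cod \<A> f = Y"
  shows "Zero \<A> Y Z \<cdot> f = Zero \<A> (Dom \<A> f) Z"
proof -
  have Y: "Y \<in> Obj \<A>" "Dom \<A> f \<in> Obj \<A>" using assms Dom_in_Obj Cod_in_Obj by auto
  have "Add \<A> (Zero \<A> Y Z) (Zero \<A> Y Z) \<cdot> f
      = Add \<A> (Zero \<A> Y Z \<cdot> f) (Zero \<A> Y Z \<cdot> f)"
    using assms Y by (intro Add_Comp[of _ "Dom \<A> f" Y _ Z]) (auto simp: Hom_iff)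
  then show ?thesis using assms Y by (intro Add_idem_Zero) (auto simp: Hom_iff)
qed

lemma Comp_Add' [simp]:
  assumes "f \<in> Arr \<A>" "f' \<in> Arr \<A>" "g \<in> Arr \<A>"
    "Dom \<A> f = Dom \<A> f'" "Cod \<A> f = Cod \<A> f'" "Cod \<A> f' = Dom \<A> g"
  shows "g \<cdot> Add \<A> f f' = Add \<A> (g \<cdot> f) (g \<cdot> f')"
  using assms by (intro Comp_Add[of _ "Dom \<A> f" "Cod \<A> f" _ _ "Cod \<A> g"]) (auto simp: Hom_iff)

lemma Add_Comp' [simp]:
  assumes "f \<in> Arr \<A>" "g \<in> Arr \<A>" "g' \<in> Arr \<A>"
    "Dom \<A> g = Dom \<A> g'" "Cod \<A> g = Cod \<A> g'" "Cod \<A> f = Dom \<A> g'"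
  shows "Add \<A> g g' \<cdot> f = Add \<A> (g \<cdot> f) (g' \<cdot> f)"
  using assms by (intro Add_Comp[of _ "Dom \<A> f" "Dom \<A> g" _ "Cod \<A> g"]) (auto simp: Hom_iff)

lemma Add_neg_unique:
  assumes "f \<in> Hom \<A> X Y" "g \<in> Hom \<A> X Y" "Add \<A> f g = Zero \<A> X Y"
  shows "f = neg g"
proof -
  have "Add \<A> (Add \<A> f g) (neg g) = Add \<A> f (Add \<A> g (neg g))"
    using assms by (intro Add_assoc[of _ X Y]) (auto simp: Hom_iff)
  then show ?thesis using assms by (auto simp: Hom_iff)
qed

lemma neg_neg [simp]: "f \<in> Arr \<A> \<Longrightarrow> neg (neg f) = f"
  using Add_neg_unique[of f "Dom \<A> f" "Cod \<A> f" "neg f"] by (simp add: Hom_iff)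

lemma Comp_neg [simp]:
  assumes "f \<in> Arr \<A>" "g \<in> Arr \<A>" "Cod \<A> f = Dom \<A> g"
  shows "g \<cdot> neg f = neg (g \<cdot> f)"
proof (rule Add_neg_unique)
  have "Add \<A> (g \<cdot> neg f) (g \<cdot> f) = g \<cdot> Add \<A> (neg f) f"
    using assms by (subst Comp_Add') auto
  then show "Add \<A> (g \<cdot> neg f) (g \<cdot> f) = Zero \<A> (Dom \<A> f) (Cod \<A> g)"
    using assms Dom_in_Obj[of f] by (simp del: Comp_Add')
qed (use assms in \<open>auto simp: Hom_iff\<close>)

lemma neg_Comp [simp]:
  assumes "f \<in> Arr \<A>" "g \<in> Arr \<A>" "Cod \<A> f = Dom \<A> g"
  shows "neg g \<cdot> f = neg (g \<cdot> f)"
proof (rule Add_neg_unique)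
  have "Add \<A> (neg g \<cdot> f) (g \<cdot> f) = Add \<A> (neg g) g \<cdot> f"
    using assms by (subst Add_Comp') auto
  then show "Add \<A> (neg g \<cdot> f) (g \<cdot> f) = Zero \<A> (Dom \<A> f) (Cod \<A> g)"
    using assms Cod_in_Obj[of g] by (simp del: Add_Comp')
qed (use assms in \<open>auto simp: Hom_iff\<close>)

lemma Comp_diff [simp]:
  assumes "f \<in> Arr \<A>" "f' \<in> Arr \<A>" "g \<in> Arr \<A>"
    "Dom \<A> f = Dom \<A> f'" "Cod \<A> f = Cod \<A> f'" "Cod \<A> f' = Dom \<A> g"
  shows "g \<cdot> diff f f' = diff (g \<cdot> f) (g \<cdot> f')"
  using assms by (simp add: diff_def)

lemma diff_Comp [simp]:
  assumes "f \<in> Arr \<A>" "g \<in> Arr \<A>" "g' \<in> Arr \<A>"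
    "Dom \<A> g = Dom \<A> g'" "Cod \<A> g = Cod \<A> g'" "Cod \<A> f = Dom \<A> g'"
  shows "diff g g' \<cdot> f = diff (g \<cdot> f) (g' \<cdot> f)"
  using assms by (simp add: diff_def)

lemma diff_self [simp]:
  assumes "f \<in> Arr \<A>"
  shows "diff f f = Zero \<A> (Dom \<A> f) (Cod \<A> f)"
  using assms by (simp add: diff_def)

lemma diff_eq_Zero_iff:
  assumes "f \<in> Hom \<A> X Y" "g \<in> Hom \<A> X Y"
  shows "diff f g = Zero \<A> X Y \<longleftrightarrow> f = g"
  using Add_neg_unique[of f X Y "neg g"] assms by (auto simp: diff_def Hom_iff)

lemma diff_Zero [simp]:
  assumes "f \<in> Arr \<A>" "Dom \<A> f = X" "Cod \<A> f = Y"
  shows "diff f (Zero \<A> X Y) = f"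
proof -
  have "X \<in> Obj \<A>" "Y \<in> Obj \<A>" using assms Dom_in_Obj Cod_in_Obj by auto
  then have "Zero \<A> X Y = neg (Zero \<A> X Y)"
    by (intro Add_neg_unique[of _ X Y]) (auto simp: Hom_iff)
  then show ?thesis using assms by (simp add: diff_def)
qed

lemma Add_diff_cancel:
  assumes "f \<in> Hom \<A> X Y" "g \<in> Hom \<A> X Y"
  shows "Add \<A> (diff f g) g = f"
  using Add_assoc[of f X Y "neg g" g] assms by (auto simp: Hom_iff diff_def)

end

section \<open>Testing exactness by maps into injective objects\<close>

lemma injective_object_Obj: "injective_object \<A> E \<Longrightarrow> E \<in> Obj \<A>"
  by (simp add: injective_object_def)

lemma injective_objectE:
  assumes "injective_object \<A> E" "monic \<A> m" "m \<in> Hom \<A> X Y" "f \<in> Hom \<A> X E"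
  obtains g where "g \<in> Hom \<A> Y E" "g \<cdot>\<^bsub>\<A>\<^esub> m = f"
proof -
  have "Dom \<A> m = X" "Cod \<A> m = Y" using assms(3) by (simp_all add: Hom_iff)
  then show thesis using assms that unfolding injective_object_def by blast
qed

locale abelian_enough_injectives = abelian_category +
  assumes enough: "enough_injectives \<A>"
begin

lemma monicD:
  assumes "monic \<A> m" "m \<in> Hom \<A> X Y" "f \<in> Hom \<A> W X" "g \<in> Hom \<A> W X" "m \<cdot> f = m \<cdot> g"
  shows "f = g"
proof -
  have "Dom \<A> m = X" using assms(2) by (simp add: Hom_iff)
  then show ?thesis using assms Hom_Obj[OF assms(3)] unfolding monic_def by blast
qed

lemma epicD:
  assumes "epic \<A> e" "e \<in> Hom \<A> X Y" "f \<in> Hom \<A> Y W" "g \<in> Hom \<A> Y W" "f \<cdot> e = g \<cdot> e"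
  shows "f = g"
proof -
  have "Cod \<A> e = Y" using assms(2) by (simp add: Hom_iff)
  then show ?thesis using assms Hom_Obj[OF assms(3)] unfolding epic_def by blast
qed

lemma kernel_univ:
  assumes "is_kernel \<A> f k" "f \<in> Hom \<A> X Y" "h \<in> Hom \<A> W X" "f \<cdot> h = Zero \<A> W Y"
  shows "\<exists>!u. u \<in> Hom \<A> W (Dom \<A> k) \<and> k \<cdot> u = h"
proof -
  have "Dom \<A> f = X" "Cod \<A> f = Y" using assms(2) by (simp_all add: Hom_iff)
  then show ?thesis using assms Hom_Obj[OF assms(3)] unfolding is_kernel_def by blast
qed

lemma cokernel_univ:
  assumes "is_cokernel \<A> f c" "f \<in> Hom \<A> X Y" "h \<in> Hom \<A> Y W" "h \<cdot> f = Zero \<A> X W"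
  shows "\<exists>!u. u \<in> Hom \<A> (Cod \<A> c) W \<and> u \<cdot> c = h"
proof -
  have "Dom \<A> f = X" "Cod \<A> f = Y" using assms(2) by (simp_all add: Hom_iff)
  then show ?thesis using assms Hom_Obj[OF assms(3)] unfolding is_cokernel_def by blast
qed

lemma kernelD:
  assumes "is_kernel \<A> f k" "f \<in> Hom \<A> X Y"
  shows "k \<in> Hom \<A> (Dom \<A> k) X" "f \<cdot> k = Zero \<A> (Dom \<A> k) Y" "monic \<A> k"
proof -
  show k: "k \<in> Hom \<A> (Dom \<A> k) X" "f \<cdot> k = Zero \<A> (Dom \<A> k) Y"
    using assms unfolding is_kernel_def Hom_iff by auto
  show "monic \<A> k"
    unfolding monic_def
  proof (intro conjI ballI impI)
    fix W g h assume W: "W \<in> Obj \<A>" and g: "g \<in> Hom \<A> W (Dom \<A> k)" and h: "h \<in> Hom \<A> W (Dom \<A> k)"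
      and eq: "k \<cdot> g = k \<cdot> h"
    have Y: "Y \<in> Obj \<A>" using Hom_Obj assms(2) by blast
    have "f \<cdot> k \<cdot> g = Zero \<A> (Dom \<A> k) Y \<cdot> g" using k by simp
    then have "f \<cdot> (k \<cdot> g) = Zero \<A> W Y"
      using g k(1) assms(2) Y by (simp add: Hom_iff)
    moreover have "k \<cdot> g \<in> Hom \<A> W X" using g k by (simp add: Hom_iff)
    ultimately have "\<exists>!u. u \<in> Hom \<A> W (Dom \<A> k) \<and> k \<cdot> u = k \<cdot> g"
      by (intro kernel_univ[OF assms])
    then show "g = h" using g h eq by metis
  qed (use k in \<open>simp add: Hom_iff\<close>)
qed

lemma kernelE:
  assumes "is_kernel \<A> f k" "f \<in> Hom \<A> X Y" "h \<in> Hom \<A> W X" "f \<cdot> h = Zero \<A> W Y"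
  obtains u where "u \<in> Hom \<A> W (Dom \<A> k)" "k \<cdot> u = h"
  using kernel_univ[OF assms] that by blast

lemma cokernelD:
  assumes "is_cokernel \<A> f c" "f \<in> Hom \<A> X Y"
  shows "c \<in> Hom \<A> Y (Cod \<A> c)" "c \<cdot> f = Zero \<A> X (Cod \<A> c)" "epic \<A> c"
proof -
  show c: "c \<in> Hom \<A> Y (Cod \<A> c)" "c \<cdot> f = Zero \<A> X (Cod \<A> c)"
    using assms unfolding is_cokernel_def Hom_iff by auto
  show "epic \<A> c"
    unfolding epic_def
  proof (intro conjI ballI impI)
    fix W g h assume W: "W \<in> Obj \<A>" and g: "g \<in> Hom \<A> (Cod \<A> c) W" and h: "h \<in> Hom \<A> (Cod \<A> c) W"
      and eq: "g \<cdot> c = h \<cdot> c"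
    have X: "X \<in> Obj \<A>" using Hom_Obj assms(2) by blast
    have "g \<cdot> c \<cdot> f = Zero \<A> X W"
      using g c assms(2) X by (simp add: Hom_iff)
    moreover have "g \<cdot> c \<in> Hom \<A> Y W" using g c by (simp add: Hom_iff)
    ultimately have "\<exists>!u. u \<in> Hom \<A> (Cod \<A> c) W \<and> u \<cdot> c = g \<cdot> c"
      by (intro cokernel_univ[OF assms])
    then show "g = h" using g h eq by metis
  qed (use c in \<open>simp add: Hom_iff\<close>)
qed

lemma cokernelE:
  assumes "is_cokernel \<A> f c" "f \<in> Hom \<A> X Y" "h \<in> Hom \<A> Y W" "h \<cdot> f = Zero \<A> X W"
  obtains u where "u \<in> Hom \<A> (Cod \<A> c) W" "u \<cdot> c = h"
  using cokernel_univ[OF assms] that by blast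

lemma is_kernel_ker_arr: "f \<in> Arr \<A> \<Longrightarrow> is_kernel \<A> f (ker_arr \<A> f)"
  unfolding ker_arr_def using ex_kernel by (rule someI_ex)

lemma is_cokernel_coker_arr: "f \<in> Arr \<A> \<Longrightarrow> is_cokernel \<A> f (coker_arr \<A> f)"
  unfolding coker_arr_def using ex_cokernel by (rule someI_ex)

lemma monic_Comp:
  assumes "monic \<A> m" "monic \<A> n" "m \<in> Hom \<A> X Y" "n \<in> Hom \<A> Y Z"
  shows "monic \<A> (n \<cdot> m)"
  unfolding monic_def
proof (intro conjI ballI impI)
  fix W f g assume f: "f \<in> Hom \<A> W (Dom \<A> (n \<cdot> m))" "g \<in> Hom \<A> W (Dom \<A> (n \<cdot> m))"
    and eq: "n \<cdot> m \<cdot> f = n \<cdot> m \<cdot> g"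
  have "m \<cdot> f = m \<cdot> g"
   by - (rule monicD[OF assms(2,4)]; use f assms eq in \<open>auto simp: Hom_iff\<close>)
  then show "f = g"
   by - (rule monicD[OF assms(1,3)]; use f assms in \<open>auto simp: Hom_iff\<close>)
qed (use assms in \<open>auto simp: Hom_iff\<close>)

text \<open>The delicate part of the image factorisation is that \<open>e\<close> is epic, i.e. that
  a map \<open>t\<close> killing \<open>e\<close> is zero. The kernel \<open>k\<close> of
  \<open>t\<close> absorbs \<open>e\<close>, so \<open>g\<close> factors through the subobject
  \<open>m \<cdot> k\<close> of its image \<open>m\<close>. As \<open>m\<close> is the kernel of the
  cokernel of \<open>g\<close>, this subobject is already all of \<open>m\<close>; hence
  \<open>k\<close> has a right inverse and \<open>t\<close> vanishes.\<close>

lemma im_arr_factor: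
  assumes g: "g \<in> Hom \<A> X Y"
  obtains e where "e \<in> Hom \<A> X (Dom \<A> (im_arr \<A> g))" "im_arr \<A> g \<cdot> e = g" "epic \<A> e"
proof -
  define c where "c = coker_arr \<A> g"
  define m where "m = im_arr \<A> g"
  note c = is_cokernel_coker_arr[of g, folded c_def]
  have c': "is_cokernel \<A> g c" using c g by (simp add: Hom_iff)
  note cD = cokernelD[OF c' g]
  have km: "is_kernel \<A> c m"
    unfolding m_def im_arr_def c_def[symmetric] using cD by (intro is_kernel_ker_arr) (simp add: Hom_iff)
  note mD = kernelD[OF km cD(1)]
  obtain e where e: "e \<in> Hom \<A> X (Dom \<A> m)" "m \<cdot> e = g"
    using kernelE[OF km cD(1) g cD(2)] by blast
  have *: "t = Zero \<A> (Dom \<A> m) T"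
    if t: "t \<in> Hom \<A> (Dom \<A> m) T" and te: "t \<cdot> e = Zero \<A> X T" for t T
  proof -
    obtain k where k: "is_kernel \<A> t k" using ex_kernel t by (auto simp: Hom_iff)
    note kD = kernelD[OF k t]
    obtain e' where e': "e' \<in> Hom \<A> X (Dom \<A> k)" "k \<cdot> e' = e"
      using kernelE[OF k t e(1) te] by blast
    \<comment> \<open>Normality of monics enters here: \<open>m \<cdot> k\<close> is the kernel of
      some \<open>s\<close>, so \<open>m\<close> factors through it once \<open>s\<close> is seen to
      kill \<open>m\<close>.\<close>
    have "monic \<A> (m \<cdot> k)" using monic_Comp[OF kD(3) mD(3) kD(1) mD(1)] .
    then obtain s where s: "is_kernel \<A> s (m \<cdot> k)" using monic_normal by blast
    have sH: "s \<in> Hom \<A> Y (Cod \<A> s)"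
      using s mD(1) kD(1) unfolding is_kernel_def by (auto simp: Hom_iff)
    note sD = kernelD[OF s sH]
    have S: "Cod \<A> s \<in> Obj \<A>" using Hom_Obj sH by blast
    have "s \<cdot> g = (s \<cdot> (m \<cdot> k)) \<cdot> e'"
      using sH mD(1) kD(1) e' e(2) by (simp add: Hom_iff)
    also have "\<dots> = Zero \<A> X (Cod \<A> s)"
      unfolding sD(2) using mD(1) kD(1) e' S by (simp add: Hom_iff)
    finally have "s \<cdot> g = Zero \<A> X (Cod \<A> s)" .
    then obtain s' where s': "s' \<in> Hom \<A> (Cod \<A> c) (Cod \<A> s)" "s' \<cdot> c = s"
      using cokernelE[OF c' g sH] by blast
    have "s \<cdot> m = s' \<cdot> (c \<cdot> m)" using s' cD(1) mD(1) by (auto simp: Hom_iff)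
    also have "\<dots> = Zero \<A> (Dom \<A> m) (Cod \<A> s)"
      unfolding mD(2) using s' Hom_Obj[OF mD(1)] by (simp add: Hom_iff)
    finally obtain w where w: "w \<in> Hom \<A> (Dom \<A> m) (Dom \<A> (m \<cdot> k))" "m \<cdot> k \<cdot> w = m"
      using kernelE[OF s sH mD(1)] by blast
    have M: "Dom \<A> m \<in> Obj \<A>" using Hom_Obj mD by blast
    have kw: "k \<cdot> w = Ident \<A> (Dom \<A> m)"
     by - (rule monicD[OF mD(3,1)]; use w kD(1) mD(1) M in \<open>auto simp: Hom_iff\<close>)
    have "t = t \<cdot> k \<cdot> w" using kw t w kD(1) mD(1) by (simp add: Hom_iff)
    then show ?thesis using kD(2) w kD(1) mD(1) Hom_Obj[OF t] by (simp add: Hom_iff)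
  qed
  have "epic \<A> e"
    unfolding epic_def
  proof (intro conjI ballI impI)
    fix W f h assume f: "f \<in> Hom \<A> (Cod \<A> e) W" "h \<in> Hom \<A> (Cod \<A> e) W" and eq: "f \<cdot> e = h \<cdot> e"
    have "diff f h = Zero \<A> (Dom \<A> m) W"
      using f e eq by (intro *) (auto simp: Hom_iff)
    then show "f = h" using f e by (auto simp: Hom_iff diff_eq_Zero_iff)
  qed (use e in \<open>auto simp: Hom_iff\<close>)
  then show thesis using that e unfolding m_def by blast
qed

lemma im_arrD:
  assumes g: "g \<in> Hom \<A> X Y"
  shows "im_arr \<A> g \<in> Hom \<A> (Dom \<A> (im_arr \<A> g)) Y" "monic \<A> (im_arr \<A> g)"
    "is_kernel \<A> (coker_arr \<A> g) (im_arr \<A> g)"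
proof -
  have c: "is_cokernel \<A> g (coker_arr \<A> g)" using is_cokernel_coker_arr g by (simp add: Hom_iff)
  note cD = cokernelD[OF c g]
  show k: "is_kernel \<A> (coker_arr \<A> g) (im_arr \<A> g)"
    unfolding im_arr_def using cD by (intro is_kernel_ker_arr) (simp add: Hom_iff)
  show "im_arr \<A> g \<in> Hom \<A> (Dom \<A> (im_arr \<A> g)) Y" "monic \<A> (im_arr \<A> g)"
    using kernelD[OF k cD(1)] by auto
qed

text \<open>The epic first factor of \<open>g\<close> can be cancelled, so maps out of
  \<open>Y\<close> do not distinguish \<open>g\<close> from its image. Coboundaries, which are
  defined as images, can thus be tested through the differential alone.\<close>

lemma im_arr_zero_iff:
  assumes g: "g \<in> Hom \<A> X Y" and y: "y \<in> Hom \<A> Y W"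
  shows "y \<cdot> im_arr \<A> g = Zero \<A> (Dom \<A> (im_arr \<A> g)) W \<longleftrightarrow> y \<cdot> g = Zero \<A> X W"
proof -
  note D = im_arrD[OF g]
  obtain e where e: "e \<in> Hom \<A> X (Dom \<A> (im_arr \<A> g))" "im_arr \<A> g \<cdot> e = g" "epic \<A> e"
    by (rule im_arr_factor[OF g])
  have O: "W \<in> Obj \<A>" "Dom \<A> (im_arr \<A> g) \<in> Obj \<A>" using Hom_Obj y D by blast+
  have *: "y \<cdot> g = y \<cdot> im_arr \<A> g \<cdot> e" using e y D by (simp add: Hom_iff)
  show ?thesis
  proof
    assume "y \<cdot> im_arr \<A> g = Zero \<A> (Dom \<A> (im_arr \<A> g)) W"
    then show "y \<cdot> g = Zero \<A> X W" unfolding * using e O by (simp add: Hom_iff)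
  next
    assume "y \<cdot> g = Zero \<A> X W"
    then have "y \<cdot> im_arr \<A> g \<cdot> e = Zero \<A> (Dom \<A> (im_arr \<A> g)) W \<cdot> e"
      unfolding * using e O by (simp add: Hom_iff)
    then show "y \<cdot> im_arr \<A> g = Zero \<A> (Dom \<A> (im_arr \<A> g)) W"
     by - (rule epicD[OF e(3,1)]; use y D O in \<open>auto simp: Hom_iff\<close>)
  qed
qed

text \<open>The epic part \<open>e\<close> of \<open>g\<close> is a cokernel of some
  \<open>a\<close>. Since \<open>g\<close> kills \<open>a\<close>, this \<open>a\<close> factors
  through \<open>k\<close>, so \<open>y\<close> kills it too and descends along \<open>e\<close>.
  Injectivity of \<open>E\<close> then extends the result along the monic image of
  \<open>g\<close>.\<close>

lemma kernel_coextend: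
  assumes k: "is_kernel \<A> g k" and g: "g \<in> Hom \<A> Y Z" and E: "injective_object \<A> E"
    and y: "y \<in> Hom \<A> Y E" and yk: "y \<cdot> k = Zero \<A> (Dom \<A> k) E"
  obtains z where "z \<in> Hom \<A> Z E" "z \<cdot> g = y"
proof -
  note D = im_arrD[OF g] and kD = kernelD[OF k g]
  obtain e where e: "e \<in> Hom \<A> Y (Dom \<A> (im_arr \<A> g))" "im_arr \<A> g \<cdot> e = g" "epic \<A> e"
    by (rule im_arr_factor[OF g])
  obtain a where a: "is_cokernel \<A> a e" using epic_normal e by blast
  have aH: "a \<in> Hom \<A> (Dom \<A> a) Y" using a e(1) unfolding is_cokernel_def by (auto simp: Hom_iff)
  note eD = cokernelD[OF a aH]
  have "g \<cdot> a = im_arr \<A> g \<cdot> (e \<cdot> a)"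
    using e D aH assoc[of a e "im_arr \<A> g"] by (simp add: Hom_iff)
  also have "\<dots> = Zero \<A> (Dom \<A> a) Z"
    unfolding eD(2) using D e Hom_Obj[OF aH] by (simp add: Hom_iff)
  finally obtain a' where a': "a' \<in> Hom \<A> (Dom \<A> a) (Dom \<A> k)" "k \<cdot> a' = a"
    using kernelE[OF k g aH] by blast
  have "y \<cdot> a = (y \<cdot> k) \<cdot> a'" using y a' kD by (simp add: Hom_iff)
  also have "\<dots> = Zero \<A> (Dom \<A> a) E" unfolding yk using a' injective_object_Obj[OF E] by (simp add: Hom_iff)
  finally obtain y' where y': "y' \<in> Hom \<A> (Cod \<A> e) E" "y' \<cdot> e = y"
    using cokernelE[OF a aH y] by blast
  have "y' \<in> Hom \<A> (Dom \<A> (im_arr \<A> g)) E" using y' e by (simp add: Hom_iff)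
  then obtain z where z: "z \<in> Hom \<A> Z E" "z \<cdot> im_arr \<A> g = y'"
    using injective_objectE[OF E D(2) D(1)] by blast
  have "z \<cdot> g = z \<cdot> (im_arr \<A> g \<cdot> e)" using e by simp
  also have "\<dots> = y' \<cdot> e" unfolding z(2)[symmetric] using z(1) e(1) D(1) by (simp add: Hom_iff)
  finally show thesis using that z y' by simp
qed

lemma hullE:
  assumes "X \<in> Obj \<A>"
  obtains E m where "injective_object \<A> E" "m \<in> Hom \<A> X E" "monic \<A> m"
  using enough assms unfolding enough_injectives_def by blast

text \<open>A monic \<open>n\<close> from \<open>X\<close> into an injective object extends along
  \<open>m\<close>, so \<open>n\<close> is \<open>y \<cdot> m\<close> for some \<open>y\<close>; as
  the composite is monic, so is \<open>m\<close>.\<close>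

lemma monicI:
  assumes m: "m \<in> Hom \<A> X Y"
    and ext: "\<And>E x. \<lbrakk>injective_object \<A> E; x \<in> Hom \<A> X E\<rbrakk> \<Longrightarrow> \<exists>y\<in>Hom \<A> Y E. y \<cdot> m = x"
  shows "monic \<A> m"
  unfolding monic_def
proof (intro conjI ballI impI)
  fix W f g assume f: "f \<in> Hom \<A> W (Dom \<A> m)" "g \<in> Hom \<A> W (Dom \<A> m)" and eq: "m \<cdot> f = m \<cdot> g"
  obtain E n where n: "injective_object \<A> E" "n \<in> Hom \<A> X E" "monic \<A> n"
    using hullE Hom_Obj[OF m] by metis
  obtain y where y: "y \<in> Hom \<A> Y E" "y \<cdot> m = n" using ext n by blast
  have "y \<cdot> m \<cdot> f = y \<cdot> m \<cdot> g" using y(1) m f eq by (simp add: Hom_iff)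
  then show "f = g"
    by - (rule monicD[OF n(3,2)]; use f m n y in \<open>auto simp: Hom_iff\<close>)
qed (use m in \<open>auto simp: Hom_iff\<close>)

text \<open>Two maps with equal composites are compared after embedding their target into an
  injective object; the hypothesis is applied to their difference there.\<close>

lemma epicI:
  assumes e: "e \<in> Hom \<A> X Y"
    and test: "\<And>E y. \<lbrakk>injective_object \<A> E; y \<in> Hom \<A> Y E; y \<cdot> e = Zero \<A> X E\<rbrakk> \<Longrightarrow> y = Zero \<A> Y E"
  shows "epic \<A> e"
  unfolding epic_def
proof (intro conjI ballI impI)
  fix W f g assume W: "W \<in> Obj \<A>" and f: "f \<in> Hom \<A> (Cod \<A> e) W" "g \<in> Hom \<A> (Cod \<A> e) W"
    and eq: "f \<cdot> e = g \<cdot> e"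
  obtain E n where n: "injective_object \<A> E" "n \<in> Hom \<A> W E" "monic \<A> n"
    using hullE[OF W] by metis
  have "n \<cdot> diff f g = Zero \<A> Y E"
    using n(2) f e eq by (intro test n(1)) (auto simp: Hom_iff)
  then have "n \<cdot> f = n \<cdot> g" using n(2) f e by (simp add: Hom_iff diff_eq_Zero_iff)
  then show "f = g"
    by - (rule monicD[OF n(3,2)]; use f n in \<open>auto\<close>)
qed (use e in \<open>auto simp: Hom_iff\<close>)

lemma epicD0:
  assumes "epic \<A> e" "e \<in> Hom \<A> X Y" "y \<in> Hom \<A> Y W" "y \<cdot> e = Zero \<A> X W"
  shows "y = Zero \<A> Y W"
proof (rule epicD[OF assms(1,2,3)])
  have O: "Y \<in> Obj \<A>" "W \<in> Obj \<A>" using Hom_Obj assms(3) by blast+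
  then show "Zero \<A> Y W \<in> Hom \<A> Y W" "y \<cdot> e = Zero \<A> Y W \<cdot> e"
    using assms by (auto simp: Hom_iff)
qed

lemma monicD0:
  assumes "monic \<A> m" "m \<in> Hom \<A> X Y" "y \<in> Hom \<A> W X" "m \<cdot> y = Zero \<A> W Y"
  shows "y = Zero \<A> W X"
proof (rule monicD[OF assms(1,2,3)])
  have O: "X \<in> Obj \<A>" "W \<in> Obj \<A>" using Hom_Obj assms(3) by blast+
  then show "Zero \<A> W X \<in> Hom \<A> W X" "m \<cdot> y = m \<cdot> Zero \<A> W X"
    using assms by (auto simp: Hom_iff)
qed

text \<open>The image of \<open>f\<close> is the kernel of its cokernel, so it must be shown that
  \<open>coker_arr \<A> f\<close> kills every \<open>h\<close> killed by \<open>g\<close>. Embedding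
  the cokernel into an injective object gives a map on \<open>Y\<close> that kills \<open>f\<close>;
  by assumption it has the form \<open>z \<cdot> g\<close>, and therefore it kills
  \<open>h\<close>.\<close>

lemma exact_atI:
  assumes f: "f \<in> Hom \<A> X Y" and g: "g \<in> Hom \<A> Y Z" and gf: "g \<cdot> f = Zero \<A> X Z"
    and ext: "\<And>E y. \<lbrakk>injective_object \<A> E; y \<in> Hom \<A> Y E; y \<cdot> f = Zero \<A> X E\<rbrakk>
       \<Longrightarrow> \<exists>z\<in>Hom \<A> Z E. z \<cdot> g = y"
  shows "exact_at \<A> f g"
  unfolding exact_at_def is_kernel_def
proof (intro conjI ballI impI)
  note D = im_arrD[OF f]
  have c: "is_cokernel \<A> f (coker_arr \<A> f)" using is_cokernel_coker_arr f by (simp add: Hom_iff)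
  note cD = cokernelD[OF c f]
  show "g \<cdot> im_arr \<A> f = Zero \<A> (Dom \<A> (im_arr \<A> f)) (Cod \<A> g)"
    using im_arr_zero_iff[OF f g] gf g by (simp add: Hom_iff)
  show "f \<in> Arr \<A>" "g \<in> Arr \<A>" "g \<in> Arr \<A>" "Cod \<A> f = Dom \<A> g" "im_arr \<A> f \<in> Arr \<A>"
    "Cod \<A> (im_arr \<A> f) = Dom \<A> g" using f g D by (auto simp: Hom_iff)
  fix W h assume W: "W \<in> Obj \<A>" and h: "h \<in> Hom \<A> W (Dom \<A> g)"
    and gh: "g \<cdot> h = Zero \<A> W (Cod \<A> g)"
  obtain E m where E: "injective_object \<A> E" "m \<in> Hom \<A> (Cod \<A> (coker_arr \<A> f)) E" "monic \<A> m"
    using hullE Hom_Obj[OF cD(1)] by metis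
  have EO: "E \<in> Obj \<A>" and QO: "Cod \<A> (coker_arr \<A> f) \<in> Obj \<A>" using Hom_Obj E by blast+
  have "m \<cdot> coker_arr \<A> f \<cdot> f = Zero \<A> X E"
    using E(2) cD(1,2) f Hom_Obj[OF f] by (simp add: Hom_iff)
  then obtain z where z: "z \<in> Hom \<A> Z E" "z \<cdot> g = m \<cdot> coker_arr \<A> f"
    using ext[OF E(1), of "m \<cdot> coker_arr \<A> f"] E(2) cD(1) by (auto simp: Hom_iff)
  have "m \<cdot> coker_arr \<A> f \<cdot> h = z \<cdot> (g \<cdot> h)"
    unfolding z(2)[symmetric] using z(1) g h by (simp add: Hom_iff)
  also have "\<dots> = Zero \<A> W E" using gh z(1) g W by (simp add: Hom_iff)
  finally have "m \<cdot> (coker_arr \<A> f \<cdot> h) = m \<cdot> Zero \<A> W (Cod \<A> (coker_arr \<A> f))"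
    using E(2) cD(1) h g W QO by (simp add: Hom_iff)
  then have "coker_arr \<A> f \<cdot> h = Zero \<A> W (Cod \<A> (coker_arr \<A> f))"
   by - (rule monicD[OF E(3,2)]; use cD(1) h g W QO in \<open>auto simp: Hom_iff\<close>)
  moreover have hY: "h \<in> Hom \<A> W Y" using h g by (simp add: Hom_iff)
  ultimately obtain u where u: "u \<in> Hom \<A> W (Dom \<A> (im_arr \<A> f))" "im_arr \<A> f \<cdot> u = h"
    using kernelE[OF D(3) cD(1) hY] by blast
  show "\<exists>!u. u \<in> Hom \<A> W (Dom \<A> (im_arr \<A> f)) \<and> im_arr \<A> f \<cdot> u = h"
    using u monicD[OF D(2,1)] by metis
qed

lemma exact_atD:
  assumes ex: "exact_at \<A> f g" and f: "f \<in> Hom \<A> X Y" and g: "g \<in> Hom \<A> Y Z"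
  shows "g \<cdot> f = Zero \<A> X Z"
proof -
  have k: "is_kernel \<A> g (im_arr \<A> f)" using ex by (simp add: exact_at_def)
  show ?thesis using im_arr_zero_iff[OF f g] kernelD[OF k g] by simp
qed

lemma exact_atE:
  assumes ex: "exact_at \<A> f g" and f: "f \<in> Hom \<A> X Y" and g: "g \<in> Hom \<A> Y Z"
    and E: "injective_object \<A> E" and y: "y \<in> Hom \<A> Y E" and yf: "y \<cdot> f = Zero \<A> X E"
  obtains z where "z \<in> Hom \<A> Z E" "z \<cdot> g = y"
proof -
  have k: "is_kernel \<A> g (im_arr \<A> f)" using ex by (simp add: exact_at_def)
  show thesis using kernel_coextend[OF k g E y] im_arr_zero_iff[OF f y] yf that by blast
qed

section \<open>Zero objects, retracts and biproducts\<close>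

text \<open>Reduces the vanishing of an object to one equation of arrows, which can be transported
  along epics and to biproducts.\<close>

lemma zero_object_iff: "is_zero_object \<A> X \<longleftrightarrow> X \<in> Obj \<A> \<and> Ident \<A> X = Zero \<A> X X"
proof safe
  assume X: "is_zero_object \<A> X"
  show O: "X \<in> Obj \<A>" using X by (simp add: is_zero_object_def)
  have "\<exists>!f. f \<in> Hom \<A> X X" using X O by (simp add: is_zero_object_def)
  moreover have "Ident \<A> X \<in> Hom \<A> X X" "Zero \<A> X X \<in> Hom \<A> X X"
    using O by (simp_all add: Hom_iff)
  ultimately show "Ident \<A> X = Zero \<A> X X" by blast
next
  assume O: "X \<in> Obj \<A>" and I: "Ident \<A> X = Zero \<A> X X"
  show "is_zero_object \<A> X"
    unfolding is_zero_object_def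
  proof (intro conjI ballI O)
    fix Y assume Y: "Y \<in> Obj \<A>"
    have "f = Zero \<A> X Y" if "f \<in> Hom \<A> X Y" for f
    proof -
      have "f = f \<cdot> Ident \<A> X" using that by (simp add: Hom_iff)
      then show ?thesis unfolding I using that O by (simp add: Hom_iff)
    qed
    then show "\<exists>!f. f \<in> Hom \<A> X Y" using O Y by (intro ex1I[of _ "Zero \<A> X Y"]) (auto simp: Hom_iff)
    have "f = Zero \<A> Y X" if "f \<in> Hom \<A> Y X" for f
    proof -
      have "f = Ident \<A> X \<cdot> f" using that by (simp add: Hom_iff)
      then show ?thesis unfolding I using that O by (simp add: Hom_iff)
    qed
    then show "\<exists>!f. f \<in> Hom \<A> Y X" using O Y by (intro ex1I[of _ "Zero \<A> Y X"]) (auto simp: Hom_iff)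
  qed
qed

lemma Hom_zero_object:
  assumes "is_zero_object \<A> X"
  shows "f \<in> Hom \<A> X Y \<Longrightarrow> f = Zero \<A> X Y" "f \<in> Hom \<A> Y X \<Longrightarrow> f = Zero \<A> Y X"
proof -
  have O: "X \<in> Obj \<A>" and I: "Ident \<A> X = Zero \<A> X X" using assms by (auto simp: zero_object_iff)
  show "f = Zero \<A> X Y" if "f \<in> Hom \<A> X Y"
  proof -
    have "f = f \<cdot> Ident \<A> X" using that by (simp add: Hom_iff)
    then show ?thesis unfolding I using that O by (simp add: Hom_iff)
  qed
  show "f = Zero \<A> Y X" if "f \<in> Hom \<A> Y X"
  proof -
    have "f = Ident \<A> X \<cdot> f" using that by (simp add: Hom_iff)
    then show ?thesis unfolding I using that O by (simp add: Hom_iff)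
  qed
qed

lemma zero_object_epic:
  assumes "is_zero_object \<A> X" "epic \<A> e" "e \<in> Hom \<A> X Y"
  shows "is_zero_object \<A> Y"
  unfolding zero_object_iff
proof (intro conjI)
  show O: "Y \<in> Obj \<A>" using Hom_Obj assms(3) by blast
  have "e = Zero \<A> X Y" using assms by (intro Hom_zero_object)
  then have "Ident \<A> Y \<cdot> e = Zero \<A> X Y" using assms(3) by (simp add: Hom_iff)
  then show "Ident \<A> Y = Zero \<A> Y Y" using O by (intro epicD0[OF assms(2,3)]) (auto simp: Hom_iff)
qed

lemma zero_object_injective:
  assumes X: "is_zero_object \<A> X"
  shows "injective_object \<A> X"
  unfolding injective_object_def
proof (intro conjI allI impI)
  show O: "X \<in> Obj \<A>" using X by (simp add: zero_object_iff)
  fix m f assume mf: "monic \<A> m \<and> f \<in> Hom \<A> (Dom \<A> m) X"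
  then have m: "m \<in> Arr \<A>" by (simp add: monic_def)
  have "Zero \<A> (Cod \<A> m) X \<in> Hom \<A> (Cod \<A> m) X" "Zero \<A> (Cod \<A> m) X \<cdot> m = f"
    using m O Hom_zero_object(2)[OF X, of f] mf Cod_in_Obj[OF m] by (auto simp: Hom_iff)
  then show "\<exists>g\<in>Hom \<A> (Cod \<A> m) X. g \<cdot> m = f" by blast
qed

lemma injective_retract:
  assumes E: "injective_object \<A> E" and i: "i \<in> Hom \<A> X E" and r: "r \<in> Hom \<A> E X"
    and ri: "r \<cdot> i = Ident \<A> X"
  shows "injective_object \<A> X"
  unfolding injective_object_def
proof (intro conjI allI impI)
  show O: "X \<in> Obj \<A>" using Hom_Obj i by blast
  fix m f assume mf: "monic \<A> m \<and> f \<in> Hom \<A> (Dom \<A> m) X"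
  then have m: "monic \<A> m" "m \<in> Hom \<A> (Dom \<A> m) (Cod \<A> m)"
    and f: "f \<in> Hom \<A> (Dom \<A> m) X" by (auto simp: monic_def Hom_iff)
  have "i \<cdot> f \<in> Hom \<A> (Dom \<A> m) E" using i f by (simp add: Hom_iff)
  then obtain g where g: "g \<in> Hom \<A> (Cod \<A> m) E" "g \<cdot> m = i \<cdot> f"
    using injective_objectE[OF E m] by blast
  have "r \<cdot> g \<cdot> m = (r \<cdot> i) \<cdot> f" using r g i m f by (simp add: Hom_iff)
  then have "r \<cdot> g \<cdot> m = f" unfolding ri using f by (simp add: Hom_iff)
  moreover have "r \<cdot> g \<in> Hom \<A> (Cod \<A> m) X" using r g by (simp add: Hom_iff)
  ultimately show "\<exists>g\<in>Hom \<A> (Cod \<A> m) X. g \<cdot> m = f" by blast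
qed

section \<open>Chosen biproducts, pairing and direct sums of arrows\<close>

definition biprod :: "'a \<Rightarrow> 'a \<Rightarrow> 'a \<times> 'b \<times> 'b \<times> 'b \<times> 'b" where
  "biprod X Y = (SOME (S, i, j, p, r). is_biproduct \<A> X Y S i j p r)"

definition Bi :: "'a \<Rightarrow> 'a \<Rightarrow> 'a" where "Bi X Y = fst (biprod X Y)"
definition in1 :: "'a \<Rightarrow> 'a \<Rightarrow> 'b" where "in1 X Y = fst (snd (biprod X Y))"
definition in2 :: "'a \<Rightarrow> 'a \<Rightarrow> 'b" where "in2 X Y = fst (snd (snd (biprod X Y)))"
definition pr1 :: "'a \<Rightarrow> 'a \<Rightarrow> 'b" where "pr1 X Y = fst (snd (snd (snd (biprod X Y))))"
definition pr2 :: "'a \<Rightarrow> 'a \<Rightarrow> 'b" where "pr2 X Y = snd (snd (snd (snd (biprod X Y))))"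

lemma is_biproduct_Bi:
  assumes "X \<in> Obj \<A>" "Y \<in> Obj \<A>"
  shows "is_biproduct \<A> X Y (Bi X Y) (in1 X Y) (in2 X Y) (pr1 X Y) (pr2 X Y)"
proof -
  have "\<exists>b. case b of (S, i, j, p, r) \<Rightarrow> is_biproduct \<A> X Y S i j p r"
    using ex_biproduct[OF assms] by auto
  then have "case biprod X Y of (S, i, j, p, r) \<Rightarrow> is_biproduct \<A> X Y S i j p r"
    unfolding biprod_def by (rule someI_ex)
  then show ?thesis by (simp add: Bi_def in1_def in2_def pr1_def pr2_def split_beta)
qed

context
  fixes X Y assumes XY: "X \<in> Obj \<A>" "Y \<in> Obj \<A>"
begin

lemma Arr_biprod [simp]:
  "in1 X Y \<in> Arr \<A>" "Dom \<A> (in1 X Y) = X" "Cod \<A> (in1 X Y) = Bi X Y"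
  "in2 X Y \<in> Arr \<A>" "Dom \<A> (in2 X Y) = Y" "Cod \<A> (in2 X Y) = Bi X Y"
  "pr1 X Y \<in> Arr \<A>" "Dom \<A> (pr1 X Y) = Bi X Y" "Cod \<A> (pr1 X Y) = X"
  "pr2 X Y \<in> Arr \<A>" "Dom \<A> (pr2 X Y) = Bi X Y" "Cod \<A> (pr2 X Y) = Y"
  "Bi X Y \<in> Obj \<A>"
  using is_biproduct_Bi[OF XY] Hom_Obj(1)[of "pr1 X Y" "Bi X Y" X]
  by (auto simp: is_biproduct_def Hom_iff)

lemma biprod_Comp [simp]:
  "pr1 X Y \<cdot> in1 X Y = Ident \<A> X" "pr2 X Y \<cdot> in2 X Y = Ident \<A> Y"
  "pr2 X Y \<cdot> in1 X Y = Zero \<A> X Y" "pr1 X Y \<cdot> in2 X Y = Zero \<A> Y X"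
  using is_biproduct_Bi[OF XY] by (auto simp: is_biproduct_def)

lemma biprod_Comp_Comp [simp]:
  "\<lbrakk>h \<in> Arr \<A>; Cod \<A> h = X\<rbrakk> \<Longrightarrow> pr1 X Y \<cdot> (in1 X Y \<cdot> h) = h"
  "\<lbrakk>h \<in> Arr \<A>; Cod \<A> h = Y\<rbrakk> \<Longrightarrow> pr2 X Y \<cdot> (in2 X Y \<cdot> h) = h"
  "\<lbrakk>h \<in> Arr \<A>; Cod \<A> h = X\<rbrakk> \<Longrightarrow> pr2 X Y \<cdot> (in1 X Y \<cdot> h) = Zero \<A> (Dom \<A> h) Y"
  "\<lbrakk>h \<in> Arr \<A>; Cod \<A> h = Y\<rbrakk> \<Longrightarrow> pr1 X Y \<cdot> (in2 X Y \<cdot> h) = Zero \<A> (Dom \<A> h) X"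
  using XY by (simp_all flip: assoc)

lemma biprod_Ident: "Add \<A> (in1 X Y \<cdot> pr1 X Y) (in2 X Y \<cdot> pr2 X Y) = Ident \<A> (Bi X Y)"
  using is_biproduct_Bi[OF XY] by (auto simp: is_biproduct_def)

lemma biprod_eq_into:
  assumes "f \<in> Hom \<A> W (Bi X Y)" "g \<in> Hom \<A> W (Bi X Y)"
    "pr1 X Y \<cdot> f = pr1 X Y \<cdot> g" "pr2 X Y \<cdot> f = pr2 X Y \<cdot> g"
  shows "f = g"
proof -
  have "h = Add \<A> (in1 X Y \<cdot> (pr1 X Y \<cdot> h)) (in2 X Y \<cdot> (pr2 X Y \<cdot> h))"
    if "h \<in> Hom \<A> W (Bi X Y)" for h
  proof -
    have "h = Ident \<A> (Bi X Y) \<cdot> h" using that by (simp add: Hom_iff)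
    then show ?thesis unfolding biprod_Ident[symmetric] using that by (simp add: Hom_iff)
  qed
  from this[OF assms(1)] this[OF assms(2)] assms(3,4) show ?thesis by simp
qed

lemma biprod_eq_out:
  assumes "f \<in> Hom \<A> (Bi X Y) W" "g \<in> Hom \<A> (Bi X Y) W"
    "f \<cdot> in1 X Y = g \<cdot> in1 X Y" "f \<cdot> in2 X Y = g \<cdot> in2 X Y"
  shows "f = g"
proof -
  have "h = Add \<A> ((h \<cdot> in1 X Y) \<cdot> pr1 X Y) ((h \<cdot> in2 X Y) \<cdot> pr2 X Y)"
    if "h \<in> Hom \<A> (Bi X Y) W" for h
  proof -
    have "h = h \<cdot> Ident \<A> (Bi X Y)" using that by (simp add: Hom_iff)
    then show ?thesis unfolding biprod_Ident[symmetric] using that by (simp add: Hom_iff)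
  qed
  from this[OF assms(1)] this[OF assms(2)] assms(3,4) show ?thesis by simp
qed

end

definition pair :: "'b \<Rightarrow> 'b \<Rightarrow> 'b" where
  "pair f g = Add \<A> (in1 (Cod \<A> f) (Cod \<A> g) \<cdot> f) (in2 (Cod \<A> f) (Cod \<A> g) \<cdot> g)"

definition copair :: "'b \<Rightarrow> 'b \<Rightarrow> 'b" where
  "copair f g = Add \<A> (f \<cdot> pr1 (Dom \<A> f) (Dom \<A> g)) (g \<cdot> pr2 (Dom \<A> f) (Dom \<A> g))"

definition dsum :: "'b \<Rightarrow> 'b \<Rightarrow> 'b" where
  "dsum f g = pair (f \<cdot> pr1 (Dom \<A> f) (Dom \<A> g)) (g \<cdot> pr2 (Dom \<A> f) (Dom \<A> g))"

lemma Arr_pair [simp]: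
  assumes "f \<in> Arr \<A>" "g \<in> Arr \<A>" "Dom \<A> f = Dom \<A> g"
  shows "pair f g \<in> Arr \<A>" "Dom \<A> (pair f g) = Dom \<A> g"
    "Cod \<A> (pair f g) = Bi (Cod \<A> f) (Cod \<A> g)"
  using assms Cod_in_Obj[of f] Cod_in_Obj[of g] by (simp_all add: pair_def)

lemma Arr_copair [simp]:
  assumes "f \<in> Arr \<A>" "g \<in> Arr \<A>" "Cod \<A> f = Cod \<A> g"
  shows "copair f g \<in> Arr \<A>" "Dom \<A> (copair f g) = Bi (Dom \<A> f) (Dom \<A> g)"
    "Cod \<A> (copair f g) = Cod \<A> g"
  using assms Dom_in_Obj[of f] Dom_in_Obj[of g] by (simp_all add: copair_def)

lemma pr_pair [simp]:
  assumes "f \<in> Arr \<A>" "g \<in> Arr \<A>" "Dom \<A> f = Dom \<A> g" "Cod \<A> f = X" "Cod \<A> g = Y"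
  shows "pr1 X Y \<cdot> pair f g = f" "pr2 X Y \<cdot> pair f g = g"
  using assms Cod_in_Obj[of f] Cod_in_Obj[of g] by (auto simp: pair_def)

lemma pair_Comp [simp]:
  assumes "f \<in> Arr \<A>" "g \<in> Arr \<A>" "Dom \<A> f = Dom \<A> g" "h \<in> Arr \<A>" "Cod \<A> h = Dom \<A> g"
  shows "pair f g \<cdot> h = pair (f \<cdot> h) (g \<cdot> h)"
  using assms Cod_in_Obj[of f] Cod_in_Obj[of g] by (simp add: pair_def)

lemma copair_pair:
  assumes "f \<in> Arr \<A>" "g \<in> Arr \<A>" "Cod \<A> f = Cod \<A> g" "h \<in> Arr \<A>" "k \<in> Arr \<A>" "Dom \<A> h = Dom \<A> k"
    "Cod \<A> h = Dom \<A> f" "Cod \<A> k = Dom \<A> g"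
  shows "copair f g \<cdot> pair h k = Add \<A> (f \<cdot> h) (g \<cdot> k)"
  using assms Dom_in_Obj[of f] Dom_in_Obj[of g] Cod_in_Obj[of g] by (simp add: copair_def)

text \<open>Rewrites a pair with a zero entry into the shape of the differential of
  \<open>disc\<close>; this is how the two sides of the chain map equation for
  \<open>disc_map\<close> come to agree.\<close>

lemma pair_Zero [simp]:
  assumes "f \<in> Arr \<A>" "Dom \<A> f = W" "Y \<in> Obj \<A>"
  shows "pair f (Zero \<A> W Y) = in1 (Cod \<A> f) Y \<cdot> f" "pair (Zero \<A> W Y) f = in2 Y (Cod \<A> f) \<cdot> f"
  using assms Dom_in_Obj[of f] Cod_in_Obj[of f] by (auto simp: pair_def)

lemma injective_Bi:
  assumes X: "injective_object \<A> X" and Y: "injective_object \<A> Y"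
  shows "injective_object \<A> (Bi X Y)"
  unfolding injective_object_def
proof (intro conjI allI impI)
  have O: "X \<in> Obj \<A>" "Y \<in> Obj \<A>" using X Y by (auto simp: injective_object_def)
  then show "Bi X Y \<in> Obj \<A>" by simp
  fix m f assume mf: "monic \<A> m \<and> f \<in> Hom \<A> (Dom \<A> m) (Bi X Y)"
  then have m: "monic \<A> m" "m \<in> Hom \<A> (Dom \<A> m) (Cod \<A> m)"
    and f: "f \<in> Hom \<A> (Dom \<A> m) (Bi X Y)" by (auto simp: monic_def Hom_iff)
  have "pr1 X Y \<cdot> f \<in> Hom \<A> (Dom \<A> m) X" "pr2 X Y \<cdot> f \<in> Hom \<A> (Dom \<A> m) Y"
    using f O by (auto simp: Hom_iff)
  then obtain g h where g: "g \<in> Hom \<A> (Cod \<A> m) X" "g \<cdot> m = pr1 X Y \<cdot> f"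
    and h: "h \<in> Hom \<A> (Cod \<A> m) Y" "h \<cdot> m = pr2 X Y \<cdot> f"
    using injective_objectE[OF X m] injective_objectE[OF Y m] by metis
  have "pair g h \<cdot> m = f"
    by - (rule biprod_eq_into[OF O, of _ "Dom \<A> m"]; use m g h f O in \<open>auto simp: Hom_iff\<close>)
  moreover have "pair g h \<in> Hom \<A> (Cod \<A> m) (Bi X Y)" using g h by (auto simp: Hom_iff)
  ultimately show "\<exists>g\<in>Hom \<A> (Cod \<A> m) (Bi X Y). g \<cdot> m = f" by blast
qed

lemma zero_object_Bi:
  assumes X: "is_zero_object \<A> X" and Y: "is_zero_object \<A> Y"
  shows "is_zero_object \<A> (Bi X Y)"
proof -
  have O: "X \<in> Obj \<A>" "Y \<in> Obj \<A>" and I: "Ident \<A> X = Zero \<A> X X" "Ident \<A> Y = Zero \<A> Y Y"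
    using X Y by (auto simp: zero_object_iff)
  have "Ident \<A> X \<cdot> pr1 X Y = Zero \<A> (Bi X Y) X" "Ident \<A> Y \<cdot> pr2 X Y = Zero \<A> (Bi X Y) Y"
    unfolding I using O by auto
  then have "pr1 X Y = Zero \<A> (Bi X Y) X" "pr2 X Y = Zero \<A> (Bi X Y) Y"
    using O by auto
  then have "Ident \<A> (Bi X Y) = Zero \<A> (Bi X Y) (Bi X Y)"
    by - (rule biprod_eq_into[OF O, of _ "Bi X Y"]; use O in \<open>auto simp: Hom_iff\<close>)
  then show ?thesis using O by (simp add: zero_object_iff)
qed

text \<open>
  A map \<open>u\<close> into an injective object that represents the injective-valued maps killing \<open>f\<close>; the
  flag \<open>P\<close> allows the trivial choice \<open>u = 0\<close> instead.
\<close>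

definition weak_hull :: "bool \<Rightarrow> 'b \<Rightarrow> 'a \<Rightarrow> 'b \<Rightarrow> bool" where
  "weak_hull P f E u \<longleftrightarrow>
     injective_object \<A> E \<and> u \<in> Hom \<A> (Cod \<A> f) E \<and> u \<cdot> f = Zero \<A> (Dom \<A> f) E \<and>
     (if P then is_zero_object \<A> E
      else (\<forall>E' y. injective_object \<A> E' \<longrightarrow> y \<in> Hom \<A> (Cod \<A> f) E' \<longrightarrow>
              y \<cdot> f = Zero \<A> (Dom \<A> f) E' \<longrightarrow> (\<exists>\<epsilon>\<in>Hom \<A> E E'. \<epsilon> \<cdot> u = y))) \<and>
     (is_zero_object \<A> (Cod \<A> f) \<longrightarrow> is_zero_object \<A> E)"

text \<open>Maps killing \<open>f\<close> are maps out of its cokernel \<open>c\<close>, and those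
  with injective target extend along a monic \<open>m\<close> into an injective object. So
  \<open>m \<cdot> c\<close> represents them.\<close>

lemma ex_weak_hull:
  assumes f: "f \<in> Arr \<A>"
  shows "\<exists>E u. weak_hull P f E u"
proof -
  define X Y where "X = Dom \<A> f" and "Y = Cod \<A> f"
  have fH: "f \<in> Hom \<A> X Y" using f by (simp add: Hom_iff X_def Y_def)
  have O: "X \<in> Obj \<A>" "Y \<in> Obj \<A>" using Hom_Obj fH by blast+
  obtain N where N: "is_zero_object \<A> N" using ex_zero_object by blast
  have NO: "N \<in> Obj \<A>" using N by (simp add: zero_object_iff)
  show ?thesis
  proof (cases P)
    case True
    have "weak_hull P f N (Zero \<A> Y N)"
      unfolding weak_hull_def using N True zero_object_injective[OF N] fH NO O
      by (auto simp: Hom_iff)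
    then show ?thesis by blast
  next
    case False
    obtain c where c: "is_cokernel \<A> f c" using ex_cokernel[OF f] by blast
    note cD = cokernelD[OF c fH]
    have QO: "Cod \<A> c \<in> Obj \<A>" using Hom_Obj cD(1) by blast
    obtain E m where E: "injective_object \<A> E" "m \<in> Hom \<A> (Cod \<A> c) E" "monic \<A> m"
      and Ez: "is_zero_object \<A> (Cod \<A> c) \<longrightarrow> is_zero_object \<A> E"
    proof (cases "is_zero_object \<A> (Cod \<A> c)")
      \<comment> \<open>An injective object containing a zero object need not be zero itself.
        Choosing the zero cokernel as its own hull preserves vanishing, as the last clause of
        \<open>weak_hull\<close> demands.\<close>
      case True
      have "Ident \<A> (Cod \<A> c) \<in> Hom \<A> (Cod \<A> c) (Cod \<A> c)" using QO by (simp add: Hom_iff)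
      moreover have "monic \<A> (Ident \<A> (Cod \<A> c))"
        unfolding monic_def using QO by (auto simp: Hom_iff)
      ultimately show thesis using that[of "Cod \<A> c"] True zero_object_injective by blast
    qed (use hullE[OF QO] that in blast)
    have EO: "E \<in> Obj \<A>" using E(1) by (rule injective_object_Obj)
    have "weak_hull P f E (m \<cdot> c)"
      unfolding weak_hull_def X_def[symmetric] Y_def[symmetric] if_not_P[OF False]
    proof (intro conjI allI impI)
      show "injective_object \<A> E" by fact
      show "m \<cdot> c \<in> Hom \<A> Y E" using E cD by (auto simp: Hom_iff)
      show "m \<cdot> c \<cdot> f = Zero \<A> X E" using E cD fH O by (simp add: Hom_iff)
      show "is_zero_object \<A> E" if "is_zero_object \<A> Y"
        using Ez zero_object_epic[OF that cD(3,1)] by blast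
      fix E' y assume E': "injective_object \<A> E'" and y: "y \<in> Hom \<A> Y E'"
        and yf: "y \<cdot> f = Zero \<A> X E'"
      obtain y' where y': "y' \<in> Hom \<A> (Cod \<A> c) E'" "y' \<cdot> c = y"
        using cokernelE[OF c fH y yf] by blast
      obtain e where e: "e \<in> Hom \<A> E E'" "e \<cdot> m = y'"
        using injective_objectE[OF E' E(3,2) y'(1)] by blast
      have "e \<cdot> (m \<cdot> c) = y' \<cdot> c" unfolding e(2)[symmetric] using e(1) E cD by (simp add: Hom_iff)
      then show "\<exists>\<epsilon>\<in>Hom \<A> E E'. \<epsilon> \<cdot> (m \<cdot> c) = y" using e y' by auto
    qed
    then show ?thesis by blast
  qed
qed

section \<open>Short exact sequences and their splicing\<close>

definition short_exact :: "'a \<Rightarrow> 'b \<Rightarrow> 'a \<Rightarrow> 'b \<Rightarrow> 'a \<Rightarrow> bool" where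
  "short_exact X f Y g Z \<longleftrightarrow> f \<in> Hom \<A> X Y \<and> g \<in> Hom \<A> Y Z \<and>
     monic \<A> f \<and> exact_at \<A> f g \<and> epic \<A> g"

lemma short_exactI:
  assumes "f \<in> Hom \<A> X Y" "g \<in> Hom \<A> Y Z" "g \<cdot> f = Zero \<A> X Z"
    "\<And>E x. \<lbrakk>injective_object \<A> E; x \<in> Hom \<A> X E\<rbrakk> \<Longrightarrow> \<exists>y\<in>Hom \<A> Y E. y \<cdot> f = x"
    "\<And>E y. \<lbrakk>injective_object \<A> E; y \<in> Hom \<A> Y E; y \<cdot> f = Zero \<A> X E\<rbrakk>
       \<Longrightarrow> \<exists>z\<in>Hom \<A> Z E. z \<cdot> g = y"
    "\<And>E z. \<lbrakk>injective_object \<A> E; z \<in> Hom \<A> Z E; z \<cdot> g = Zero \<A> Y E\<rbrakk> \<Longrightarrow> z = Zero \<A> Z E"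
  shows "short_exact X f Y g Z"
  unfolding short_exact_def
  using assms(1,2) monicI[OF assms(1,4)] exact_atI[OF assms(1-3,5)] epicI[OF assms(2,6)] by blast

text \<open>A map that kills \<open>\<eta> n\<close> descends along \<open>\<pi> n\<close> to
  \<open>X (Suc n)\<close> and then extends along the monic \<open>\<eta> (Suc n)\<close>. A map
  that kills \<open>\<eta> (Suc n) \<cdot> \<pi> n\<close> already kills
  \<open>\<eta> (Suc n)\<close>, since \<open>\<pi> n\<close> is epic. These two remarks give
  exactness at every place.\<close>

lemma short_exact_splice:
  fixes X I :: "nat \<Rightarrow> 'a" and \<eta> \<pi> :: "nat \<Rightarrow> 'b"
  assumes se: "\<And>n. short_exact (X n) (\<eta> n) (I n) (\<pi> n) (X (Suc n))"
  shows "exact_coresolution \<A> (X 0) (\<eta> 0) I (\<lambda>p. \<eta> (Suc p) \<cdot> \<pi> p)"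
proof -
  have H: "\<eta> n \<in> Hom \<A> (X n) (I n)" "\<pi> n \<in> Hom \<A> (I n) (X (Suc n))" "monic \<A> (\<eta> n)"
    "exact_at \<A> (\<eta> n) (\<pi> n)" "epic \<A> (\<pi> n)" for n
    using se[of n] by (auto simp: short_exact_def)
  have Hc [simp]: "\<eta> n \<in> Arr \<A>" "\<pi> n \<in> Arr \<A>" "Dom \<A> (\<eta> n) = X n" "Cod \<A> (\<eta> n) = I n"
    "Dom \<A> (\<pi> n) = I n" "Cod \<A> (\<pi> n) = X (Suc n)" for n
    using H(1,2)[of n] by (auto simp: Hom_iff)
  have O [simp]: "X n \<in> Obj \<A>" "I n \<in> Obj \<A>" for n
    using Hom_Obj[OF H(1)] by blast+
  have pe: "\<pi> n \<cdot> \<eta> n = Zero \<A> (X n) (X (Suc n))" for n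
    using exact_atD[OF H(4,1,2)] .
  have ext: "\<exists>z\<in>Hom \<A> (I (Suc n)) E. z \<cdot> (\<eta> (Suc n) \<cdot> \<pi> n) = y"
    if E: "injective_object \<A> E" and y: "y \<in> Hom \<A> (I n) E" "y \<cdot> \<eta> n = Zero \<A> (X n) E" for E y n
  proof -
    obtain z where z: "z \<in> Hom \<A> (X (Suc n)) E" "z \<cdot> \<pi> n = y"
      using exact_atE[OF H(4) H(1,2) E y] by blast
    obtain w where w: "w \<in> Hom \<A> (I (Suc n)) E" "w \<cdot> \<eta> (Suc n) = z"
      using injective_objectE[OF E H(3) H(1) z(1)] by blast
    have "w \<cdot> (\<eta> (Suc n) \<cdot> \<pi> n) = z \<cdot> \<pi> n"
      unfolding w(2)[symmetric] using w(1) by (simp add: Hom_iff)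
    then show ?thesis using w z by auto
  qed
  show ?thesis
    unfolding exact_coresolution_def
  proof (intro conjI allI)
    show "\<eta> 0 \<in> Hom \<A> (X 0) (I 0)" "monic \<A> (\<eta> 0)" using H by auto
    show "\<eta> (Suc p) \<cdot> \<pi> p \<in> Hom \<A> (I p) (I (Suc p))" for p by (simp add: Hom_iff)
    show "exact_at \<A> (\<eta> 0) (\<eta> (Suc 0) \<cdot> \<pi> 0)"
      by (rule exact_atI[OF H(1), where Z = "I (Suc 0)"]) (simp_all add: Hom_iff pe ext[unfolded Hom_iff])
    fix p
    show "exact_at \<A> (\<eta> (Suc p) \<cdot> \<pi> p) (\<eta> (Suc (Suc p)) \<cdot> \<pi> (Suc p))"
    proof (rule exact_atI)
      show "\<eta> (Suc p) \<cdot> \<pi> p \<in> Hom \<A> (I p) (I (Suc p))"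
        "\<eta> (Suc (Suc p)) \<cdot> \<pi> (Suc p) \<in> Hom \<A> (I (Suc p)) (I (Suc (Suc p)))"
        by (auto simp: Hom_iff)
      have "\<eta> (Suc (Suc p)) \<cdot> \<pi> (Suc p) \<cdot> (\<eta> (Suc p) \<cdot> \<pi> p)
          = \<eta> (Suc (Suc p)) \<cdot> ((\<pi> (Suc p) \<cdot> \<eta> (Suc p)) \<cdot> \<pi> p)" by simp
      then show "\<eta> (Suc (Suc p)) \<cdot> \<pi> (Suc p) \<cdot> (\<eta> (Suc p) \<cdot> \<pi> p) = Zero \<A> (I p) (I (Suc (Suc p)))"
        unfolding pe by simp
      fix E y assume E: "injective_object \<A> E" and y: "y \<in> Hom \<A> (I (Suc p)) E"
        and y0: "y \<cdot> (\<eta> (Suc p) \<cdot> \<pi> p) = Zero \<A> (I p) E"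
      have "y \<cdot> \<eta> (Suc p) = Zero \<A> (X (Suc p)) E"
        by (rule epicD0[OF H(5,2)]) (use y y0 in \<open>auto simp: Hom_iff\<close>)
      then show "\<exists>z\<in>Hom \<A> (I (Suc (Suc p))) E. z \<cdot> (\<eta> (Suc (Suc p)) \<cdot> \<pi> (Suc p)) = y"
        using ext[OF E y] by blast
    qed
  qed
qed

section \<open>Cocycles, coboundaries and cohomology\<close>

text \<open>Evaluates the definite description of an induced map: uniqueness comes from the monic
  \<open>m'\<close>, while the candidate \<open>u\<close> is supplied by a kernel factorisation at
  each use.\<close>

lemma induced_sub_eq:
  assumes "m' \<in> Hom \<A> M' X'" "monic \<A> m'" "Dom \<A> m = M" "u \<in> Hom \<A> M M'" "m' \<cdot> u = h \<cdot> m"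
  shows "induced_sub \<A> m m' h = u"
proof -
  have D: "Dom \<A> m' = M'" using assms(1) by (simp add: Hom_iff)
  show ?thesis
    unfolding induced_sub_def D assms(3)
  proof (rule the_equality)
    show "v = u" if "v \<in> Hom \<A> M M' \<and> m' \<cdot> v = h \<cdot> m" for v
      by (rule monicD[OF assms(2,1)]) (use that assms in auto)
  qed (use assms in auto)
qed

lemma induced_quot_eq:
  assumes "c \<in> Hom \<A> X M" "epic \<A> c" "Cod \<A> c' = M'" "u \<in> Hom \<A> M M'" "u \<cdot> c = c' \<cdot> h"
  shows "induced_quot \<A> c c' h = u"
proof -
  have D: "Cod \<A> c = M" using assms(1) by (simp add: Hom_iff)
  show ?thesis
    unfolding induced_quot_def D assms(3)
  proof (rule the_equality)
    show "v = u" if "v \<in> Hom \<A> M M' \<and> v \<cdot> c = c' \<cdot> h" for v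
      by (rule epicD[OF assms(2,1)]) (use that assms in auto)
  qed (use assms in auto)
qed

context
  fixes X assumes X: "cochain_complex \<A> X"
begin

lemma complex_Arr [simp]:
  "ob X q \<in> Obj \<A>" "df X q \<in> Arr \<A>" "Dom \<A> (df X q) = ob X q" "Cod \<A> (df X q) = ob X (q + 1)"
  using X by (auto simp: cochain_complex_def Hom_iff)

lemma complex_dd [simp]:
  "df X (q + 1) \<cdot> df X q = Zero \<A> (ob X q) (ob X (q + 1 + 1))"
  "df X q \<cdot> df X (q - 1) = Zero \<A> (ob X (q - 1)) (ob X (q + 1))"
proof -
  show *: "df X (q + 1) \<cdot> df X q = Zero \<A> (ob X q) (ob X (q + 1 + 1))" for q
    using X by (auto simp: cochain_complex_def)
  show "df X q \<cdot> df X (q - 1) = Zero \<A> (ob X (q - 1)) (ob X (q + 1))"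
    using *[of "q - 1"] by simp
qed

lemma cocycle_incD:
  "cocycle_inc \<A> X q \<in> Hom \<A> (cocycles \<A> X q) (ob X q)" "monic \<A> (cocycle_inc \<A> X q)"
  "df X q \<cdot> cocycle_inc \<A> X q = Zero \<A> (cocycles \<A> X q) (ob X (q + 1))"
  "is_kernel \<A> (df X q) (cocycle_inc \<A> X q)"
proof -
  show k: "is_kernel \<A> (df X q) (cocycle_inc \<A> X q)"
    unfolding cocycle_inc_def by (rule is_kernel_ker_arr) simp
  have "df X q \<in> Hom \<A> (ob X q) (ob X (q + 1))" by (simp add: Hom_iff)
  from kernelD[OF k this]
  show "cocycle_inc \<A> X q \<in> Hom \<A> (cocycles \<A> X q) (ob X q)" "monic \<A> (cocycle_inc \<A> X q)"
    "df X q \<cdot> cocycle_inc \<A> X q = Zero \<A> (cocycles \<A> X q) (ob X (q + 1))"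
    by (auto simp: cocycles_def)
qed

lemma cobound_incD:
  "cobound_inc \<A> X q \<in> Hom \<A> (cobounds \<A> X q) (ob X q)" "monic \<A> (cobound_inc \<A> X q)"
  "is_kernel \<A> (coker_arr \<A> (df X (q - 1))) (cobound_inc \<A> X q)"
proof -
  have "df X (q - 1) \<in> Hom \<A> (ob X (q - 1)) (ob X q)" by (simp add: Hom_iff)
  from im_arrD[OF this]
  show "cobound_inc \<A> X q \<in> Hom \<A> (cobounds \<A> X q) (ob X q)" "monic \<A> (cobound_inc \<A> X q)"
    "is_kernel \<A> (coker_arr \<A> (df X (q - 1))) (cobound_inc \<A> X q)"
    by (auto simp: cobounds_def cobound_inc_def)
qed

lemma cobound_inc_zero_iff:
  assumes "y \<in> Hom \<A> (ob X q) W"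
  shows "y \<cdot> cobound_inc \<A> X q = Zero \<A> (cobounds \<A> X q) W \<longleftrightarrow>
         y \<cdot> df X (q - 1) = Zero \<A> (ob X (q - 1)) W"
proof -
  have "df X (q - 1) \<in> Hom \<A> (ob X (q - 1)) (ob X q)" by (simp add: Hom_iff)
  from im_arr_zero_iff[OF this assms] show ?thesis by (simp add: cobounds_def cobound_inc_def)
qed

lemma cocycles_Arr [simp]:
  "cocycle_inc \<A> X q \<in> Arr \<A>" "Dom \<A> (cocycle_inc \<A> X q) = cocycles \<A> X q"
  "Cod \<A> (cocycle_inc \<A> X q) = ob X q" "cocycles \<A> X q \<in> Obj \<A>"
  using cocycle_incD(1)[of q] Hom_Obj[OF cocycle_incD(1)] by (auto simp: Hom_iff)

lemma cobounds_Arr [simp]: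
  "cobound_inc \<A> X q \<in> Arr \<A>" "Dom \<A> (cobound_inc \<A> X q) = cobounds \<A> X q"
  "Cod \<A> (cobound_inc \<A> X q) = ob X q" "cobounds \<A> X q \<in> Obj \<A>"
  using cobound_incD(1)[of q] Hom_Obj[OF cobound_incD(1)] by (auto simp: Hom_iff)

lemma cobound_to_cocycleD:
  "cobound_to_cocycle \<A> X q \<in> Hom \<A> (cobounds \<A> X q) (cocycles \<A> X q)"
  "cocycle_inc \<A> X q \<cdot> cobound_to_cocycle \<A> X q = cobound_inc \<A> X q"
proof -
  have d: "df X q \<in> Hom \<A> (ob X q) (ob X (q + 1))" by (simp add: Hom_iff)
  then have "df X q \<cdot> cobound_inc \<A> X q = Zero \<A> (cobounds \<A> X q) (ob X (q + 1))"
    by (simp add: cobound_inc_zero_iff)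
  from kernelE[OF cocycle_incD(4) d cobound_incD(1) this]
  obtain u where u: "u \<in> Hom \<A> (cobounds \<A> X q) (cocycles \<A> X q)"
    "cocycle_inc \<A> X q \<cdot> u = cobound_inc \<A> X q" by auto
  then have "cobound_to_cocycle \<A> X q = u"
    unfolding cobound_to_cocycle_def
    by (intro induced_sub_eq[OF cocycle_incD(1,2)]) auto
  then show "cobound_to_cocycle \<A> X q \<in> Hom \<A> (cobounds \<A> X q) (cocycles \<A> X q)"
    "cocycle_inc \<A> X q \<cdot> cobound_to_cocycle \<A> X q = cobound_inc \<A> X q" using u by auto
qed

lemma cobound_to_cocycle_Arr [simp]:
  "cobound_to_cocycle \<A> X q \<in> Arr \<A>" "Dom \<A> (cobound_to_cocycle \<A> X q) = cobounds \<A> X q"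
  "Cod \<A> (cobound_to_cocycle \<A> X q) = cocycles \<A> X q"
  using cobound_to_cocycleD(1)[of q] by (auto simp: Hom_iff)

lemma cohom_projD:
  "is_cokernel \<A> (cobound_to_cocycle \<A> X q) (cohom_proj \<A> X q)"
  "cohom_proj \<A> X q \<in> Hom \<A> (cocycles \<A> X q) (cohom \<A> X q)" "epic \<A> (cohom_proj \<A> X q)"
  "cohom_proj \<A> X q \<cdot> cobound_to_cocycle \<A> X q = Zero \<A> (cobounds \<A> X q) (cohom \<A> X q)"
proof -
  show c: "is_cokernel \<A> (cobound_to_cocycle \<A> X q) (cohom_proj \<A> X q)"
    unfolding cohom_proj_def by (rule is_cokernel_coker_arr) simp
  from cokernelD[OF c cobound_to_cocycleD(1)]
  show "cohom_proj \<A> X q \<in> Hom \<A> (cocycles \<A> X q) (cohom \<A> X q)" "epic \<A> (cohom_proj \<A> X q)"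
    "cohom_proj \<A> X q \<cdot> cobound_to_cocycle \<A> X q = Zero \<A> (cobounds \<A> X q) (cohom \<A> X q)"
    by (auto simp: cohom_def)
qed

lemma cohom_Arr [simp]:
  "cohom_proj \<A> X q \<in> Arr \<A>" "Dom \<A> (cohom_proj \<A> X q) = cocycles \<A> X q"
  "Cod \<A> (cohom_proj \<A> X q) = cohom \<A> X q" "cohom \<A> X q \<in> Obj \<A>"
  using cohom_projD(2)[of q] Hom_Obj[OF cohom_projD(2)] by (auto simp: Hom_iff)

text \<open>Together with \<open>cohom_extend\<close> this reduces cohomology to maps on
  \<open>ob X q\<close>: injective-valued maps on cohomology are those induced by injective-valued
  maps on \<open>ob X q\<close> that kill the coboundaries.\<close>

lemma cohom_factor:
  assumes "y \<in> Hom \<A> (ob X q) W" "y \<cdot> df X (q - 1) = Zero \<A> (ob X (q - 1)) W"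
  obtains h where "h \<in> Hom \<A> (cohom \<A> X q) W" "h \<cdot> cohom_proj \<A> X q = y \<cdot> cocycle_inc \<A> X q"
proof -
  have "y \<cdot> cobound_inc \<A> X q = Zero \<A> (cobounds \<A> X q) W"
    using assms by (simp add: cobound_inc_zero_iff)
  then have "y \<cdot> cocycle_inc \<A> X q \<cdot> cobound_to_cocycle \<A> X q = Zero \<A> (cobounds \<A> X q) W"
    using assms(1) by (simp add: Hom_iff cobound_to_cocycleD(2))
  moreover have "y \<cdot> cocycle_inc \<A> X q \<in> Hom \<A> (cocycles \<A> X q) W"
    using assms by (simp add: Hom_iff)
  ultimately show thesis
    using cokernelE[OF cohom_projD(1) cobound_to_cocycleD(1)] that unfolding cohom_def by blast
qed

lemma cocycles_extend:
  assumes E: "injective_object \<A> E" and y: "y \<in> Hom \<A> (cocycles \<A> X q) E"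
  obtains x where "x \<in> Hom \<A> (ob X q) E" "x \<cdot> cocycle_inc \<A> X q = y"
  using injective_objectE[OF E cocycle_incD(2) cocycle_incD(1) y] by blast

text \<open>The cocycles are the kernel of the differential, so \<open>kernel_coextend\<close>
  applies. This carries a chase from degree \<open>q\<close> to degree \<open>q + 1\<close>.\<close>

lemma cocycles_zeroE:
  assumes E: "injective_object \<A> E" and y: "y \<in> Hom \<A> (ob X q) E"
    and 0: "y \<cdot> cocycle_inc \<A> X q = Zero \<A> (cocycles \<A> X q) E"
  obtains z where "z \<in> Hom \<A> (ob X (q + 1)) E" "z \<cdot> df X q = y"
proof -
  have d: "df X q \<in> Hom \<A> (ob X q) (ob X (q + 1))" by (simp add: Hom_iff)
  show thesis
    using kernel_coextend[OF cocycle_incD(4) d E y] 0 that unfolding cocycles_def by blast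
qed

lemma cobounds_extend:
  assumes E: "injective_object \<A> E" and y: "y \<in> Hom \<A> (cobounds \<A> X q) E"
  obtains x where "x \<in> Hom \<A> (ob X q) E" "x \<cdot> cobound_inc \<A> X q = y"
  using injective_objectE[OF E cobound_incD(2) cobound_incD(1) y] by blast

text \<open>The map \<open>x\<close> is extended from the cocycles. It kills the coboundaries
  because these lie inside the cocycles, where \<open>x\<close> is \<open>y\<close> after
  \<open>cohom_proj\<close>.\<close>

lemma cohom_extend:
  assumes E: "injective_object \<A> E" and y: "y \<in> Hom \<A> (cohom \<A> X q) E"
  obtains x where "x \<in> Hom \<A> (ob X q) E" "x \<cdot> df X (q - 1) = Zero \<A> (ob X (q - 1)) E"
    "x \<cdot> cocycle_inc \<A> X q = y \<cdot> cohom_proj \<A> X q"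
proof -
  have EO: "E \<in> Obj \<A>" using E by (rule injective_object_Obj)
  have "y \<cdot> cohom_proj \<A> X q \<in> Hom \<A> (cocycles \<A> X q) E" using y by (simp add: Hom_iff)
  then obtain x where x: "x \<in> Hom \<A> (ob X q) E" "x \<cdot> cocycle_inc \<A> X q = y \<cdot> cohom_proj \<A> X q"
    using cocycles_extend[OF E] by blast
  have "x \<cdot> cobound_inc \<A> X q = x \<cdot> cocycle_inc \<A> X q \<cdot> cobound_to_cocycle \<A> X q"
    using x(1) by (simp add: Hom_iff cobound_to_cocycleD(2))
  also have "\<dots> = y \<cdot> (cohom_proj \<A> X q \<cdot> cobound_to_cocycle \<A> X q)"
    unfolding x(2) using y by (simp add: Hom_iff)
  also have "\<dots> = Zero \<A> (cobounds \<A> X q) E"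
    unfolding cohom_projD(4) using y by (simp add: Hom_iff)
  finally show thesis using that x by (simp add: cobound_inc_zero_iff)
qed

end

section \<open>Functoriality of cocycles, coboundaries and cohomology\<close>

lemma chain_map_Arr:
  assumes f: "chain_map \<A> X Y f"
  shows
  "f q \<in> Arr \<A>" "Dom \<A> (f q) = ob X q" "Cod \<A> (f q) = ob Y q"
  using f by (auto simp: chain_map_def Hom_iff)

lemma chain_map_commute:
  assumes f: "chain_map \<A> X Y f"
  shows
  "df Y q \<cdot> f q = f (q + 1) \<cdot> df X q" "df Y (q - 1) \<cdot> f (q - 1) = f q \<cdot> df X (q - 1)"
proof -
  show *: "df Y q \<cdot> f q = f (q + 1) \<cdot> df X q" for q using f by (auto simp: chain_map_def)
  show "df Y (q - 1) \<cdot> f (q - 1) = f q \<cdot> df X (q - 1)" using *[of "q - 1"] by simp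
qed

context
  fixes X Y f assumes X: "cochain_complex \<A> X" and Y: "cochain_complex \<A> Y" and f: "chain_map \<A> X Y f"
begin

lemmas chain_map_simps [simp] = complex_Arr[OF X] complex_Arr[OF Y] chain_map_Arr[OF f]
  complex_dd[OF X] complex_dd[OF Y] cocycles_Arr[OF X] cocycles_Arr[OF Y]
  cobounds_Arr[OF X] cobounds_Arr[OF Y] cohom_Arr[OF X] cohom_Arr[OF Y]
  cobound_to_cocycle_Arr[OF X] cobound_to_cocycle_Arr[OF Y]

lemma cocycles_mapD:
  "cocycles_map \<A> X Y f q \<in> Hom \<A> (cocycles \<A> X q) (cocycles \<A> Y q)"
  "cocycle_inc \<A> Y q \<cdot> cocycles_map \<A> X Y f q = f q \<cdot> cocycle_inc \<A> X q"
proof -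
  have d: "df Y q \<in> Hom \<A> (ob Y q) (ob Y (q + 1))" by (simp add: Hom_iff)
  have "df Y q \<cdot> (f q \<cdot> cocycle_inc \<A> X q) = (df Y q \<cdot> f q) \<cdot> cocycle_inc \<A> X q" by simp
  also have "\<dots> = Zero \<A> (cocycles \<A> X q) (ob Y (q + 1))"
    unfolding chain_map_commute[OF f] using cocycle_incD(3)[OF X] by simp
  finally obtain u where u: "u \<in> Hom \<A> (cocycles \<A> X q) (cocycles \<A> Y q)"
    "cocycle_inc \<A> Y q \<cdot> u = f q \<cdot> cocycle_inc \<A> X q"
    using kernelE[OF cocycle_incD(4)[OF Y] d, of "f q \<cdot> cocycle_inc \<A> X q" "cocycles \<A> X q"]
    by (auto simp: Hom_iff)
  then have "cocycles_map \<A> X Y f q = u"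
    unfolding cocycles_map_def
    by (intro induced_sub_eq[OF cocycle_incD(1,2)[OF Y]]) auto
  then show "cocycles_map \<A> X Y f q \<in> Hom \<A> (cocycles \<A> X q) (cocycles \<A> Y q)"
    "cocycle_inc \<A> Y q \<cdot> cocycles_map \<A> X Y f q = f q \<cdot> cocycle_inc \<A> X q" using u by auto
qed

text \<open>The coboundaries of \<open>Y\<close> are the kernel of the cokernel \<open>c\<close> of
  the incoming differential, so it suffices that \<open>c \<cdot> f q\<close> kills the coboundaries
  of \<open>X\<close>. The chain map equation moves \<open>f\<close> to the other side of the
  differential, which \<open>c\<close> kills.\<close>

lemma cobounds_mapD:
  "cobounds_map \<A> X Y f q \<in> Hom \<A> (cobounds \<A> X q) (cobounds \<A> Y q)"
  "cobound_inc \<A> Y q \<cdot> cobounds_map \<A> X Y f q = f q \<cdot> cobound_inc \<A> X q"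
proof -
  have d: "df Y (q - 1) \<in> Hom \<A> (ob Y (q - 1)) (ob Y q)" by (simp add: Hom_iff)
  define c where "c = coker_arr \<A> (df Y (q - 1))"
  have ck: "is_cokernel \<A> (df Y (q - 1)) c" unfolding c_def by (rule is_cokernel_coker_arr) simp
  note cD = cokernelD[OF ck d]
  have CO: "Cod \<A> c \<in> Obj \<A>" using Hom_Obj cD by blast
  have "(c \<cdot> f q) \<cdot> df X (q - 1) = c \<cdot> (df Y (q - 1) \<cdot> f (q - 1))"
    unfolding chain_map_commute[OF f] using cD(1) by (simp add: Hom_iff)
  also have "\<dots> = (c \<cdot> df Y (q - 1)) \<cdot> f (q - 1)" using cD(1) by (simp add: Hom_iff)
  also have "\<dots> = Zero \<A> (ob X (q - 1)) (Cod \<A> c)" unfolding cD(2) using CO by simp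
  finally have "(c \<cdot> f q) \<cdot> cobound_inc \<A> X q = Zero \<A> (cobounds \<A> X q) (Cod \<A> c)"
    using cD(1) by (subst cobound_inc_zero_iff[OF X]) (auto simp: Hom_iff)
  then have "c \<cdot> (f q \<cdot> cobound_inc \<A> X q) = Zero \<A> (cobounds \<A> X q) (Cod \<A> c)"
    using cD(1) by (simp add: Hom_iff)
  then obtain u where u: "u \<in> Hom \<A> (cobounds \<A> X q) (cobounds \<A> Y q)"
    "cobound_inc \<A> Y q \<cdot> u = f q \<cdot> cobound_inc \<A> X q"
    using kernelE[OF cobound_incD(3)[OF Y, of q, folded c_def] cD(1), of "f q \<cdot> cobound_inc \<A> X q" "cobounds \<A> X q"]
    by (auto simp: Hom_iff)
  then have "cobounds_map \<A> X Y f q = u"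
    unfolding cobounds_map_def
    by (intro induced_sub_eq[OF cobound_incD(1,2)[OF Y]]) auto
  then show "cobounds_map \<A> X Y f q \<in> Hom \<A> (cobounds \<A> X q) (cobounds \<A> Y q)"
    "cobound_inc \<A> Y q \<cdot> cobounds_map \<A> X Y f q = f q \<cdot> cobound_inc \<A> X q" using u by auto
qed

lemma cocycles_map_Arr [simp]:
  "cocycles_map \<A> X Y f q \<in> Arr \<A>" "Dom \<A> (cocycles_map \<A> X Y f q) = cocycles \<A> X q"
  "Cod \<A> (cocycles_map \<A> X Y f q) = cocycles \<A> Y q"
  using cocycles_mapD(1)[of q] by (auto simp: Hom_iff)

lemma cobounds_map_Arr [simp]:
  "cobounds_map \<A> X Y f q \<in> Arr \<A>" "Dom \<A> (cobounds_map \<A> X Y f q) = cobounds \<A> X q"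
  "Cod \<A> (cobounds_map \<A> X Y f q) = cobounds \<A> Y q"
  using cobounds_mapD(1)[of q] by (auto simp: Hom_iff)

text \<open>The maps on coboundaries and on cocycles commute with the inclusions of one into the
  other, since they do so after the monic inclusion of cocycles into \<open>ob Y q\<close>. Hence
  the map on cocycles descends to the cokernels.\<close>

lemma cohom_mapD:
  "cohom_map \<A> X Y f q \<in> Hom \<A> (cohom \<A> X q) (cohom \<A> Y q)"
  "cohom_map \<A> X Y f q \<cdot> cohom_proj \<A> X q = cohom_proj \<A> Y q \<cdot> cocycles_map \<A> X Y f q"
proof -
  have "cocycle_inc \<A> Y q \<cdot> (cocycles_map \<A> X Y f q \<cdot> cobound_to_cocycle \<A> X q)
      = (cocycle_inc \<A> Y q \<cdot> cocycles_map \<A> X Y f q) \<cdot> cobound_to_cocycle \<A> X q" by simp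
  also have "\<dots> = f q \<cdot> cobound_inc \<A> X q"
    unfolding cocycles_mapD by (simp add: cobound_to_cocycleD[OF X])
  also have "\<dots> = (cocycle_inc \<A> Y q \<cdot> cobound_to_cocycle \<A> Y q) \<cdot> cobounds_map \<A> X Y f q"
    unfolding cobounds_mapD(2)[symmetric] cobound_to_cocycleD(2)[OF Y] ..
  also have "\<dots> = cocycle_inc \<A> Y q \<cdot> (cobound_to_cocycle \<A> Y q \<cdot> cobounds_map \<A> X Y f q)" by simp
  finally have *: "cocycles_map \<A> X Y f q \<cdot> cobound_to_cocycle \<A> X q
      = cobound_to_cocycle \<A> Y q \<cdot> cobounds_map \<A> X Y f q"
    by - (rule monicD[OF cocycle_incD(2,1)[OF Y]]; auto simp: Hom_iff)
  have "cohom_proj \<A> Y q \<cdot> cocycles_map \<A> X Y f q \<cdot> cobound_to_cocycle \<A> X q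
      = (cohom_proj \<A> Y q \<cdot> cobound_to_cocycle \<A> Y q) \<cdot> cobounds_map \<A> X Y f q"
    using * by simp
  also have "\<dots> = Zero \<A> (cobounds \<A> X q) (cohom \<A> Y q)"
    unfolding cohom_projD(4)[OF Y] by simp
  finally obtain u where u: "u \<in> Hom \<A> (cohom \<A> X q) (cohom \<A> Y q)"
    "u \<cdot> cohom_proj \<A> X q = cohom_proj \<A> Y q \<cdot> cocycles_map \<A> X Y f q"
    using cokernelE[OF cohom_projD(1)[OF X] cobound_to_cocycleD(1)[OF X],
        where h = "cohom_proj \<A> Y q \<cdot> cocycles_map \<A> X Y f q" and W = "cohom \<A> Y q"]
    by (auto simp: Hom_iff)
  then have "cohom_map \<A> X Y f q = u"
    unfolding cohom_map_def
    by (intro induced_quot_eq[OF cohom_projD(2,3)[OF X]]) auto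
  then show "cohom_map \<A> X Y f q \<in> Hom \<A> (cohom \<A> X q) (cohom \<A> Y q)"
    "cohom_map \<A> X Y f q \<cdot> cohom_proj \<A> X q = cohom_proj \<A> Y q \<cdot> cocycles_map \<A> X Y f q"
    using u by auto
qed

lemma cohom_map_Arr [simp]:
  "cohom_map \<A> X Y f q \<in> Arr \<A>" "Dom \<A> (cohom_map \<A> X Y f q) = cohom \<A> X q"
  "Cod \<A> (cohom_map \<A> X Y f q) = cohom \<A> Y q"
  using cohom_mapD(1)[of q] by (auto simp: Hom_iff)

end

lemma chain_map_Comp:
  assumes X: "cochain_complex \<A> X" and Y: "cochain_complex \<A> Y" and Z: "cochain_complex \<A> Z"
    and f: "chain_map \<A> X Y f" and g: "chain_map \<A> Y Z g"
  shows "chain_map \<A> X Z (\<lambda>q. g q \<cdot> f q)"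
  unfolding chain_map_def
proof (intro conjI allI)
  note [simp] = chain_map_Arr[OF f] chain_map_Arr[OF g] complex_Arr[OF X] complex_Arr[OF Y] complex_Arr[OF Z]
  fix q
  show "g q \<cdot> f q \<in> Hom \<A> (ob X q) (ob Z q)" by (simp add: Hom_iff)
  have "df Z q \<cdot> (g q \<cdot> f q) = (df Z q \<cdot> g q) \<cdot> f q" by simp
  also have "\<dots> = g (q + 1) \<cdot> (df Y q \<cdot> f q)" unfolding chain_map_commute[OF g] by simp
  also have "\<dots> = g (q + 1) \<cdot> f (q + 1) \<cdot> df X q" unfolding chain_map_commute[OF f] by simp
  finally show "df Z q \<cdot> (g q \<cdot> f q) = g (q + 1) \<cdot> f (q + 1) \<cdot> df X q" .
qed

text \<open>The steps of a spliced resolution are composites. Functoriality turns the composites of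
  induced maps produced by \<open>short_exact_splice\<close> into the induced maps of composites
  that \<open>CE_resolution\<close> refers to.\<close>

lemma induced_maps_Comp:
  assumes X: "cochain_complex \<A> X" and Y: "cochain_complex \<A> Y" and Z: "cochain_complex \<A> Z"
    and f: "chain_map \<A> X Y f" and g: "chain_map \<A> Y Z g"
  shows "cocycles_map \<A> X Z (\<lambda>q. g q \<cdot> f q) q = cocycles_map \<A> Y Z g q \<cdot> cocycles_map \<A> X Y f q"
    "cobounds_map \<A> X Z (\<lambda>q. g q \<cdot> f q) q = cobounds_map \<A> Y Z g q \<cdot> cobounds_map \<A> X Y f q"
    "cohom_map \<A> X Z (\<lambda>q. g q \<cdot> f q) q = cohom_map \<A> Y Z g q \<cdot> cohom_map \<A> X Y f q"
proof -
  note gf = chain_map_Comp[OF assms]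
  note [simp] = chain_map_simps[OF X Y f] chain_map_simps[OF Y Z g]
    cocycles_map_Arr[OF X Y f] cocycles_map_Arr[OF Y Z g] cocycles_map_Arr[OF X Z gf]
    cobounds_map_Arr[OF X Y f] cobounds_map_Arr[OF Y Z g] cobounds_map_Arr[OF X Z gf]
    cohom_map_Arr[OF X Y f] cohom_map_Arr[OF Y Z g] cohom_map_Arr[OF X Z gf]
  have "cocycle_inc \<A> Z q \<cdot> (cocycles_map \<A> Y Z g q \<cdot> cocycles_map \<A> X Y f q)
      = (cocycle_inc \<A> Z q \<cdot> cocycles_map \<A> Y Z g q) \<cdot> cocycles_map \<A> X Y f q" by simp
  also have "\<dots> = g q \<cdot> (cocycle_inc \<A> Y q \<cdot> cocycles_map \<A> X Y f q)"
    unfolding cocycles_mapD[OF Y Z g] by simp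
  also have "\<dots> = g q \<cdot> f q \<cdot> cocycle_inc \<A> X q" unfolding cocycles_mapD[OF X Y f] by simp
  finally show z: "cocycles_map \<A> X Z (\<lambda>q. g q \<cdot> f q) q = cocycles_map \<A> Y Z g q \<cdot> cocycles_map \<A> X Y f q"
    unfolding cocycles_map_def[of _ X Z]
    by - (rule induced_sub_eq[OF cocycle_incD(1,2)[OF Z]]; simp add: Hom_iff)
  have "cobound_inc \<A> Z q \<cdot> (cobounds_map \<A> Y Z g q \<cdot> cobounds_map \<A> X Y f q)
      = (cobound_inc \<A> Z q \<cdot> cobounds_map \<A> Y Z g q) \<cdot> cobounds_map \<A> X Y f q" by simp
  also have "\<dots> = g q \<cdot> (cobound_inc \<A> Y q \<cdot> cobounds_map \<A> X Y f q)"
    unfolding cobounds_mapD[OF Y Z g] by simp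
  also have "\<dots> = g q \<cdot> f q \<cdot> cobound_inc \<A> X q" unfolding cobounds_mapD[OF X Y f] by simp
  finally show "cobounds_map \<A> X Z (\<lambda>q. g q \<cdot> f q) q = cobounds_map \<A> Y Z g q \<cdot> cobounds_map \<A> X Y f q"
    unfolding cobounds_map_def[of _ X Z]
    by - (rule induced_sub_eq[OF cobound_incD(1,2)[OF Z]]; simp add: Hom_iff)
  have "(cohom_map \<A> Y Z g q \<cdot> cohom_map \<A> X Y f q) \<cdot> cohom_proj \<A> X q
      = (cohom_map \<A> Y Z g q \<cdot> cohom_proj \<A> Y q) \<cdot> cocycles_map \<A> X Y f q"
    using cohom_mapD(2)[OF X Y f] by simp
  also have "\<dots> = cohom_proj \<A> Z q \<cdot> cocycles_map \<A> X Z (\<lambda>q. g q \<cdot> f q) q"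
    unfolding cohom_mapD(2)[OF Y Z g] z by simp
  finally show "cohom_map \<A> X Z (\<lambda>q. g q \<cdot> f q) q = cohom_map \<A> Y Z g q \<cdot> cohom_map \<A> X Y f q"
    unfolding cohom_map_def[of _ X Z]
    by - (rule induced_quot_eq[OF cohom_projD(2,3)[OF X]]; simp add: Hom_iff)
qed

section \<open>Cartan-Eilenberg exact sequences of complexes\<close>

text \<open>For an arrow \<open>\<eta> q\<close>, enough injectives make this equivalent to
  \<open>\<eta> q\<close> being monic. The dual form is the one that is easily checked on a direct
  summand of the target.\<close>

definition extends :: "('a, 'b) cochain \<Rightarrow> ('a, 'b) cochain \<Rightarrow> (int \<Rightarrow> 'b) \<Rightarrow> int \<Rightarrow> bool" where
  "extends A I \<eta> q \<longleftrightarrow>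
     (\<forall>E \<alpha>. injective_object \<A> E \<longrightarrow> \<alpha> \<in> Hom \<A> (ob A q) E \<longrightarrow>
        (\<exists>\<beta>\<in>Hom \<A> (ob I q) E. \<beta> \<cdot> \<eta> q = \<alpha>))"

text \<open>For a chain map \<open>\<eta>\<close> this says that the induced map from
  \<open>ob A q\<close> modulo coboundaries to \<open>ob I q\<close> modulo coboundaries is monic,
  expressed without quotient objects.\<close>

definition extends_cocycles ::
    "('a, 'b) cochain \<Rightarrow> ('a, 'b) cochain \<Rightarrow> (int \<Rightarrow> 'b) \<Rightarrow> int \<Rightarrow> bool" where
  "extends_cocycles A I \<eta> q \<longleftrightarrow>
     (\<forall>E \<alpha>. injective_object \<A> E \<longrightarrow> \<alpha> \<in> Hom \<A> (ob A q) E \<longrightarrow>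
        \<alpha> \<cdot> df A (q - 1) = Zero \<A> (ob A (q - 1)) E \<longrightarrow>
        (\<exists>\<beta>\<in>Hom \<A> (ob I q) E. \<beta> \<cdot> df I (q - 1) = Zero \<A> (ob I (q - 1)) E \<and> \<beta> \<cdot> \<eta> q = \<alpha>))"

text \<open>The weak inverse \<open>s\<close> of the differential encodes a splitting of the complex
  into its cohomology and a contractible part without naming the summands, and it is found
  componentwise on direct sums.\<close>

definition split_injective_complex :: "('a, 'b) cochain \<Rightarrow> bool" where
  "split_injective_complex I \<longleftrightarrow> cochain_complex \<A> I \<and>
     (\<forall>q. injective_object \<A> (ob I q)) \<and>
     (\<forall>q. \<exists>s\<in>Hom \<A> (ob I (q + 1)) (ob I q). df I q \<cdot> (s \<cdot> df I q) = df I q)"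

definition CE_short_exact :: "('a, 'b) cochain \<Rightarrow> (int \<Rightarrow> 'b) \<Rightarrow> ('a, 'b) cochain \<Rightarrow>
    (int \<Rightarrow> 'b) \<Rightarrow> ('a, 'b) cochain \<Rightarrow> bool" where
  "CE_short_exact A \<eta> I \<pi> A' \<longleftrightarrow>
     cochain_complex \<A> A \<and> cochain_complex \<A> I \<and> cochain_complex \<A> A' \<and>
     chain_map \<A> A I \<eta> \<and> chain_map \<A> I A' \<pi> \<and>
     (\<forall>q. short_exact (ob A q) (\<eta> q) (ob I q) (\<pi> q) (ob A' q)) \<and>
     (\<forall>q. extends_cocycles A I \<eta> q)"

lemma extendsE:
  assumes "extends A I \<eta> q" "injective_object \<A> E" "\<alpha> \<in> Hom \<A> (ob A q) E"
  obtains \<beta> where "\<beta> \<in> Hom \<A> (ob I q) E" "\<beta> \<cdot> \<eta> q = \<alpha>"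
  using assms unfolding extends_def by blast

lemma extends_cocyclesE:
  assumes "extends_cocycles A I \<eta> q" "injective_object \<A> E" "\<alpha> \<in> Hom \<A> (ob A q) E"
    "\<alpha> \<cdot> df A (q - 1) = Zero \<A> (ob A (q - 1)) E"
  obtains \<beta> where "\<beta> \<in> Hom \<A> (ob I q) E" "\<beta> \<cdot> df I (q - 1) = Zero \<A> (ob I (q - 1)) E"
    "\<beta> \<cdot> \<eta> q = \<alpha>"
  using assms unfolding extends_cocycles_def by blast

text \<open>Subtracting \<open>s d\<close> from the identity gives a projection onto the cocycles,
  and \<open>d s'\<close> is one onto the coboundaries. The latter also splits the coboundaries off
  the cocycles, with the cohomology as complement, so cohomology is a retract of a retract of
  \<open>ob I q\<close>.\<close>

lemma split_injective_complex_injective: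
  assumes "split_injective_complex I"
  shows "injective_object \<A> (cocycles \<A> I q)" "injective_object \<A> (cobounds \<A> I q)"
    "injective_object \<A> (cohom \<A> I q)"
proof -
  have I: "cochain_complex \<A> I" and inj: "\<And>q. injective_object \<A> (ob I q)"
    and ex: "\<And>q. \<exists>s\<in>Hom \<A> (ob I (q + 1)) (ob I q). df I q \<cdot> (s \<cdot> df I q) = df I q"
    using assms by (auto simp: split_injective_complex_def)
  note [simp] = complex_Arr[OF I] complex_dd[OF I] cocycles_Arr[OF I] cobounds_Arr[OF I]
    cohom_Arr[OF I] cobound_to_cocycle_Arr[OF I]
  define z where "z = cocycle_inc \<A> I q"
  define b where "b = cobound_inc \<A> I q"
  define j where "j = cobound_to_cocycle \<A> I q"
  define \<pi> where "\<pi> = cohom_proj \<A> I q"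
  note zD = cocycle_incD[OF I, of q, folded z_def] and bD = cobound_incD[OF I, of q, folded b_def]
    and jD = cobound_to_cocycleD[OF I, of q, folded j_def z_def b_def]
    and piD = cohom_projD[OF I, of q, folded \<pi>_def j_def]
  have [simp]: "z \<in> Arr \<A>" "Dom \<A> z = cocycles \<A> I q" "Cod \<A> z = ob I q"
    "b \<in> Arr \<A>" "Dom \<A> b = cobounds \<A> I q" "Cod \<A> b = ob I q"
    "j \<in> Arr \<A>" "Dom \<A> j = cobounds \<A> I q" "Cod \<A> j = cocycles \<A> I q"
    "\<pi> \<in> Arr \<A>" "Dom \<A> \<pi> = cocycles \<A> I q" "Cod \<A> \<pi> = cohom \<A> I q"
    by (auto simp: z_def b_def j_def \<pi>_def)
  obtain s where s: "s \<in> Hom \<A> (ob I (q + 1)) (ob I q)" "df I q \<cdot> (s \<cdot> df I q) = df I q"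
    using ex by blast
  have dq: "df I q \<in> Hom \<A> (ob I q) (ob I (q + 1))" by (simp add: Hom_iff)
  obtain s' where s': "s' \<in> Hom \<A> (ob I q) (ob I (q - 1))" "df I (q - 1) \<cdot> (s' \<cdot> df I (q - 1)) = df I (q - 1)"
    using ex[of "q - 1"] by auto
  have [simp]: "s \<in> Arr \<A>" "Dom \<A> s = ob I (q + 1)" "Cod \<A> s = ob I q"
    "s' \<in> Arr \<A>" "Dom \<A> s' = ob I q" "Cod \<A> s' = ob I (q - 1)" using s s' by (auto simp: Hom_iff)
  let ?p = "diff (Ident \<A> (ob I q)) (s \<cdot> df I q)"
  have "df I q \<cdot> ?p = Zero \<A> (ob I q) (ob I (q + 1))" using s(2) by simp
  then obtain r where r: "r \<in> Hom \<A> (ob I q) (cocycles \<A> I q)" "z \<cdot> r = ?p"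
    using kernelE[OF zD(4) dq, of ?p "ob I q"] by (auto simp: Hom_iff)
  have "z \<cdot> (r \<cdot> z) = ?p \<cdot> z" unfolding r(2)[symmetric] using r(1) by (simp add: Hom_iff)
  also have "\<dots> = z" using zD(3) by simp
  finally have rz: "r \<cdot> z = Ident \<A> (cocycles \<A> I q)"
    using r(1) by - (rule monicD[OF zD(2,1)]; auto simp: Hom_iff)
  show Z: "injective_object \<A> (cocycles \<A> I q)"
    using injective_retract[OF inj zD(1) r(1) rz] .
  obtain e where e: "e \<in> Hom \<A> (ob I (q - 1)) (cobounds \<A> I q)" "b \<cdot> e = df I (q - 1)" "epic \<A> e"
    using im_arr_factor[of "df I (q - 1)" "ob I (q - 1)" "ob I q"]
    unfolding b_def cobounds_def cobound_inc_def by (auto simp: Hom_iff)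
  have [simp]: "e \<in> Arr \<A>" "Dom \<A> e = ob I (q - 1)" "Cod \<A> e = cobounds \<A> I q"
    using e by (auto simp: Hom_iff)
  \<comment> \<open>With \<open>b \<cdot> e\<close> as image factorisation of the incoming
    differential, the splitting identity says that \<open>b e s' b e\<close> equals
    \<open>b e\<close>. Cancelling the monic \<open>b\<close> on the left and the epic
    \<open>e\<close> on the right makes \<open>e \<cdot> s'\<close> a retraction of
    \<open>b\<close>.\<close>
  have "b \<cdot> (e \<cdot> (s' \<cdot> (b \<cdot> e))) = (b \<cdot> e) \<cdot> (s' \<cdot> (b \<cdot> e))" by simp
  also have "\<dots> = b \<cdot> e" unfolding e(2) s'(2) ..
  finally have "e \<cdot> s' \<cdot> b \<cdot> e = Ident \<A> (cobounds \<A> I q) \<cdot> e"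
    by - (rule monicD[OF bD(2,1)]; auto simp: Hom_iff)
  then have eb: "e \<cdot> s' \<cdot> b = Ident \<A> (cobounds \<A> I q)"
    by - (rule epicD[OF e(3,1)]; auto simp: Hom_iff)
  show "injective_object \<A> (cobounds \<A> I q)"
    by (rule injective_retract[OF inj bD(1) _ eb]) (simp add: Hom_iff)
  \<comment> \<open>Since \<open>e \<cdot> s' \<cdot> z\<close> retracts \<open>j\<close>, the map
    \<open>?t\<close> kills the coboundaries and descends to a map \<open>\<sigma>\<close>, which is
    a section of \<open>\<pi>\<close>.\<close>
  let ?t = "diff (Ident \<A> (cocycles \<A> I q)) (j \<cdot> (e \<cdot> s' \<cdot> z))"
  have "e \<cdot> s' \<cdot> z \<cdot> j = Ident \<A> (cobounds \<A> I q)" unfolding eb[symmetric] jD(2)[symmetric] by simp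
  then have "?t \<cdot> j = Zero \<A> (cobounds \<A> I q) (cocycles \<A> I q)" by simp
  then obtain \<sigma> where \<sigma>: "\<sigma> \<in> Hom \<A> (cohom \<A> I q) (cocycles \<A> I q)" "\<sigma> \<cdot> \<pi> = ?t"
    using cokernelE[OF piD(1) jD(1), of ?t "cocycles \<A> I q"] by (auto simp: Hom_iff)
  have "\<pi> \<cdot> \<sigma> \<cdot> \<pi> = \<pi> \<cdot> ?t" unfolding \<sigma>(2)[symmetric] using \<sigma>(1) by (simp add: Hom_iff)
  also have "\<dots> = diff \<pi> ((\<pi> \<cdot> j) \<cdot> (e \<cdot> s' \<cdot> z))" by simp
  also have "\<dots> = \<pi>" unfolding piD(4) by simp
  finally have "\<pi> \<cdot> \<sigma> = Ident \<A> (cohom \<A> I q)"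
    using \<sigma>(1) by - (rule epicD[OF piD(3,2)]; auto simp: Hom_iff)
  then show "injective_object \<A> (cohom \<A> I q)"
    using injective_retract[OF Z \<sigma>(1) piD(2)] by blast
qed

context
  fixes A \<eta> I \<pi> A' assumes CE: "CE_short_exact A \<eta> I \<pi> A'"
begin

lemma CE_short_exactD:
  "cochain_complex \<A> A" "cochain_complex \<A> I" "cochain_complex \<A> A'"
  "chain_map \<A> A I \<eta>" "chain_map \<A> I A' \<pi>"
  "short_exact (ob A q) (\<eta> q) (ob I q) (\<pi> q) (ob A' q)" "extends_cocycles A I \<eta> q"
  using CE by (auto simp: CE_short_exact_def)

private lemmas A = CE_short_exactD(1) and I = CE_short_exactD(2) and A' = CE_short_exactD(3)
  and \<eta> = CE_short_exactD(4) and \<pi> = CE_short_exactD(5)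

private lemmas CE_simps = chain_map_simps[OF A I \<eta>] chain_map_simps[OF I A' \<pi>]
    cocycles_map_Arr[OF A I \<eta>] cocycles_map_Arr[OF I A' \<pi>]
    cobounds_map_Arr[OF A I \<eta>] cobounds_map_Arr[OF I A' \<pi>]
    cohom_map_Arr[OF A I \<eta>] cohom_map_Arr[OF I A' \<pi>]

private lemma objD:
  "\<eta> q \<in> Hom \<A> (ob A q) (ob I q)" "\<pi> q \<in> Hom \<A> (ob I q) (ob A' q)" "monic \<A> (\<eta> q)"
  "exact_at \<A> (\<eta> q) (\<pi> q)" "epic \<A> (\<pi> q)" "\<pi> q \<cdot> \<eta> q = Zero \<A> (ob A q) (ob A' q)"
proof -
  show *: "\<eta> q \<in> Hom \<A> (ob A q) (ob I q)" "\<pi> q \<in> Hom \<A> (ob I q) (ob A' q)" "monic \<A> (\<eta> q)"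
    "exact_at \<A> (\<eta> q) (\<pi> q)" "epic \<A> (\<pi> q)"
    using CE_short_exactD(6)[of q] by (auto simp: short_exact_def)
  show "\<pi> q \<cdot> \<eta> q = Zero \<A> (ob A q) (ob A' q)" using exact_atD[OF *(4,1,2)] .
qed

text \<open>Taking cocycles is left exact for any short exact sequence of complexes. Surjectivity
  onto the cocycles of \<open>A'\<close> is where \<open>extends_cocycles\<close> enters, in degree
  \<open>q + 1\<close>: it makes the connecting homomorphism from degree \<open>q\<close> of
  \<open>A'\<close> to degree \<open>q + 1\<close> of \<open>A\<close> vanish.\<close>

lemma short_exact_cocycles:
  "short_exact (cocycles \<A> A q) (cocycles_map \<A> A I \<eta> q) (cocycles \<A> I q)
     (cocycles_map \<A> I A' \<pi> q) (cocycles \<A> A' q)"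
proof (rule short_exactI)
  note [simp] = CE_simps
  let ?f = "cocycles_map \<A> A I \<eta> q" and ?g = "cocycles_map \<A> I A' \<pi> q"
  let ?z = "cocycle_inc \<A> A q" and ?y = "cocycle_inc \<A> I q" and ?x = "cocycle_inc \<A> A' q"
  note f = cocycles_mapD[OF A I \<eta>, of q] and g = cocycles_mapD[OF I A' \<pi>, of q]
  show "?f \<in> Hom \<A> (cocycles \<A> A q) (cocycles \<A> I q)" "?g \<in> Hom \<A> (cocycles \<A> I q) (cocycles \<A> A' q)"
    by (fact f g)+
  have "?x \<cdot> (?g \<cdot> ?f) = (?x \<cdot> ?g) \<cdot> ?f" by simp
  also have "\<dots> = \<pi> q \<cdot> (?y \<cdot> ?f)" unfolding g(2) by simp
  also have "\<dots> = (\<pi> q \<cdot> \<eta> q) \<cdot> ?z" unfolding f(2) by simp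
  also have "\<dots> = Zero \<A> (cocycles \<A> A q) (ob A' q)" unfolding objD(6) by simp
  finally show "?g \<cdot> ?f = Zero \<A> (cocycles \<A> A q) (cocycles \<A> A' q)"
    by - (rule monicD0[OF cocycle_incD(2,1)[OF A']]; simp add: Hom_iff)
next
  note [simp] = CE_simps
  let ?f = "cocycles_map \<A> A I \<eta> q" and ?z = "cocycle_inc \<A> A q" and ?y = "cocycle_inc \<A> I q"
  fix E \<zeta> assume E: "injective_object \<A> E" and \<zeta>: "\<zeta> \<in> Hom \<A> (cocycles \<A> A q) E"
  obtain \<alpha> where \<alpha>: "\<alpha> \<in> Hom \<A> (ob A q) E" "\<alpha> \<cdot> ?z = \<zeta>" using cocycles_extend[OF A E \<zeta>] .
  obtain \<beta> where \<beta>: "\<beta> \<in> Hom \<A> (ob I q) E" "\<beta> \<cdot> \<eta> q = \<alpha>"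
    using injective_objectE[OF E objD(3,1) \<alpha>(1)] .
  have "\<beta> \<cdot> ?y \<cdot> ?f = \<beta> \<cdot> \<eta> q \<cdot> ?z" using \<beta>(1) by (simp add: Hom_iff cocycles_mapD(2)[OF A I \<eta>])
  then have "\<beta> \<cdot> ?y \<cdot> ?f = \<zeta>" using \<alpha> \<beta> by simp
  moreover have "\<beta> \<cdot> ?y \<in> Hom \<A> (cocycles \<A> I q) E" using \<beta> by (simp add: Hom_iff)
  ultimately show "\<exists>\<xi>\<in>Hom \<A> (cocycles \<A> I q) E. \<xi> \<cdot> ?f = \<zeta>" by blast
next
  note [simp] = CE_simps
  let ?f = "cocycles_map \<A> A I \<eta> q" and ?g = "cocycles_map \<A> I A' \<pi> q"
  let ?z = "cocycle_inc \<A> A q" and ?y = "cocycle_inc \<A> I q" and ?x = "cocycle_inc \<A> A' q"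
  fix E \<zeta> assume E: "injective_object \<A> E" and \<zeta>: "\<zeta> \<in> Hom \<A> (cocycles \<A> I q) E"
    and \<zeta>0: "\<zeta> \<cdot> ?f = Zero \<A> (cocycles \<A> A q) E"
  have [simp]: "E \<in> Obj \<A>" using E by (rule injective_object_Obj)
  obtain x where x: "x \<in> Hom \<A> (ob I q) E" "x \<cdot> ?y = \<zeta>" using cocycles_extend[OF I E \<zeta>] .
  have "x \<cdot> \<eta> q \<cdot> ?z = \<zeta> \<cdot> ?f"
    unfolding x(2)[symmetric] using x(1) by (simp add: Hom_iff cocycles_mapD(2)[OF A I \<eta>])
  then have "x \<cdot> \<eta> q \<cdot> ?z = Zero \<A> (cocycles \<A> A q) E" using \<zeta>0 by simp
  moreover have "x \<cdot> \<eta> q \<in> Hom \<A> (ob A q) E" using x by (simp add: Hom_iff)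
  ultimately obtain y where y: "y \<in> Hom \<A> (ob A (q + 1)) E" "y \<cdot> df A q = x \<cdot> \<eta> q"
    using cocycles_zeroE[OF A E] by blast
  obtain y' where y': "y' \<in> Hom \<A> (ob I (q + 1)) E" "y' \<cdot> \<eta> (q + 1) = y"
    using injective_objectE[OF E objD(3,1) y(1)] .
  \<comment> \<open>Subtracting a map that factors through the differential does not change the
    restriction to cocycles, but it makes the result kill \<open>\<eta> q\<close> and hence descend
    to \<open>A'\<close>.\<close>
  let ?d = "diff x (y' \<cdot> df I q)"
  have d: "?d \<in> Hom \<A> (ob I q) E" using x y' by (auto simp: Hom_iff)
  have "(y' \<cdot> df I q) \<cdot> \<eta> q = y' \<cdot> (df I q \<cdot> \<eta> q)" using y' by (simp add: Hom_iff)
  also have "\<dots> = x \<cdot> \<eta> q"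
    unfolding chain_map_commute[OF \<eta>] y(2)[symmetric] y'(2)[symmetric] using y'(1) by (simp add: Hom_iff)
  finally have "?d \<cdot> \<eta> q = Zero \<A> (ob A q) E" using x y' by (auto simp: Hom_iff)
  then obtain w where w: "w \<in> Hom \<A> (ob A' q) E" "w \<cdot> \<pi> q = ?d"
    using exact_atE[OF objD(4,1,2) E d] by blast
  have "w \<cdot> ?x \<cdot> ?g = (w \<cdot> \<pi> q) \<cdot> ?y" using w(1) by (simp add: Hom_iff cocycles_mapD(2)[OF I A' \<pi>])
  also have "\<dots> = \<zeta>" unfolding w(2) x(2)[symmetric] using x(1) y' cocycle_incD(3)[OF I, of q]
    by (simp add: Hom_iff)
  finally have "w \<cdot> ?x \<cdot> ?g = \<zeta>" .
  moreover have "w \<cdot> ?x \<in> Hom \<A> (cocycles \<A> A' q) E" using w by (simp add: Hom_iff)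
  ultimately show "\<exists>\<xi>\<in>Hom \<A> (cocycles \<A> A' q) E. \<xi> \<cdot> ?g = \<zeta>" by blast
next
  note [simp] = CE_simps
  let ?g = "cocycles_map \<A> I A' \<pi> q" and ?y = "cocycle_inc \<A> I q" and ?x = "cocycle_inc \<A> A' q"
  fix E \<zeta> assume E: "injective_object \<A> E" and \<zeta>: "\<zeta> \<in> Hom \<A> (cocycles \<A> A' q) E"
    and \<zeta>0: "\<zeta> \<cdot> ?g = Zero \<A> (cocycles \<A> I q) E"
  have [simp]: "E \<in> Obj \<A>" using E by (rule injective_object_Obj)
  obtain x where x: "x \<in> Hom \<A> (ob A' q) E" "x \<cdot> ?x = \<zeta>" using cocycles_extend[OF A' E \<zeta>] .
  have [simp]: "x \<in> Arr \<A>" "Dom \<A> x = ob A' q" "Cod \<A> x = E" using x by (auto simp: Hom_iff)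
  have "x \<cdot> \<pi> q \<cdot> ?y = \<zeta> \<cdot> ?g"
    unfolding x(2)[symmetric] by (simp add: cocycles_mapD(2)[OF I A' \<pi>])
  then have "x \<cdot> \<pi> q \<cdot> ?y = Zero \<A> (cocycles \<A> I q) E" using \<zeta>0 by simp
  moreover have "x \<cdot> \<pi> q \<in> Hom \<A> (ob I q) E" by (simp add: Hom_iff)
  ultimately obtain y where y: "y \<in> Hom \<A> (ob I (q + 1)) E" "y \<cdot> df I q = x \<cdot> \<pi> q"
    using cocycles_zeroE[OF I E] by blast
  have [simp]: "y \<in> Arr \<A>" "Dom \<A> y = ob I (q + 1)" "Cod \<A> y = E" using y by (auto simp: Hom_iff)
  have "(y \<cdot> \<eta> (q + 1)) \<cdot> df A q = (y \<cdot> df I q) \<cdot> \<eta> q" by (simp add: chain_map_commute[OF \<eta>])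
  also have "\<dots> = x \<cdot> (\<pi> q \<cdot> \<eta> q)" unfolding y(2) by simp
  also have "\<dots> = Zero \<A> (ob A q) E" unfolding objD(6) by simp
  \<comment> \<open>Rewritten with \<open>q + 1 - 1\<close> in order to match
    \<open>extends_cocycles\<close> in degree \<open>q + 1\<close>.\<close>
  finally have "(y \<cdot> \<eta> (q + 1)) \<cdot> df A (q + 1 - 1) = Zero \<A> (ob A (q + 1 - 1)) E" by simp
  moreover have "y \<cdot> \<eta> (q + 1) \<in> Hom \<A> (ob A (q + 1)) E" by (simp add: Hom_iff)
  ultimately obtain \<beta> where \<beta>: "\<beta> \<in> Hom \<A> (ob I (q + 1)) E"
    "\<beta> \<cdot> df I q = Zero \<A> (ob I q) E" "\<beta> \<cdot> \<eta> (q + 1) = y \<cdot> \<eta> (q + 1)"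
    using extends_cocyclesE[OF CE_short_exactD(7) E] by (metis add_diff_cancel_right')
  have [simp]: "\<beta> \<in> Arr \<A>" "Dom \<A> \<beta> = ob I (q + 1)" "Cod \<A> \<beta> = E" using \<beta> by (auto simp: Hom_iff)
  \<comment> \<open>As \<open>\<beta>\<close> kills the differential, \<open>diff y \<beta>\<close>
    has the same composite with \<open>df I q\<close> as \<open>y\<close>, but it descends to a map
    \<open>w\<close> on \<open>A'\<close>. This shows that \<open>x\<close> factors through the
    differential of \<open>A'\<close> and so vanishes on cocycles.\<close>
  have "diff y \<beta> \<cdot> \<eta> (q + 1) = Zero \<A> (ob A (q + 1)) E" using \<beta>(3) by simp
  moreover have "diff y \<beta> \<in> Hom \<A> (ob I (q + 1)) E" by (simp add: Hom_iff)
  ultimately obtain w where w: "w \<in> Hom \<A> (ob A' (q + 1)) E" "w \<cdot> \<pi> (q + 1) = diff y \<beta>"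
    using exact_atE[OF objD(4,1,2) E] by blast
  have [simp]: "w \<in> Arr \<A>" "Dom \<A> w = ob A' (q + 1)" "Cod \<A> w = E" using w by (auto simp: Hom_iff)
  have "(w \<cdot> df A' q) \<cdot> \<pi> q = (w \<cdot> \<pi> (q + 1)) \<cdot> df I q" by (simp add: chain_map_commute[OF \<pi>])
  also have "\<dots> = x \<cdot> \<pi> q" unfolding w(2) using \<beta>(2) y(2) by simp
  finally have "w \<cdot> df A' q = x"
    by - (rule epicD[OF objD(5,2) _ x(1)]; simp add: Hom_iff)
  then have "\<zeta> = w \<cdot> (df A' q \<cdot> ?x)" using x(2) by auto
  then show "\<zeta> = Zero \<A> (cocycles \<A> A' q) E" unfolding cocycle_incD(3)[OF A'] by simp
qed

text \<open>Surjectivity is formal, because \<open>\<pi>\<close> is epic in degree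
  \<open>q - 1\<close>. Exactness in the middle is what rests on \<open>extends_cocycles\<close>: a
  coboundary of \<open>I\<close> that lies in \<open>A\<close> has to be a coboundary of
  \<open>A\<close>.\<close>

lemma short_exact_cobounds:
  "short_exact (cobounds \<A> A q) (cobounds_map \<A> A I \<eta> q) (cobounds \<A> I q)
     (cobounds_map \<A> I A' \<pi> q) (cobounds \<A> A' q)"
proof (rule short_exactI)
  note [simp] = CE_simps
  let ?f = "cobounds_map \<A> A I \<eta> q" and ?g = "cobounds_map \<A> I A' \<pi> q"
  let ?z = "cobound_inc \<A> A q" and ?y = "cobound_inc \<A> I q" and ?x = "cobound_inc \<A> A' q"
  note f = cobounds_mapD[OF A I \<eta>, of q] and g = cobounds_mapD[OF I A' \<pi>, of q]
  show "?f \<in> Hom \<A> (cobounds \<A> A q) (cobounds \<A> I q)" "?g \<in> Hom \<A> (cobounds \<A> I q) (cobounds \<A> A' q)"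
    by (fact f g)+
  have "?x \<cdot> (?g \<cdot> ?f) = (?x \<cdot> ?g) \<cdot> ?f" by simp
  also have "\<dots> = \<pi> q \<cdot> (?y \<cdot> ?f)" unfolding g(2) by simp
  also have "\<dots> = (\<pi> q \<cdot> \<eta> q) \<cdot> ?z" unfolding f(2) by simp
  also have "\<dots> = Zero \<A> (cobounds \<A> A q) (ob A' q)" unfolding objD(6) by simp
  finally show "?g \<cdot> ?f = Zero \<A> (cobounds \<A> A q) (cobounds \<A> A' q)"
    by - (rule monicD0[OF cobound_incD(2,1)[OF A']]; simp add: Hom_iff)
next
  note [simp] = CE_simps
  let ?f = "cobounds_map \<A> A I \<eta> q" and ?z = "cobound_inc \<A> A q" and ?y = "cobound_inc \<A> I q"
  fix E \<zeta> assume E: "injective_object \<A> E" and \<zeta>: "\<zeta> \<in> Hom \<A> (cobounds \<A> A q) E"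
  obtain \<alpha> where \<alpha>: "\<alpha> \<in> Hom \<A> (ob A q) E" "\<alpha> \<cdot> ?z = \<zeta>" using cobounds_extend[OF A E \<zeta>] .
  obtain \<beta> where \<beta>: "\<beta> \<in> Hom \<A> (ob I q) E" "\<beta> \<cdot> \<eta> q = \<alpha>"
    using injective_objectE[OF E objD(3,1) \<alpha>(1)] .
  have "\<beta> \<cdot> ?y \<cdot> ?f = \<beta> \<cdot> \<eta> q \<cdot> ?z" using \<beta>(1) by (simp add: Hom_iff cobounds_mapD(2)[OF A I \<eta>])
  then have "\<beta> \<cdot> ?y \<cdot> ?f = \<zeta>" using \<alpha> \<beta> by simp
  moreover have "\<beta> \<cdot> ?y \<in> Hom \<A> (cobounds \<A> I q) E" using \<beta> by (simp add: Hom_iff)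
  ultimately show "\<exists>\<xi>\<in>Hom \<A> (cobounds \<A> I q) E. \<xi> \<cdot> ?f = \<zeta>" by blast
next
  note [simp] = CE_simps
  let ?f = "cobounds_map \<A> A I \<eta> q" and ?g = "cobounds_map \<A> I A' \<pi> q"
  let ?z = "cobound_inc \<A> A q" and ?y = "cobound_inc \<A> I q" and ?x = "cobound_inc \<A> A' q"
  fix E \<zeta> assume E: "injective_object \<A> E" and \<zeta>: "\<zeta> \<in> Hom \<A> (cobounds \<A> I q) E"
    and \<zeta>0: "\<zeta> \<cdot> ?f = Zero \<A> (cobounds \<A> A q) E"
  have [simp]: "E \<in> Obj \<A>" using E by (rule injective_object_Obj)
  obtain x where x: "x \<in> Hom \<A> (ob I q) E" "x \<cdot> ?y = \<zeta>" using cobounds_extend[OF I E \<zeta>] .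
  have [simp]: "x \<in> Arr \<A>" "Dom \<A> x = ob I q" "Cod \<A> x = E" using x by (auto simp: Hom_iff)
  have "(x \<cdot> \<eta> q) \<cdot> ?z = \<zeta> \<cdot> ?f"
    unfolding x(2)[symmetric] by (simp add: cobounds_mapD(2)[OF A I \<eta>])
  moreover have xe: "x \<cdot> \<eta> q \<in> Hom \<A> (ob A q) E" by (simp add: Hom_iff)
  ultimately have "(x \<cdot> \<eta> q) \<cdot> df A (q - 1) = Zero \<A> (ob A (q - 1)) E"
    using \<zeta>0 cobound_inc_zero_iff[OF A xe] by simp
  then obtain \<beta> where \<beta>: "\<beta> \<in> Hom \<A> (ob I q) E"
    "\<beta> \<cdot> df I (q - 1) = Zero \<A> (ob I (q - 1)) E" "\<beta> \<cdot> \<eta> q = x \<cdot> \<eta> q"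
    using extends_cocyclesE[OF CE_short_exactD(7) E xe] by metis
  have [simp]: "\<beta> \<in> Arr \<A>" "Dom \<A> \<beta> = ob I q" "Cod \<A> \<beta> = E" using \<beta> by (auto simp: Hom_iff)
  \<comment> \<open>The correction \<open>\<beta>\<close> vanishes on coboundaries, so
    \<open>diff x \<beta>\<close> still restricts to \<open>\<zeta>\<close>.\<close>
  have "diff x \<beta> \<cdot> \<eta> q = Zero \<A> (ob A q) E" using \<beta>(3) by simp
  moreover have "diff x \<beta> \<in> Hom \<A> (ob I q) E" by (simp add: Hom_iff)
  ultimately obtain w where w: "w \<in> Hom \<A> (ob A' q) E" "w \<cdot> \<pi> q = diff x \<beta>"
    using exact_atE[OF objD(4,1,2) E] by blast
  have "\<beta> \<cdot> ?y = Zero \<A> (cobounds \<A> I q) E" using cobound_inc_zero_iff[OF I \<beta>(1)] \<beta>(2) by simp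
  then have "diff x \<beta> \<cdot> ?y = \<zeta>" using x(2) by auto
  moreover have "w \<cdot> ?x \<cdot> ?g = (w \<cdot> \<pi> q) \<cdot> ?y" using w(1) by (simp add: Hom_iff cobounds_mapD(2)[OF I A' \<pi>])
  ultimately have "w \<cdot> ?x \<cdot> ?g = \<zeta>" using w(2) by simp
  moreover have "w \<cdot> ?x \<in> Hom \<A> (cobounds \<A> A' q) E" using w by (simp add: Hom_iff)
  ultimately show "\<exists>\<xi>\<in>Hom \<A> (cobounds \<A> A' q) E. \<xi> \<cdot> ?g = \<zeta>" by blast
next
  note [simp] = CE_simps
  let ?g = "cobounds_map \<A> I A' \<pi> q" and ?y = "cobound_inc \<A> I q" and ?x = "cobound_inc \<A> A' q"
  fix E \<zeta> assume E: "injective_object \<A> E" and \<zeta>: "\<zeta> \<in> Hom \<A> (cobounds \<A> A' q) E"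
    and \<zeta>0: "\<zeta> \<cdot> ?g = Zero \<A> (cobounds \<A> I q) E"
  have [simp]: "E \<in> Obj \<A>" using E by (rule injective_object_Obj)
  obtain x where x: "x \<in> Hom \<A> (ob A' q) E" "x \<cdot> ?x = \<zeta>" using cobounds_extend[OF A' E \<zeta>] .
  have [simp]: "x \<in> Arr \<A>" "Dom \<A> x = ob A' q" "Cod \<A> x = E" using x by (auto simp: Hom_iff)
  have "(x \<cdot> \<pi> q) \<cdot> ?y = \<zeta> \<cdot> ?g"
    unfolding x(2)[symmetric] by (simp add: cobounds_mapD(2)[OF I A' \<pi>])
  moreover have xe: "x \<cdot> \<pi> q \<in> Hom \<A> (ob I q) E" by (simp add: Hom_iff)
  ultimately have "(x \<cdot> \<pi> q) \<cdot> df I (q - 1) = Zero \<A> (ob I (q - 1)) E"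
    using \<zeta>0 cobound_inc_zero_iff[OF I xe] by simp
  then have "x \<cdot> df A' (q - 1) \<cdot> \<pi> (q - 1) = Zero \<A> (ob I (q - 1)) E"
    by (simp add: chain_map_commute[OF \<pi>])
  then have "x \<cdot> df A' (q - 1) = Zero \<A> (ob A' (q - 1)) E"
    by - (rule epicD0[OF objD(5,2)]; auto simp: Hom_iff)
  then show "\<zeta> = Zero \<A> (cobounds \<A> A' q) E" using cobound_inc_zero_iff[OF A' x(1)] x(2) by simp
qed

text \<open>\<open>extends_cocycles\<close> gives the left end, and surjectivity is inherited from
  the cocycles. Exactness in the middle repeats the chase for cocycles, with the extra check that
  the resulting map \<open>w\<close> kills the coboundaries of \<open>A'\<close>.\<close>

lemma short_exact_cohom:
  "short_exact (cohom \<A> A q) (cohom_map \<A> A I \<eta> q) (cohom \<A> I q)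
     (cohom_map \<A> I A' \<pi> q) (cohom \<A> A' q)"
proof (rule short_exactI)
  note [simp] = CE_simps
  let ?f = "cohom_map \<A> A I \<eta> q" and ?g = "cohom_map \<A> I A' \<pi> q"
  let ?Zf = "cocycles_map \<A> A I \<eta> q" and ?Zg = "cocycles_map \<A> I A' \<pi> q"
  let ?z = "cohom_proj \<A> A q" and ?y = "cohom_proj \<A> I q" and ?x = "cohom_proj \<A> A' q"
  note f = cohom_mapD[OF A I \<eta>, of q] and g = cohom_mapD[OF I A' \<pi>, of q]
  show "?f \<in> Hom \<A> (cohom \<A> A q) (cohom \<A> I q)" "?g \<in> Hom \<A> (cohom \<A> I q) (cohom \<A> A' q)"
    by (fact f g)+
  have z: "?Zg \<cdot> ?Zf = Zero \<A> (cocycles \<A> A q) (cocycles \<A> A' q)"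
    using short_exact_cocycles[of q] unfolding short_exact_def by (auto intro: exact_atD)
  have "(?g \<cdot> ?f) \<cdot> ?z = ?g \<cdot> (?f \<cdot> ?z)" by simp
  also have "\<dots> = (?g \<cdot> ?y) \<cdot> ?Zf" unfolding f(2) by simp
  also have "\<dots> = ?x \<cdot> (?Zg \<cdot> ?Zf)" unfolding g(2) by simp
  finally have "(?g \<cdot> ?f) \<cdot> ?z = Zero \<A> (cocycles \<A> A q) (cohom \<A> A' q)" unfolding z by simp
  then show "?g \<cdot> ?f = Zero \<A> (cohom \<A> A q) (cohom \<A> A' q)"
    by - (rule epicD0[OF cohom_projD(3,2)[OF A]]; auto simp: Hom_iff)
next
  note [simp] = CE_simps
  let ?f = "cohom_map \<A> A I \<eta> q" and ?Zf = "cocycles_map \<A> A I \<eta> q"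
  let ?z = "cocycle_inc \<A> A q" and ?y = "cocycle_inc \<A> I q"
  let ?pz = "cohom_proj \<A> A q" and ?py = "cohom_proj \<A> I q"
  fix E h assume E: "injective_object \<A> E" and h: "h \<in> Hom \<A> (cohom \<A> A q) E"
  obtain \<alpha> where \<alpha>: "\<alpha> \<in> Hom \<A> (ob A q) E" "\<alpha> \<cdot> df A (q - 1) = Zero \<A> (ob A (q - 1)) E"
    "\<alpha> \<cdot> ?z = h \<cdot> ?pz" using cohom_extend[OF A E h] .
  obtain \<beta> where \<beta>: "\<beta> \<in> Hom \<A> (ob I q) E" "\<beta> \<cdot> df I (q - 1) = Zero \<A> (ob I (q - 1)) E"
    "\<beta> \<cdot> \<eta> q = \<alpha>" using extends_cocyclesE[OF CE_short_exactD(7) E \<alpha>(1,2)] .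
  obtain k where k: "k \<in> Hom \<A> (cohom \<A> I q) E" "k \<cdot> ?py = \<beta> \<cdot> ?y"
    using cohom_factor[OF I \<beta>(1,2)] .
  have "(k \<cdot> ?f) \<cdot> ?pz = (k \<cdot> ?py) \<cdot> ?Zf" using k(1) by (simp add: Hom_iff cohom_mapD(2)[OF A I \<eta>])
  also have "\<dots> = (\<beta> \<cdot> \<eta> q) \<cdot> ?z"
    unfolding k(2) using \<beta>(1) by (simp add: Hom_iff cocycles_mapD(2)[OF A I \<eta>])
  also have "\<dots> = h \<cdot> ?pz" unfolding \<beta>(3) \<alpha>(3) ..
  finally have "k \<cdot> ?f = h"
    by - (rule epicD[OF cohom_projD(3,2)[OF A] _ h]; use k in \<open>simp add: Hom_iff\<close>)
  then show "\<exists>y\<in>Hom \<A> (cohom \<A> I q) E. y \<cdot> ?f = h" using k by blast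
next
  note [simp] = CE_simps
  let ?f = "cohom_map \<A> A I \<eta> q" and ?g = "cohom_map \<A> I A' \<pi> q"
  let ?Zf = "cocycles_map \<A> A I \<eta> q" and ?Zg = "cocycles_map \<A> I A' \<pi> q"
  let ?z = "cocycle_inc \<A> A q" and ?y = "cocycle_inc \<A> I q" and ?x = "cocycle_inc \<A> A' q"
  let ?pz = "cohom_proj \<A> A q" and ?py = "cohom_proj \<A> I q" and ?px = "cohom_proj \<A> A' q"
  fix E h assume E: "injective_object \<A> E" and h: "h \<in> Hom \<A> (cohom \<A> I q) E"
    and h0: "h \<cdot> ?f = Zero \<A> (cohom \<A> A q) E"
  have [simp]: "E \<in> Obj \<A>" using E by (rule injective_object_Obj)
  have [simp]: "h \<in> Arr \<A>" "Dom \<A> h = cohom \<A> I q" "Cod \<A> h = E" using h by (auto simp: Hom_iff)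
  obtain x where x: "x \<in> Hom \<A> (ob I q) E" "x \<cdot> df I (q - 1) = Zero \<A> (ob I (q - 1)) E"
    "x \<cdot> ?y = h \<cdot> ?py" using cohom_extend[OF I E h] .
  have [simp]: "x \<in> Arr \<A>" "Dom \<A> x = ob I q" "Cod \<A> x = E" using x by (auto simp: Hom_iff)
  have "x \<cdot> \<eta> q \<cdot> ?z = (x \<cdot> ?y) \<cdot> ?Zf" by (simp add: cocycles_mapD(2)[OF A I \<eta>])
  also have "\<dots> = (h \<cdot> ?f) \<cdot> ?pz" unfolding x(3) by (simp add: cohom_mapD(2)[OF A I \<eta>])
  finally have "x \<cdot> \<eta> q \<cdot> ?z = Zero \<A> (cocycles \<A> A q) E" unfolding h0 by simp
  moreover have "x \<cdot> \<eta> q \<in> Hom \<A> (ob A q) E" by (simp add: Hom_iff)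
  ultimately obtain y where y: "y \<in> Hom \<A> (ob A (q + 1)) E" "y \<cdot> df A q = x \<cdot> \<eta> q"
    using cocycles_zeroE[OF A E] by blast
  obtain y' where y': "y' \<in> Hom \<A> (ob I (q + 1)) E" "y' \<cdot> \<eta> (q + 1) = y"
    using injective_objectE[OF E objD(3,1) y(1)] .
  have [simp]: "y' \<in> Arr \<A>" "Dom \<A> y' = ob I (q + 1)" "Cod \<A> y' = E" using y' by (auto simp: Hom_iff)
  let ?d = "diff x (y' \<cdot> df I q)"
  have d: "?d \<in> Hom \<A> (ob I q) E" by (auto simp: Hom_iff)
  have "(y' \<cdot> df I q) \<cdot> \<eta> q = y' \<cdot> (df I q \<cdot> \<eta> q)" by simp
  also have "\<dots> = x \<cdot> \<eta> q"
    unfolding chain_map_commute[OF \<eta>] y(2)[symmetric] y'(2)[symmetric] by simp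
  finally have "?d \<cdot> \<eta> q = Zero \<A> (ob A q) E" by simp
  then obtain w where w: "w \<in> Hom \<A> (ob A' q) E" "w \<cdot> \<pi> q = ?d"
    using exact_atE[OF objD(4,1,2) E d] by blast
  have [simp]: "w \<in> Arr \<A>" "Dom \<A> w = ob A' q" "Cod \<A> w = E" using w by (auto simp: Hom_iff)
  have "(w \<cdot> df A' (q - 1)) \<cdot> \<pi> (q - 1) = (w \<cdot> \<pi> q) \<cdot> df I (q - 1)"
    by (simp add: chain_map_commute[OF \<pi>])
  also have "\<dots> = Zero \<A> (ob I (q - 1)) E" unfolding w(2) using x(2) by simp
  finally have "w \<cdot> df A' (q - 1) = Zero \<A> (ob A' (q - 1)) E"
    by - (rule epicD0[OF objD(5,2)]; auto simp: Hom_iff)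
  then obtain k where k: "k \<in> Hom \<A> (cohom \<A> A' q) E" "k \<cdot> ?px = w \<cdot> ?x"
    using cohom_factor[OF A' w(1)] by blast
  have "(k \<cdot> ?g) \<cdot> ?py = (k \<cdot> ?px) \<cdot> ?Zg" using k(1) by (simp add: Hom_iff cohom_mapD(2)[OF I A' \<pi>])
  also have "\<dots> = (w \<cdot> \<pi> q) \<cdot> ?y" unfolding k(2) by (simp add: cocycles_mapD(2)[OF I A' \<pi>])
  also have "\<dots> = h \<cdot> ?py" unfolding w(2) x(3)[symmetric] using cocycle_incD(3)[OF I, of q] by simp
  finally have "k \<cdot> ?g = h"
    by - (rule epicD[OF cohom_projD(3,2)[OF I] _ h]; use k in \<open>simp add: Hom_iff\<close>)
  then show "\<exists>k\<in>Hom \<A> (cohom \<A> A' q) E. k \<cdot> ?g = h" using k by blast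
next
  note [simp] = CE_simps
  let ?g = "cohom_map \<A> I A' \<pi> q" and ?Zg = "cocycles_map \<A> I A' \<pi> q"
  let ?py = "cohom_proj \<A> I q" and ?px = "cohom_proj \<A> A' q"
  fix E h assume E: "injective_object \<A> E" and h: "h \<in> Hom \<A> (cohom \<A> A' q) E"
    and h0: "h \<cdot> ?g = Zero \<A> (cohom \<A> I q) E"
  have [simp]: "E \<in> Obj \<A>" using E by (rule injective_object_Obj)
  have [simp]: "h \<in> Arr \<A>" "Dom \<A> h = cohom \<A> A' q" "Cod \<A> h = E" using h by (auto simp: Hom_iff)
  have "(h \<cdot> ?px) \<cdot> ?Zg = (h \<cdot> ?g) \<cdot> ?py" by (simp add: cohom_mapD(2)[OF I A' \<pi>])
  then have *: "(h \<cdot> ?px) \<cdot> ?Zg = Zero \<A> (cocycles \<A> I q) E" unfolding h0 by simp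
  have "epic \<A> ?Zg" using short_exact_cocycles[of q] by (simp add: short_exact_def)
  from epicD0[OF this _ _ *] have "h \<cdot> ?px = Zero \<A> (cocycles \<A> A' q) E"
    by (simp add: Hom_iff)
  then show "h = Zero \<A> (cohom \<A> A' q) E"
    by - (rule epicD0[OF cohom_projD(3,2)[OF A'] h])
qed

end

text \<open>The end of each sequence is the start of the next, so they splice objectwise, and by the
  three preceding lemmas also on cocycles, coboundaries and cohomology. The equations
  \<open>C\<close> identify the spliced maps with the maps induced by the steps.\<close>

lemma CE_resolutionI:
  fixes X I :: "nat \<Rightarrow> ('a, 'b) cochain" and \<eta> \<pi> :: "nat \<Rightarrow> int \<Rightarrow> 'b"
  assumes CE: "\<And>n. CE_short_exact (X n) (\<eta> n) (I n) (\<pi> n) (X (Suc n))"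
    and inj: "\<And>n. split_injective_complex (I n)"
  shows "CE_resolution \<A> (X 0) \<lparr>cpx = I, aug = \<eta> 0, step = \<lambda>p q. \<eta> (Suc p) q \<cdot> \<pi> p q\<rparr>"
proof -
  note D = CE_short_exactD[OF CE]
  have step: "chain_map \<A> (I p) (I (Suc p)) (\<lambda>q. \<eta> (Suc p) q \<cdot> \<pi> p q)" for p
    by (rule chain_map_Comp[OF D(2) D(3) D(2) D(5) D(4)])
  note C = induced_maps_Comp[OF D(2) D(3) D(2) D(5) D(4)]
  show ?thesis
    unfolding CE_resolution_def injective_resolution_def
    using D(1,2,4) step split_injective_complex_injective[OF inj]
      short_exact_splice[of "\<lambda>n. ob (X n) _" "\<lambda>n. \<eta> n _" "\<lambda>n. ob (I n) _" "\<lambda>n. \<pi> n _", OF D(6)]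
      short_exact_splice[of "\<lambda>n. cocycles \<A> (X n) _" "\<lambda>n. cocycles_map \<A> (X n) (I n) (\<eta> n) _"
        "\<lambda>n. cocycles \<A> (I n) _" "\<lambda>n. cocycles_map \<A> (I n) (X (Suc n)) (\<pi> n) _",
        OF short_exact_cocycles[OF CE]]
      short_exact_splice[of "\<lambda>n. cobounds \<A> (X n) _" "\<lambda>n. cobounds_map \<A> (X n) (I n) (\<eta> n) _"
        "\<lambda>n. cobounds \<A> (I n) _" "\<lambda>n. cobounds_map \<A> (I n) (X (Suc n)) (\<pi> n) _",
        OF short_exact_cobounds[OF CE]]
      short_exact_splice[of "\<lambda>n. cohom \<A> (X n) _" "\<lambda>n. cohom_map \<A> (X n) (I n) (\<eta> n) _"
        "\<lambda>n. cohom \<A> (I n) _" "\<lambda>n. cohom_map \<A> (I n) (X (Suc n)) (\<pi> n) _",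
        OF short_exact_cohom[OF CE]]
      inj[unfolded split_injective_complex_def]
    by (simp add: C)
qed

end

section \<open>Short exact sequences of split complexes of injectives\<close>

text \<open>Indexing the three complexes by positions lets facts about each of them be stated once
  for a variable \<open>i\<close>; only the two maps of a row single out constructors.\<close>

datatype pos = Sub | Mid | Quo

lemma all_pos: "(\<forall>i. P i) \<longleftrightarrow> P Sub \<and> P Mid \<and> P Quo"
  by (metis pos.exhaust)

record ('o, 'm) ses =
  cx :: "pos \<Rightarrow> ('o, 'm) cochain"
  inc :: "int \<Rightarrow> 'm"
  prj :: "int \<Rightarrow> 'm"

context abelian_enough_injectives
begin

definition is_ses :: "('a, 'b) ses \<Rightarrow> bool" where
  "is_ses S \<longleftrightarrow> short_exact_complexes \<A> (cx S Sub) (inc S) (cx S Mid) (prj S) (cx S Quo)"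

definition ses_map :: "('a, 'b) ses \<Rightarrow> ('a, 'b) ses \<Rightarrow> (pos \<Rightarrow> int \<Rightarrow> 'b) \<Rightarrow> bool" where
  "ses_map S T m \<longleftrightarrow> (\<forall>i. chain_map \<A> (cx S i) (cx T i) (m i)) \<and>
     (\<forall>q. inc T q \<cdot> m Sub q = m Mid q \<cdot> inc S q) \<and>
     (\<forall>q. prj T q \<cdot> m Mid q = m Quo q \<cdot> prj S q)"

definition zero_at :: "('a, 'b) ses \<Rightarrow> int \<Rightarrow> bool" where
  "zero_at S q \<longleftrightarrow> (\<forall>i. is_zero_object \<A> (ob (cx S i) q))"

text \<open>Vanishing is tracked degree by degree, so no range of degrees has to be carried through
  the construction.\<close>

definition split_target :: "('a, 'b) ses \<Rightarrow> ('a, 'b) ses \<Rightarrow> (pos \<Rightarrow> int \<Rightarrow> 'b) \<Rightarrow> bool" where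
  "split_target S T m \<longleftrightarrow> is_ses T \<and> (\<forall>i. split_injective_complex (cx T i)) \<and> ses_map S T m \<and>
     (\<forall>q. zero_at S q \<longrightarrow> zero_at T q)"

lemma is_ses_iff:
  "is_ses S \<longleftrightarrow> (\<forall>i. cochain_complex \<A> (cx S i)) \<and>
     chain_map \<A> (cx S Sub) (cx S Mid) (inc S) \<and> chain_map \<A> (cx S Mid) (cx S Quo) (prj S) \<and>
     (\<forall>q. short_exact (ob (cx S Sub) q) (inc S q) (ob (cx S Mid) q) (prj S q) (ob (cx S Quo) q))"
  unfolding is_ses_def short_exact_complexes_def all_pos short_exact_def chain_map_def by auto

lemma is_sesD:
  assumes "is_ses S"
  shows "cochain_complex \<A> (cx S i)" "chain_map \<A> (cx S Sub) (cx S Mid) (inc S)"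
    "chain_map \<A> (cx S Mid) (cx S Quo) (prj S)"
    "inc S q \<in> Hom \<A> (ob (cx S Sub) q) (ob (cx S Mid) q)"
    "prj S q \<in> Hom \<A> (ob (cx S Mid) q) (ob (cx S Quo) q)"
    "monic \<A> (inc S q)" "exact_at \<A> (inc S q) (prj S q)" "epic \<A> (prj S q)"
    "prj S q \<cdot> inc S q = Zero \<A> (ob (cx S Sub) q) (ob (cx S Quo) q)"
proof -
  show *: "cochain_complex \<A> (cx S i)" "chain_map \<A> (cx S Sub) (cx S Mid) (inc S)"
    "chain_map \<A> (cx S Mid) (cx S Quo) (prj S)"
    "inc S q \<in> Hom \<A> (ob (cx S Sub) q) (ob (cx S Mid) q)"
    "prj S q \<in> Hom \<A> (ob (cx S Mid) q) (ob (cx S Quo) q)"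
    "monic \<A> (inc S q)" "exact_at \<A> (inc S q) (prj S q)" "epic \<A> (prj S q)"
    using assms unfolding is_ses_iff short_exact_def by auto
  show "prj S q \<cdot> inc S q = Zero \<A> (ob (cx S Sub) q) (ob (cx S Quo) q)"
    by (rule exact_atD[OF *(7,4,5)])
qed

lemmas is_ses_simps = complex_Arr[OF is_sesD(1)] complex_dd[OF is_sesD(1)]
  chain_map_Arr[OF is_sesD(2)] chain_map_Arr[OF is_sesD(3)] is_sesD(9)

section \<open>Direct sums of complexes and of their short exact sequences\<close>

lemma short_exact_dsum:
  assumes s: "short_exact X f Y g Z" and s': "short_exact X' f' Y' g' Z'"
  shows "short_exact (Bi X X') (dsum f f') (Bi Y Y') (dsum g g') (Bi Z Z')"
proof -
  have H: "f \<in> Hom \<A> X Y" "g \<in> Hom \<A> Y Z" "monic \<A> f" "exact_at \<A> f g" "epic \<A> g"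
    "f' \<in> Hom \<A> X' Y'" "g' \<in> Hom \<A> Y' Z'" "monic \<A> f'" "exact_at \<A> f' g'" "epic \<A> g'"
    using s s' by (auto simp: short_exact_def)
  have [simp]: "X \<in> Obj \<A>" "Y \<in> Obj \<A>" "Z \<in> Obj \<A>" "X' \<in> Obj \<A>" "Y' \<in> Obj \<A>" "Z' \<in> Obj \<A>"
    using H(1,2,6,7) Hom_Obj by blast+
  have [simp]: "f \<in> Arr \<A>" "Dom \<A> f = X" "Cod \<A> f = Y" "g \<in> Arr \<A>" "Dom \<A> g = Y" "Cod \<A> g = Z"
    "f' \<in> Arr \<A>" "Dom \<A> f' = X'" "Cod \<A> f' = Y'" "g' \<in> Arr \<A>" "Dom \<A> g' = Y'" "Cod \<A> g' = Z'"
    using H(1,2,6,7) by (auto simp: Hom_iff)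
  note gf = exact_atD[OF H(4,1,2)] exact_atD[OF H(9,6,7)]
  have gf': "g \<cdot> (f \<cdot> h) = Zero \<A> (Dom \<A> h) Z" if "h \<in> Arr \<A>" "Cod \<A> h = X" for h
    using that gf(1) by (simp flip: assoc)
  have gf'': "g' \<cdot> (f' \<cdot> h) = Zero \<A> (Dom \<A> h) Z'" if "h \<in> Arr \<A>" "Cod \<A> h = X'" for h
    using that gf(2) by (simp flip: assoc)
  show ?thesis
  proof (rule short_exactI)
    show "dsum f f' \<in> Hom \<A> (Bi X X') (Bi Y Y')" "dsum g g' \<in> Hom \<A> (Bi Y Y') (Bi Z Z')"
      by (simp_all add: dsum_def Hom_iff)
    show "dsum g g' \<cdot> dsum f f' = Zero \<A> (Bi X X') (Bi Z Z')"
      by (simp add: dsum_def gf' gf'')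
  next
    fix E x assume E: "injective_object \<A> E" and x: "x \<in> Hom \<A> (Bi X X') E"
    have [simp]: "x \<in> Arr \<A>" "Dom \<A> x = Bi X X'" "Cod \<A> x = E" using x by (auto simp: Hom_iff)
    have "x \<cdot> in1 X X' \<in> Hom \<A> X E" "x \<cdot> in2 X X' \<in> Hom \<A> X' E" by (auto simp: Hom_iff)
    then obtain y y' where y: "y \<in> Hom \<A> Y E" "y \<cdot> f = x \<cdot> in1 X X'"
      and y': "y' \<in> Hom \<A> Y' E" "y' \<cdot> f' = x \<cdot> in2 X X'"
      using injective_objectE[OF E H(3,1)] injective_objectE[OF E H(8,6)] by metis
    have [simp]: "y \<in> Arr \<A>" "Dom \<A> y = Y" "Cod \<A> y = E" "y' \<in> Arr \<A>" "Dom \<A> y' = Y'" "Cod \<A> y' = E"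
      using y(1) y'(1) by (auto simp: Hom_iff)
    have "copair y y' \<cdot> dsum f f' = x"
      by (rule biprod_eq_out[of X X' _ E])
        (auto simp: Hom_iff dsum_def y(2) y'(2) copair_pair simp flip: pair_Comp)
    moreover have "copair y y' \<in> Hom \<A> (Bi Y Y') E" by (simp add: Hom_iff)
    ultimately show "\<exists>y\<in>Hom \<A> (Bi Y Y') E. y \<cdot> dsum f f' = x" by blast
  next
    fix E x assume E: "injective_object \<A> E" and x: "x \<in> Hom \<A> (Bi Y Y') E"
      and x0: "x \<cdot> dsum f f' = Zero \<A> (Bi X X') E"
    have [simp]: "x \<in> Arr \<A>" "Dom \<A> x = Bi Y Y'" "Cod \<A> x = E" "E \<in> Obj \<A>"
      using x injective_object_Obj[OF E] by (auto simp: Hom_iff)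
    have "x \<cdot> dsum f f' \<cdot> in1 X X' = Zero \<A> X E" "x \<cdot> dsum f f' \<cdot> in2 X X' = Zero \<A> X' E"
      unfolding x0 by simp_all
    then have "(x \<cdot> in1 Y Y') \<cdot> f = Zero \<A> X E" "(x \<cdot> in2 Y Y') \<cdot> f' = Zero \<A> X' E"
      by (simp_all add: dsum_def)
    moreover have "x \<cdot> in1 Y Y' \<in> Hom \<A> Y E" "x \<cdot> in2 Y Y' \<in> Hom \<A> Y' E" by (auto simp: Hom_iff)
    ultimately obtain y y' where y: "y \<in> Hom \<A> Z E" "y \<cdot> g = x \<cdot> in1 Y Y'"
      and y': "y' \<in> Hom \<A> Z' E" "y' \<cdot> g' = x \<cdot> in2 Y Y'"
      using exact_atE[OF H(4,1,2) E] exact_atE[OF H(9,6,7) E] by metis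
    have [simp]: "y \<in> Arr \<A>" "Dom \<A> y = Z" "Cod \<A> y = E" "y' \<in> Arr \<A>" "Dom \<A> y' = Z'" "Cod \<A> y' = E"
      using y(1) y'(1) by (auto simp: Hom_iff)
    have "copair y y' \<cdot> dsum g g' = x"
      by (rule biprod_eq_out[of Y Y' _ E])
        (auto simp: Hom_iff dsum_def y(2) y'(2) copair_pair simp flip: pair_Comp)
    moreover have "copair y y' \<in> Hom \<A> (Bi Z Z') E" by (simp add: Hom_iff)
    ultimately show "\<exists>y\<in>Hom \<A> (Bi Z Z') E. y \<cdot> dsum g g' = x" by blast
  next
    fix E x assume E: "injective_object \<A> E" and x: "x \<in> Hom \<A> (Bi Z Z') E"
      and x0: "x \<cdot> dsum g g' = Zero \<A> (Bi Y Y') E"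
    have [simp]: "x \<in> Arr \<A>" "Dom \<A> x = Bi Z Z'" "Cod \<A> x = E" "E \<in> Obj \<A>"
      using x injective_object_Obj[OF E] by (auto simp: Hom_iff)
    have "x \<cdot> dsum g g' \<cdot> in1 Y Y' = Zero \<A> Y E" "x \<cdot> dsum g g' \<cdot> in2 Y Y' = Zero \<A> Y' E"
      unfolding x0 by simp_all
    then have "(x \<cdot> in1 Z Z') \<cdot> g = Zero \<A> Y E" "(x \<cdot> in2 Z Z') \<cdot> g' = Zero \<A> Y' E"
      by (simp_all add: dsum_def)
    moreover have "x \<cdot> in1 Z Z' \<in> Hom \<A> Z E" "x \<cdot> in2 Z Z' \<in> Hom \<A> Z' E" by (auto simp: Hom_iff)
    ultimately have "x \<cdot> in1 Z Z' = Zero \<A> Z E" "x \<cdot> in2 Z Z' = Zero \<A> Z' E"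
      using epicD0[OF H(5,2)] epicD0[OF H(10,7)] by blast+
    then show "x = Zero \<A> (Bi Z Z') E"
      by - (rule biprod_eq_out[of Z Z' _ E]; simp add: Hom_iff)
  qed
qed

definition csum :: "('a, 'b) cochain \<Rightarrow> ('a, 'b) cochain \<Rightarrow> ('a, 'b) cochain" where
  "csum X Y = \<lparr>ob = \<lambda>q. Bi (ob X q) (ob Y q), df = \<lambda>q. dsum (df X q) (df Y q)\<rparr>"

definition ssum :: "('a, 'b) ses \<Rightarrow> ('a, 'b) ses \<Rightarrow> ('a, 'b) ses" where
  "ssum S T = \<lparr>cx = \<lambda>i. csum (cx S i) (cx T i), inc = \<lambda>q. dsum (inc S q) (inc T q),
     prj = \<lambda>q. dsum (prj S q) (prj T q)\<rparr>"

definition smap_pair :: "(pos \<Rightarrow> int \<Rightarrow> 'b) \<Rightarrow> (pos \<Rightarrow> int \<Rightarrow> 'b) \<Rightarrow> pos \<Rightarrow> int \<Rightarrow> 'b" where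
  "smap_pair m n i q = pair (m i q) (n i q)"

lemma complex_dd_Comp:
  assumes "cochain_complex \<A> X" "h \<in> Arr \<A>" "Cod \<A> h = ob X q"
  shows "df X (q + 1) \<cdot> (df X q \<cdot> h) = Zero \<A> (Dom \<A> h) (ob X (q + 1 + 1))"
proof -
  note [simp] = complex_Arr[OF assms(1)]
  have "df X (q + 1) \<cdot> (df X q \<cdot> h) = (df X (q + 1) \<cdot> df X q) \<cdot> h" using assms(2,3) by simp
  then show ?thesis unfolding complex_dd[OF assms(1)] using assms(2,3) by simp
qed

lemma cochain_complex_csum:
  assumes X: "cochain_complex \<A> X" and Y: "cochain_complex \<A> Y"
  shows "cochain_complex \<A> (csum X Y)"
proof -
  note [simp] = complex_Arr[OF X] complex_Arr[OF Y] complex_dd_Comp[OF X] complex_dd_Comp[OF Y]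
  show ?thesis by (simp add: cochain_complex_def csum_def dsum_def Hom_iff del: add.assoc)
qed

lemma split_injective_complex_csum:
  assumes X: "split_injective_complex X" and Y: "split_injective_complex Y"
  shows "split_injective_complex (csum X Y)"
  unfolding split_injective_complex_def
proof (intro conjI allI)
  have c: "cochain_complex \<A> X" "cochain_complex \<A> Y"
    and inj: "\<And>q. injective_object \<A> (ob X q)" "\<And>q. injective_object \<A> (ob Y q)"
    and ex: "\<And>q. \<exists>s\<in>Hom \<A> (ob X (q + 1)) (ob X q). df X q \<cdot> (s \<cdot> df X q) = df X q"
      "\<And>q. \<exists>s\<in>Hom \<A> (ob Y (q + 1)) (ob Y q). df Y q \<cdot> (s \<cdot> df Y q) = df Y q"
    using X Y by (auto simp: split_injective_complex_def)
  note [simp] = complex_Arr[OF c(1)] complex_Arr[OF c(2)]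
  show "cochain_complex \<A> (csum X Y)" using cochain_complex_csum c by blast
  fix q
  show "injective_object \<A> (ob (csum X Y) q)" using inj by (simp add: csum_def injective_Bi)
  obtain s s' where s: "s \<in> Hom \<A> (ob X (q + 1)) (ob X q)" "df X q \<cdot> (s \<cdot> df X q) = df X q"
    and s': "s' \<in> Hom \<A> (ob Y (q + 1)) (ob Y q)" "df Y q \<cdot> (s' \<cdot> df Y q) = df Y q"
    using ex by metis
  have [simp]: "s \<in> Arr \<A>" "Dom \<A> s = ob X (q + 1)" "Cod \<A> s = ob X q"
    "s' \<in> Arr \<A>" "Dom \<A> s' = ob Y (q + 1)" "Cod \<A> s' = ob Y q" using s s' by (auto simp: Hom_iff)
  have "df X q \<cdot> (s \<cdot> (df X q \<cdot> h)) = df X q \<cdot> h" if "h \<in> Arr \<A>" "Cod \<A> h = ob X q" for h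
  proof -
    have "df X q \<cdot> (s \<cdot> (df X q \<cdot> h)) = (df X q \<cdot> (s \<cdot> df X q)) \<cdot> h" using that by simp
    then show ?thesis unfolding s(2) .
  qed
  moreover have "df Y q \<cdot> (s' \<cdot> (df Y q \<cdot> h)) = df Y q \<cdot> h" if "h \<in> Arr \<A>" "Cod \<A> h = ob Y q" for h
  proof -
    have "df Y q \<cdot> (s' \<cdot> (df Y q \<cdot> h)) = (df Y q \<cdot> (s' \<cdot> df Y q)) \<cdot> h" using that by simp
    then show ?thesis unfolding s'(2) .
  qed
  ultimately have "df (csum X Y) q \<cdot> (dsum s s' \<cdot> df (csum X Y) q) = df (csum X Y) q"
    by (simp add: csum_def dsum_def)
  moreover have "dsum s s' \<in> Hom \<A> (ob (csum X Y) (q + 1)) (ob (csum X Y) q)"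
    by (simp add: csum_def dsum_def Hom_iff)
  ultimately show "\<exists>s\<in>Hom \<A> (ob (csum X Y) (q + 1)) (ob (csum X Y) q).
      df (csum X Y) q \<cdot> (s \<cdot> df (csum X Y) q) = df (csum X Y) q" by blast
qed

lemma commute_Comp:
  assumes "a \<cdot> b = c \<cdot> d" "b \<in> Arr \<A>" "a \<in> Arr \<A>" "Cod \<A> b = Dom \<A> a" "d \<in> Arr \<A>" "c \<in> Arr \<A>"
    "Cod \<A> d = Dom \<A> c" "h \<in> Arr \<A>" "Cod \<A> h = Dom \<A> b" "Cod \<A> h = Dom \<A> d"
  shows "a \<cdot> (b \<cdot> h) = c \<cdot> (d \<cdot> h)"
proof -
  have "a \<cdot> (b \<cdot> h) = (a \<cdot> b) \<cdot> h" "c \<cdot> (d \<cdot> h) = (c \<cdot> d) \<cdot> h"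
    using assms(2-) by simp_all
  then show ?thesis using assms(1) by simp
qed

lemma chain_map_dsum:
  assumes c: "cochain_complex \<A> X" "cochain_complex \<A> Y" "cochain_complex \<A> X'" "cochain_complex \<A> Y'"
    and f: "chain_map \<A> X Y f" and g: "chain_map \<A> X' Y' g"
  shows "chain_map \<A> (csum X X') (csum Y Y') (\<lambda>q. dsum (f q) (g q))"
proof -
  note [simp] = complex_Arr[OF c(1)] complex_Arr[OF c(2)] complex_Arr[OF c(3)] complex_Arr[OF c(4)]
    chain_map_Arr[OF f] chain_map_Arr[OF g]
  have "df Y q \<cdot> (f q \<cdot> h) = f (q + 1) \<cdot> (df X q \<cdot> h)" if "h \<in> Arr \<A>" "Cod \<A> h = ob X q" for h q
    using that by (intro commute_Comp[OF chain_map_commute(1)[OF f]]) auto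
  moreover have "df Y' q \<cdot> (g q \<cdot> h) = g (q + 1) \<cdot> (df X' q \<cdot> h)" if "h \<in> Arr \<A>" "Cod \<A> h = ob X' q" for h q
    using that by (intro commute_Comp[OF chain_map_commute(1)[OF g]]) auto
  ultimately show ?thesis by (simp add: chain_map_def csum_def dsum_def Hom_iff)
qed

lemma chain_map_pair:
  assumes c: "cochain_complex \<A> X" "cochain_complex \<A> Y" "cochain_complex \<A> Y'"
    and f: "chain_map \<A> X Y f" and g: "chain_map \<A> X Y' g"
  shows "chain_map \<A> X (csum Y Y') (\<lambda>q. pair (f q) (g q))"
proof -
  note [simp] = complex_Arr[OF c(1)] complex_Arr[OF c(2)] complex_Arr[OF c(3)]
    chain_map_Arr[OF f] chain_map_Arr[OF g]
  show ?thesis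
    by (simp add: chain_map_def csum_def dsum_def Hom_iff chain_map_commute(1)[OF f] chain_map_commute(1)[OF g])
qed

lemma is_ses_ssum:
  assumes S: "is_ses S" and T: "is_ses T"
  shows "is_ses (ssum S T)"
  using is_sesD(1)[OF S] is_sesD(1)[OF T] is_sesD(2)[OF S] is_sesD(2)[OF T] is_sesD(3)[OF S] is_sesD(3)[OF T]
    S T unfolding is_ses_iff ssum_def
  by (simp add: chain_map_dsum cochain_complex_csum) (simp add: csum_def short_exact_dsum)

lemma split_target_ssum:
  assumes S: "is_ses S" and T: "split_target S T m" and U: "split_target S U n"
  shows "split_target S (ssum T U) (smap_pair m n)"
proof -
  have T': "is_ses T" "\<And>i. split_injective_complex (cx T i)" "ses_map S T m" "\<And>q. zero_at S q \<Longrightarrow> zero_at T q"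
    and U': "is_ses U" "\<And>i. split_injective_complex (cx U i)" "ses_map S U n" "\<And>q. zero_at S q \<Longrightarrow> zero_at U q"
    using T U by (auto simp: split_target_def)
  have m: "chain_map \<A> (cx S i) (cx T i) (m i)" "inc T q \<cdot> m Sub q = m Mid q \<cdot> inc S q"
     "prj T q \<cdot> m Mid q = m Quo q \<cdot> prj S q"
    and n: "chain_map \<A> (cx S i) (cx U i) (n i)" "inc U q \<cdot> n Sub q = n Mid q \<cdot> inc S q"
     "prj U q \<cdot> n Mid q = n Quo q \<cdot> prj S q" for i q
    using T'(3) U'(3) by (auto simp: ses_map_def)
  note [simp] = is_ses_simps[OF S] is_ses_simps[OF T'(1)] is_ses_simps[OF U'(1)]
    chain_map_Arr[OF m(1)] chain_map_Arr[OF n(1)]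
  show ?thesis
    unfolding split_target_def ses_map_def
  proof (intro conjI allI impI)
    show "is_ses (ssum T U)" using T' U' by (simp add: is_ses_ssum)
    fix i show "split_injective_complex (cx (ssum T U) i)"
      using T' U' by (simp add: ssum_def split_injective_complex_csum)
    have "smap_pair m n i = (\<lambda>q. pair (m i q) (n i q))" by (auto simp: smap_pair_def)
    then show "chain_map \<A> (cx S i) (cx (ssum T U) i) (smap_pair m n i)"
      using m n is_sesD(1)[OF S] is_sesD(1)[OF T'(1)] is_sesD(1)[OF U'(1)]
      by (simp add: ssum_def chain_map_pair)
  next
    fix q show "inc (ssum T U) q \<cdot> smap_pair m n Sub q = smap_pair m n Mid q \<cdot> inc S q"
      "prj (ssum T U) q \<cdot> smap_pair m n Mid q = smap_pair m n Quo q \<cdot> prj S q"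
      by (simp_all add: ssum_def smap_pair_def dsum_def m n)
    assume "zero_at S q"
    then show "zero_at (ssum T U) q" using T'(4) U'(4)
      by (simp add: zero_at_def ssum_def csum_def zero_object_Bi)
  qed
qed

text \<open>An extension to one summand, composed with the projection, is an extension to the sum.
  One summand is enough, so each piece of the target can be designed for a single requirement, and
  further pieces do no harm.\<close>

lemma extends_ssum:
  assumes S: "is_ses S" and T: "split_target S T m" and U: "split_target S U n"
  shows "extends (cx S i) (cx T i) (m i) q \<or> extends (cx S i) (cx U i) (n i) q \<Longrightarrow>
      extends (cx S i) (cx (ssum T U) i) (smap_pair m n i) q"
    "extends_cocycles (cx S i) (cx T i) (m i) q \<or> extends_cocycles (cx S i) (cx U i) (n i) q \<Longrightarrow>
      extends_cocycles (cx S i) (cx (ssum T U) i) (smap_pair m n i) q"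
proof -
  have T': "is_ses T" "chain_map \<A> (cx S i) (cx T i) (m i)"
    and U': "is_ses U" "chain_map \<A> (cx S i) (cx U i) (n i)"
    using T U by (auto simp: split_target_def ses_map_def)
  note [simp] = is_ses_simps[OF S] is_ses_simps[OF T'(1)] is_ses_simps[OF U'(1)]
    chain_map_Arr[OF T'(2)] chain_map_Arr[OF U'(2)]
  let ?X = "ob (cx T i) q" and ?Y = "ob (cx U i) q"
  have 1: "\<beta> \<cdot> pr1 ?X ?Y \<in> Hom \<A> (ob (cx (ssum T U) i) q) E"
      "(\<beta> \<cdot> pr1 ?X ?Y) \<cdot> smap_pair m n i q = \<beta> \<cdot> m i q"
      "(\<beta> \<cdot> pr1 ?X ?Y) \<cdot> df (cx (ssum T U) i) (q - 1)
        = (\<beta> \<cdot> df (cx T i) (q - 1)) \<cdot> pr1 (ob (cx T i) (q - 1)) (ob (cx U i) (q - 1))"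
    if "\<beta> \<in> Hom \<A> ?X E" for \<beta> E
    using that by (simp_all add: Hom_iff ssum_def csum_def smap_pair_def dsum_def)
  have 2: "\<beta> \<cdot> pr2 ?X ?Y \<in> Hom \<A> (ob (cx (ssum T U) i) q) E"
      "(\<beta> \<cdot> pr2 ?X ?Y) \<cdot> smap_pair m n i q = \<beta> \<cdot> n i q"
      "(\<beta> \<cdot> pr2 ?X ?Y) \<cdot> df (cx (ssum T U) i) (q - 1)
        = (\<beta> \<cdot> df (cx U i) (q - 1)) \<cdot> pr2 (ob (cx T i) (q - 1)) (ob (cx U i) (q - 1))"
    if "\<beta> \<in> Hom \<A> ?Y E" for \<beta> E
    using that by (simp_all add: Hom_iff ssum_def csum_def smap_pair_def dsum_def)
  have ob: "ob (cx (ssum T U) i) (q - 1) = Bi (ob (cx T i) (q - 1)) (ob (cx U i) (q - 1))"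
    by (simp add: ssum_def csum_def)
  show "extends (cx S i) (cx (ssum T U) i) (smap_pair m n i) q"
    if ex: "extends (cx S i) (cx T i) (m i) q \<or> extends (cx S i) (cx U i) (n i) q"
    unfolding extends_def
  proof (intro allI impI)
    fix E \<alpha> assume *: "injective_object \<A> E" "\<alpha> \<in> Hom \<A> (ob (cx S i) q) E"
    from ex show "\<exists>\<beta>\<in>Hom \<A> (ob (cx (ssum T U) i) q) E. \<beta> \<cdot> smap_pair m n i q = \<alpha>"
    proof
      assume "extends (cx S i) (cx T i) (m i) q"
      then obtain \<beta> where \<beta>: "\<beta> \<in> Hom \<A> ?X E" "\<beta> \<cdot> m i q = \<alpha>" using extendsE * by blast
      show ?thesis using 1(1,2)[OF \<beta>(1)] \<beta>(2) by blast
    next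
      assume "extends (cx S i) (cx U i) (n i) q"
      then obtain \<beta> where \<beta>: "\<beta> \<in> Hom \<A> ?Y E" "\<beta> \<cdot> n i q = \<alpha>" using extendsE * by blast
      show ?thesis using 2(1,2)[OF \<beta>(1)] \<beta>(2) by blast
    qed
  qed
  show "extends_cocycles (cx S i) (cx (ssum T U) i) (smap_pair m n i) q"
    if ex: "extends_cocycles (cx S i) (cx T i) (m i) q \<or> extends_cocycles (cx S i) (cx U i) (n i) q"
    unfolding extends_cocycles_def
  proof (intro allI impI)
    fix E \<alpha> assume *: "injective_object \<A> E" "\<alpha> \<in> Hom \<A> (ob (cx S i) q) E"
      "\<alpha> \<cdot> df (cx S i) (q - 1) = Zero \<A> (ob (cx S i) (q - 1)) E"
    have [simp]: "E \<in> Obj \<A>" using *(1) by (rule injective_object_Obj)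
    from ex show "\<exists>\<beta>\<in>Hom \<A> (ob (cx (ssum T U) i) q) E.
      \<beta> \<cdot> df (cx (ssum T U) i) (q - 1) = Zero \<A> (ob (cx (ssum T U) i) (q - 1)) E \<and>
      \<beta> \<cdot> smap_pair m n i q = \<alpha>"
    proof
      assume "extends_cocycles (cx S i) (cx T i) (m i) q"
      then obtain \<beta> where \<beta>: "\<beta> \<in> Hom \<A> ?X E" "\<beta> \<cdot> m i q = \<alpha>"
        "\<beta> \<cdot> df (cx T i) (q - 1) = Zero \<A> (ob (cx T i) (q - 1)) E"
        using extends_cocyclesE * by blast
      show ?thesis using 1[OF \<beta>(1)] \<beta>(2,3) by (auto intro!: bexI[of _ "\<beta> \<cdot> pr1 ?X ?Y"] simp: ob)
    next
      assume "extends_cocycles (cx S i) (cx U i) (n i) q"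
      then obtain \<beta> where \<beta>: "\<beta> \<in> Hom \<A> ?Y E" "\<beta> \<cdot> n i q = \<alpha>"
        "\<beta> \<cdot> df (cx U i) (q - 1) = Zero \<A> (ob (cx U i) (q - 1)) E"
        using extends_cocyclesE * by blast
      show ?thesis using 2[OF \<beta>(1)] \<beta>(2,3) by (auto intro!: bexI[of _ "\<beta> \<cdot> pr2 ?X ?Y"] simp: ob)
    qed
  qed
qed

section \<open>Complexes with zero differential and contractible complexes\<close>

definition sphere :: "(int \<Rightarrow> 'a) \<Rightarrow> ('a, 'b) cochain" where
  "sphere E = \<lparr>ob = E, df = \<lambda>q. Zero \<A> (E q) (E (q + 1))\<rparr>"

text \<open>The differential identifies the second summand in degree \<open>q\<close> with the first
  one in degree \<open>q + 1\<close>. Thus \<open>E q\<close> occurs in degrees \<open>q - 1\<close>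
  and \<open>q\<close>.\<close>

definition disc :: "(int \<Rightarrow> 'a) \<Rightarrow> ('a, 'b) cochain" where
  "disc E = \<lparr>ob = \<lambda>q. Bi (E q) (E (q + 1)),
     df = \<lambda>q. in1 (E (q + 1)) (E (q + 1 + 1)) \<cdot> pr2 (E q) (E (q + 1))\<rparr>"

text \<open>A chain map into \<open>disc E\<close> is determined by its first components, which may
  be chosen arbitrarily; commutation with the differential forces the second component to be
  \<open>u (q + 1) \<cdot> df X q\<close>.\<close>

definition disc_map :: "('a, 'b) cochain \<Rightarrow> (int \<Rightarrow> 'b) \<Rightarrow> int \<Rightarrow> 'b" where
  "disc_map X u q = pair (u q) (u (q + 1) \<cdot> df X q)"

context
  fixes E assumes inj: "\<And>q::int. injective_object \<A> (E q)"
begin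

lemma injective_family_Obj [simp]: "E q \<in> Obj \<A>"
  using inj by (rule injective_object_Obj)

lemma split_injective_complex_sphere: "split_injective_complex (sphere E)"
  unfolding split_injective_complex_def
proof (intro conjI allI)
  show "cochain_complex \<A> (sphere E)" by (simp add: cochain_complex_def sphere_def Hom_iff)
  fix q show "injective_object \<A> (ob (sphere E) q)" by (simp add: sphere_def inj)
  show "\<exists>s\<in>Hom \<A> (ob (sphere E) (q + 1)) (ob (sphere E) q).
      df (sphere E) q \<cdot> (s \<cdot> df (sphere E) q) = df (sphere E) q"
    by (rule bexI[of _ "Zero \<A> (E (q + 1)) (E q)"]) (simp_all add: sphere_def Hom_iff)
qed

lemma split_injective_complex_disc: "split_injective_complex (disc E)"
  unfolding split_injective_complex_def
proof (intro conjI allI)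
  show "cochain_complex \<A> (disc E)" by (simp add: cochain_complex_def disc_def Hom_iff)
  fix q show "injective_object \<A> (ob (disc E) q)" by (simp add: disc_def inj injective_Bi)
  \<comment> \<open>The witness is the contracting homotopy, which carries the first summand in
    degree \<open>q + 1\<close> back to the second one in degree \<open>q\<close>.\<close>
  show "\<exists>s\<in>Hom \<A> (ob (disc E) (q + 1)) (ob (disc E) q).
      df (disc E) q \<cdot> (s \<cdot> df (disc E) q) = df (disc E) q"
    by (rule bexI[of _ "in2 (E q) (E (q + 1)) \<cdot> pr1 (E (q + 1)) (E (q + 1 + 1))"])
      (simp_all add: disc_def Hom_iff)
qed

lemma chain_map_sphere:
  assumes X: "cochain_complex \<A> X" and u: "\<And>q. u q \<in> Hom \<A> (ob X q) (E q)"
    and ud: "\<And>q. u q \<cdot> df X (q - 1) = Zero \<A> (ob X (q - 1)) (E q)"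
  shows "chain_map \<A> X (sphere E) u"
proof -
  note [simp] = complex_Arr[OF X]
  have "u (q + 1) \<cdot> df X q = Zero \<A> (ob X q) (E (q + 1))" for q using ud[of "q + 1"] by simp
  then show ?thesis using u by (simp add: chain_map_def sphere_def Hom_iff)
qed

lemma chain_map_disc:
  assumes X: "cochain_complex \<A> X" and u: "\<And>q. u q \<in> Hom \<A> (ob X q) (E q)"
  shows "chain_map \<A> X (disc E) (disc_map X u)"
proof -
  note [simp] = complex_Arr[OF X] complex_dd[OF X]
  have [simp]: "u q \<in> Arr \<A>" "Dom \<A> (u q) = ob X q" "Cod \<A> (u q) = E q" for q
    using u[of q] by (auto simp: Hom_iff)
  show ?thesis by (simp add: chain_map_def disc_def disc_map_def Hom_iff del: add.assoc)
qed

end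

section \<open>Building blocks of the target and the maps into them\<close>

definition sub_target :: "'a \<Rightarrow> ('a, 'b) cochain \<Rightarrow> ('a, 'b) ses" where
  "sub_target N X = \<lparr>cx = case_pos X X (sphere (\<lambda>_. N)), inc = \<lambda>q. Ident \<A> (ob X q),
     prj = \<lambda>q. Zero \<A> (ob X q) N\<rparr>"

definition quo_target :: "'a \<Rightarrow> ('a, 'b) cochain \<Rightarrow> ('a, 'b) ses" where
  "quo_target N X = \<lparr>cx = case_pos (sphere (\<lambda>_. N)) X X, inc = \<lambda>q. Zero \<A> N (ob X q),
     prj = \<lambda>q. Ident \<A> (ob X q)\<rparr>"

definition shift_target :: "(int \<Rightarrow> 'a) \<Rightarrow> ('a, 'b) ses" where
  "shift_target E = \<lparr>cx = case_pos (sphere E) (disc E) (sphere (\<lambda>q. E (q + 1))),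
     inc = \<lambda>q. in1 (E q) (E (q + 1)), prj = \<lambda>q. pr2 (E q) (E (q + 1))\<rparr>"

text \<open>A map into the row X = X -> 0 is determined by its middle component \<open>b\<close>,
  since the left square forces restriction to the subcomplex. The zero complex is encoded as the
  sphere on a zero object, so it inherits the splitting from spheres.\<close>

lemma split_target_sub:
  assumes S: "is_ses S" and N: "is_zero_object \<A> N" and X: "split_injective_complex X"
    and b: "chain_map \<A> (cx S Mid) X b"
    and zero: "\<And>q. zero_at S q \<Longrightarrow> is_zero_object \<A> (ob X q)"
  shows "split_target S (sub_target N X)
     (case_pos (\<lambda>q. b q \<cdot> inc S q) b (\<lambda>q. Zero \<A> (ob (cx S Quo) q) N))"
proof -
  have NO: "N \<in> Obj \<A>" using N by (simp add: zero_object_iff)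
  have Xc: "cochain_complex \<A> X" using X by (simp add: split_injective_complex_def)
  have Ns: "split_injective_complex (sphere (\<lambda>_. N))"
    by (rule split_injective_complex_sphere) (rule zero_object_injective[OF N])
  have Nc: "cochain_complex \<A> (sphere (\<lambda>_. N))" using Ns by (simp add: split_injective_complex_def)
  note [simp] = NO is_ses_simps[OF S] complex_Arr[OF Xc] chain_map_Arr[OF b]
  have e: "short_exact Y (Ident \<A> Y) Y (Zero \<A> Y N) N" if [simp]: "Y \<in> Obj \<A>" for Y
  proof (rule short_exactI)
    fix E y assume E: "injective_object \<A> E" and y: "y \<in> Hom \<A> Y E" "y \<cdot> Ident \<A> Y = Zero \<A> Y E"
    then have "Zero \<A> N E \<in> Hom \<A> N E" "Zero \<A> N E \<cdot> Zero \<A> Y N = y"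
      using injective_object_Obj[OF E] by (auto simp: Hom_iff)
    then show "\<exists>z\<in>Hom \<A> N E. z \<cdot> Zero \<A> Y N = y" by blast
  next
    fix E y assume E: "injective_object \<A> E" and y: "y \<in> Hom \<A> N E"
    then show "y = Zero \<A> N E" using Hom_zero_object[OF N] by blast
  qed (auto simp: Hom_iff)
  have "is_ses (sub_target N X)"
    unfolding is_ses_iff all_pos sub_target_def
    using Xc Nc by (simp add: e) (simp add: chain_map_def Hom_iff sphere_def e)
  moreover have "chain_map \<A> (cx S Quo) (sphere (\<lambda>_. N)) (\<lambda>q. Zero \<A> (ob (cx S Quo) q) N)"
    by (simp add: chain_map_def sphere_def Hom_iff)
  moreover have "chain_map \<A> (cx S Sub) X (\<lambda>q. b q \<cdot> inc S q)"
    by (rule chain_map_Comp[OF is_sesD(1)[OF S] is_sesD(1)[OF S] Xc is_sesD(2)[OF S] b])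
  ultimately show ?thesis
    unfolding split_target_def ses_map_def all_pos using X Ns b zero N
    by (auto simp: sub_target_def zero_at_def all_pos) (simp_all add: sphere_def)
qed

text \<open>The mirror image: for the row 0 -> X = X the component on the quotient complex
  determines the other two.\<close>

lemma split_target_quo:
  assumes S: "is_ses S" and N: "is_zero_object \<A> N" and X: "split_injective_complex X"
    and c: "chain_map \<A> (cx S Quo) X c"
    and zero: "\<And>q. zero_at S q \<Longrightarrow> is_zero_object \<A> (ob X q)"
  shows "split_target S (quo_target N X)
     (case_pos (\<lambda>q. Zero \<A> (ob (cx S Sub) q) N) (\<lambda>q. c q \<cdot> prj S q) c)"
proof -
  have NO: "N \<in> Obj \<A>" using N by (simp add: zero_object_iff)
  have Xc: "cochain_complex \<A> X" using X by (simp add: split_injective_complex_def)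
  have Ns: "split_injective_complex (sphere (\<lambda>_. N))"
    by (rule split_injective_complex_sphere) (rule zero_object_injective[OF N])
  have Nc: "cochain_complex \<A> (sphere (\<lambda>_. N))" using Ns by (simp add: split_injective_complex_def)
  note [simp] = NO is_ses_simps[OF S] complex_Arr[OF Xc] chain_map_Arr[OF c]
  have e: "short_exact N (Zero \<A> N Y) Y (Ident \<A> Y) Y" if [simp]: "Y \<in> Obj \<A>" for Y
  proof (rule short_exactI)
    fix E y assume E: "injective_object \<A> E" and y: "y \<in> Hom \<A> N E"
    then have "Zero \<A> Y E \<in> Hom \<A> Y E" "Zero \<A> Y E \<cdot> Zero \<A> N Y = y"
      using injective_object_Obj[OF E] Hom_zero_object(1)[OF N y] by (auto simp: Hom_iff)
    then show "\<exists>z\<in>Hom \<A> Y E. z \<cdot> Zero \<A> N Y = y" by blast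
  next
    fix E y assume E: "injective_object \<A> E" and y: "y \<in> Hom \<A> Y E"
    then show "\<exists>z\<in>Hom \<A> Y E. z \<cdot> Ident \<A> Y = y" by (auto simp: Hom_iff)
  qed (auto simp: Hom_iff)
  have "is_ses (quo_target N X)"
    unfolding is_ses_iff all_pos quo_target_def
    using Xc Nc by (simp add: e) (simp add: chain_map_def Hom_iff sphere_def e)
  moreover have "chain_map \<A> (cx S Sub) (sphere (\<lambda>_. N)) (\<lambda>q. Zero \<A> (ob (cx S Sub) q) N)"
    by (simp add: chain_map_def sphere_def Hom_iff)
  moreover have "chain_map \<A> (cx S Mid) X (\<lambda>q. c q \<cdot> prj S q)"
    by (rule chain_map_Comp[OF is_sesD(1)[OF S] is_sesD(1)[OF S] Xc is_sesD(3)[OF S] c])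
  ultimately show ?thesis
    unfolding split_target_def ses_map_def all_pos using X Ns c zero N
    by (auto simp: quo_target_def zero_at_def all_pos) (simp_all add: sphere_def)
qed

text \<open>
  The connecting homomorphism of \<open>shift_target E\<close> is the identity of \<open>E\<close>: this is what allows
  the cohomology of the subcomplex to embed although the connecting homomorphism of \<open>S\<close> need not
  vanish.
\<close>

lemma split_target_shift:
  assumes S: "is_ses S" and inj: "\<And>q. injective_object \<A> (E q)"
    and u: "\<And>q. u q \<in> Hom \<A> (ob (cx S Mid) q) (E q)"
    and ud: "\<And>q. u q \<cdot> (df (cx S Mid) (q - 1) \<cdot> inc S (q - 1)) = Zero \<A> (ob (cx S Sub) (q - 1)) (E q)"
    and zero: "\<And>q. zero_at S (q - 1) \<Longrightarrow> is_zero_object \<A> (E q)"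
      "\<And>q. zero_at S q \<Longrightarrow> is_zero_object \<A> (E q)"
  obtains c where "split_target S (shift_target E)
     (case_pos (\<lambda>q. u q \<cdot> inc S q) (disc_map (cx S Mid) u) c)"
proof -
  have EO: "E q \<in> Obj \<A>" for q using inj by (rule injective_object_Obj)
  have [simp]: "u q \<in> Arr \<A>" "Dom \<A> (u q) = ob (cx S Mid) q" "Cod \<A> (u q) = E q" for q
    using u[of q] by (auto simp: Hom_iff)
  note [simp] = EO is_ses_simps[OF S]
  let ?B = "cx S Mid"
  have dinc: "df ?B q \<cdot> inc S q = inc S (q + 1) \<cdot> df (cx S Sub) q"
     "df ?B (q - 1) \<cdot> inc S (q - 1) = inc S q \<cdot> df (cx S Sub) (q - 1)" for q
    using chain_map_commute[OF is_sesD(2)[OF S]] by auto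
  have udf: "u (q + 1) \<cdot> (df ?B q \<cdot> inc S q) = Zero \<A> (ob (cx S Sub) q) (E (q + 1))" for q
    using ud[of "q + 1"] by simp
  \<comment> \<open>The map \<open>u (q + 1) \<cdot> df ?B q\<close> vanishes on the subcomplex by
    \<open>udf\<close>, so it descends to the quotient. This gives the component into the shifted
    sphere.\<close>
  have "\<exists>c\<in>Hom \<A> (ob (cx S Quo) q) (E (q + 1)). c \<cdot> prj S q = u (q + 1) \<cdot> df ?B q" for q
    by (rule exact_atE[OF is_sesD(7,4,5)[OF S] inj, of "u (q + 1) \<cdot> df ?B q" q "q + 1"])
      (auto simp: Hom_iff udf)
  then obtain c where c: "\<And>q. c q \<in> Hom \<A> (ob (cx S Quo) q) (E (q + 1))"
    "\<And>q. c q \<cdot> prj S q = u (q + 1) \<cdot> df ?B q" by metis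
  have [simp]: "c q \<in> Arr \<A>" "Dom \<A> (c q) = ob (cx S Quo) q" "Cod \<A> (c q) = E (q + 1)" for q
    using c(1)[of q] by (auto simp: Hom_iff)
  have cd: "c (q + 1) \<cdot> df (cx S Quo) q = Zero \<A> (ob (cx S Quo) q) (E (q + 1 + 1))" for q
  proof -
    have "(c (q + 1) \<cdot> df (cx S Quo) q) \<cdot> prj S q = (c (q + 1) \<cdot> prj S (q + 1)) \<cdot> df ?B q"
      using chain_map_commute(1)[OF is_sesD(3)[OF S]] by simp
    also have "\<dots> = Zero \<A> (ob ?B q) (E (q + 1 + 1))" unfolding c(2) by simp
    finally show ?thesis
      by - (rule epicD0[OF is_sesD(8,5)[OF S]]; simp add: Hom_iff)
  qed
  have E1: "injective_object \<A> (E (q + 1))" for q by (rule inj)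
  note sp = split_injective_complex_sphere[of E, OF inj] split_injective_complex_disc[of E, OF inj]
    split_injective_complex_sphere[of "\<lambda>q. E (q + 1)", OF E1]
  have cc: "cochain_complex \<A> (sphere E)" "cochain_complex \<A> (disc E)"
    "cochain_complex \<A> (sphere (\<lambda>q. E (q + 1)))"
    using sp by (simp_all add: split_injective_complex_def)
  have e: "short_exact X (in1 X Y) (Bi X Y) (pr2 X Y) Y" if [simp]: "X \<in> Obj \<A>" "Y \<in> Obj \<A>" for X Y
  proof (rule short_exactI)
    fix E x assume E: "injective_object \<A> E" and x: "x \<in> Hom \<A> X E"
    have "(x \<cdot> pr1 X Y) \<cdot> in1 X Y = x" "x \<cdot> pr1 X Y \<in> Hom \<A> (Bi X Y) E"
      using x by (auto simp: Hom_iff)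
    then show "\<exists>y\<in>Hom \<A> (Bi X Y) E. y \<cdot> in1 X Y = x" by blast
  next
    fix E y assume E: "injective_object \<A> E" and y: "y \<in> Hom \<A> (Bi X Y) E"
      and y0: "y \<cdot> in1 X Y = Zero \<A> X E"
    have [simp]: "E \<in> Obj \<A>" using E by (rule injective_object_Obj)
    have "(y \<cdot> in2 X Y) \<cdot> pr2 X Y = y"
      by (rule biprod_eq_out[of X Y _ E]) (use y y0 in \<open>auto simp: Hom_iff\<close>)
    moreover have "y \<cdot> in2 X Y \<in> Hom \<A> Y E" using y by (simp add: Hom_iff)
    ultimately show "\<exists>z\<in>Hom \<A> Y E. z \<cdot> pr2 X Y = y" by blast
  next
    fix E z assume E: "injective_object \<A> E" and z: "z \<in> Hom \<A> Y E"
      and z0: "z \<cdot> pr2 X Y = Zero \<A> (Bi X Y) E"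
    have "z = (z \<cdot> pr2 X Y) \<cdot> in2 X Y" using z by (simp add: Hom_iff)
    then show "z = Zero \<A> Y E" unfolding z0 using injective_object_Obj[OF E] by simp
  qed (auto simp: Hom_iff)
  have "is_ses (shift_target E)"
    unfolding is_ses_iff all_pos shift_target_def
    using cc by (simp add: chain_map_def Hom_iff sphere_def disc_def e)
  moreover have "chain_map \<A> (cx S Sub) (sphere E) (\<lambda>q. u q \<cdot> inc S q)"
    by (rule chain_map_sphere[OF inj is_sesD(1)[OF S]])
      (use ud in \<open>auto simp: Hom_iff dinc\<close>)
  moreover have "chain_map \<A> ?B (disc E) (disc_map ?B u)"
    by (rule chain_map_disc[OF inj is_sesD(1)[OF S] u])
  moreover have "chain_map \<A> (cx S Quo) (sphere (\<lambda>q. E (q + 1))) c"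
    by (rule chain_map_sphere[OF E1 is_sesD(1)[OF S] c(1)]) (use cd[of "_ - 1"] in simp)
  \<comment> \<open>In degree \<open>q\<close> the target contains \<open>E (q + 1)\<close> besides
    \<open>E q\<close>; this is why \<open>zero\<close> also covers vanishing in the preceding
    degree.\<close>
  moreover have "zero_at (shift_target E) q" if "zero_at S q" for q
    using zero(1)[of "q + 1"] zero(2)[of q] that
    by (simp add: zero_at_def all_pos shift_target_def sphere_def disc_def zero_object_Bi)
  ultimately have "split_target S (shift_target E) (case_pos (\<lambda>q. u q \<cdot> inc S q) (disc_map ?B u) c)"
    unfolding split_target_def ses_map_def all_pos using sp
    by (simp add: shift_target_def disc_map_def udf c(2))
  then show thesis using that by blast
qed

lemma weak_hullD:
  assumes h: "weak_hull P f E u" and f: "f \<in> Hom \<A> X Y"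
  shows "injective_object \<A> E" "u \<in> Hom \<A> Y E" "u \<cdot> f = Zero \<A> X E"
    "P \<Longrightarrow> is_zero_object \<A> E" "is_zero_object \<A> Y \<Longrightarrow> is_zero_object \<A> E"
    "\<lbrakk>\<not> P; injective_object \<A> E'; y \<in> Hom \<A> Y E'; y \<cdot> f = Zero \<A> X E'\<rbrakk>
      \<Longrightarrow> \<exists>\<epsilon>\<in>Hom \<A> E E'. \<epsilon> \<cdot> u = y"
proof -
  have "Dom \<A> f = X" "Cod \<A> f = Y" using f by (simp_all add: Hom_iff)
  then show "injective_object \<A> E" "u \<in> Hom \<A> Y E" "u \<cdot> f = Zero \<A> X E"
    "P \<Longrightarrow> is_zero_object \<A> E" "is_zero_object \<A> Y \<Longrightarrow> is_zero_object \<A> E"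
    "\<lbrakk>\<not> P; injective_object \<A> E'; y \<in> Hom \<A> Y E'; y \<cdot> f = Zero \<A> X E'\<rbrakk>
      \<Longrightarrow> \<exists>\<epsilon>\<in>Hom \<A> E E'. \<epsilon> \<cdot> u = y"
    using h by (simp_all add: weak_hull_def)
qed

lemma ex_weak_hull_family:
  assumes "\<And>q. f q \<in> Arr \<A>"
  shows "\<exists>E u. \<forall>q. weak_hull (P q) (f q) (E q) (u q)"
proof -
  have "\<forall>q. \<exists>E u. weak_hull (P q) (f q) E u" using assms by (simp add: ex_weak_hull)
  then obtain E where "\<forall>q. \<exists>u. weak_hull (P q) (f q) (E q) u" by metis
  then show ?thesis by metis
qed

section \<open>Embedding a short exact sequence of complexes\<close>

text \<open>With a zero object in degree \<open>q - 1\<close>, every map on degree \<open>q\<close>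
  kills the coboundaries.\<close>

lemma extends_of_extends_cocycles:
  assumes X: "cochain_complex \<A> X" and "is_zero_object \<A> (ob X (q - 1))" and "extends_cocycles X I \<eta> q"
  shows "extends X I \<eta> q"
  unfolding extends_def
proof (intro allI impI)
  fix E \<alpha> assume E: "injective_object \<A> E" and \<alpha>: "\<alpha> \<in> Hom \<A> (ob X q) E"
  have "\<alpha> \<cdot> df X (q - 1) \<in> Hom \<A> (ob X (q - 1)) E"
    using \<alpha> by (simp add: Hom_iff complex_Arr[OF X])
  then have "\<alpha> \<cdot> df X (q - 1) = Zero \<A> (ob X (q - 1)) E" using Hom_zero_object(1) assms(2) by blast
  then show "\<exists>\<beta>\<in>Hom \<A> (ob I q) E. \<beta> \<cdot> \<eta> q = \<alpha>" using extends_cocyclesE[OF assms(3) E \<alpha>] by blast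
qed

text \<open>Replaces the shift piece in a degree that follows a vanishing one. There an extension of
  \<open>\<alpha>\<close> to the middle complex kills the incoming differential for free, so the
  condition on the middle complex applies, and the map it gives is restricted along
  \<open>inc T\<close>.\<close>

lemma extends_cocycles_Sub:
  assumes S: "is_ses S" and T: "split_target S T m" and z: "is_zero_object \<A> (ob (cx S Mid) (q - 1))"
    and ex: "extends_cocycles (cx S Mid) (cx T Mid) (m Mid) q"
  shows "extends_cocycles (cx S Sub) (cx T Sub) (m Sub) q"
  unfolding extends_cocycles_def
proof (intro allI impI)
  have T': "is_ses T" "ses_map S T m" using T by (auto simp: split_target_def)
  have m: "chain_map \<A> (cx S i) (cx T i) (m i)" "inc T q \<cdot> m Sub q = m Mid q \<cdot> inc S q" for i
    using T'(2) by (auto simp: ses_map_def)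
  note [simp] = is_ses_simps[OF S] is_ses_simps[OF T'(1)] chain_map_Arr[OF m(1)]
  fix E \<alpha> assume E: "injective_object \<A> E" and \<alpha>: "\<alpha> \<in> Hom \<A> (ob (cx S Sub) q) E"
  have [simp]: "E \<in> Obj \<A>" using E by (rule injective_object_Obj)
  obtain \<beta> where \<beta>: "\<beta> \<in> Hom \<A> (ob (cx S Mid) q) E" "\<beta> \<cdot> inc S q = \<alpha>"
    using injective_objectE[OF E is_sesD(6,4)[OF S] \<alpha>] by blast
  have "\<beta> \<cdot> df (cx S Mid) (q - 1) \<in> Hom \<A> (ob (cx S Mid) (q - 1)) E"
    using \<beta> by (simp add: Hom_iff)
  then have "\<beta> \<cdot> df (cx S Mid) (q - 1) = Zero \<A> (ob (cx S Mid) (q - 1)) E"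
    using Hom_zero_object(1)[OF z] by blast
  then obtain \<gamma> where \<gamma>: "\<gamma> \<in> Hom \<A> (ob (cx T Mid) q) E"
    "\<gamma> \<cdot> df (cx T Mid) (q - 1) = Zero \<A> (ob (cx T Mid) (q - 1)) E" "\<gamma> \<cdot> m Mid q = \<beta>"
    using extends_cocyclesE[OF ex E \<beta>(1)] by blast
  have [simp]: "\<gamma> \<in> Arr \<A>" "Dom \<A> \<gamma> = ob (cx T Mid) q" "Cod \<A> \<gamma> = E" using \<gamma> by (auto simp: Hom_iff)
  have "(\<gamma> \<cdot> inc T q) \<cdot> df (cx T Sub) (q - 1) = (\<gamma> \<cdot> df (cx T Mid) (q - 1)) \<cdot> inc T (q - 1)"
    using chain_map_commute(2)[OF is_sesD(2)[OF T'(1)]] by simp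
  also have "\<dots> = Zero \<A> (ob (cx T Sub) (q - 1)) E" unfolding \<gamma>(2) by simp
  finally have 1: "(\<gamma> \<cdot> inc T q) \<cdot> df (cx T Sub) (q - 1) = Zero \<A> (ob (cx T Sub) (q - 1)) E" .
  have "(\<gamma> \<cdot> inc T q) \<cdot> m Sub q = (\<gamma> \<cdot> m Mid q) \<cdot> inc S q" using m(2) by simp
  then have 2: "(\<gamma> \<cdot> inc T q) \<cdot> m Sub q = \<alpha>" unfolding \<gamma>(3) \<beta>(2) .
  have "\<gamma> \<cdot> inc T q \<in> Hom \<A> (ob (cx T Sub) q) E" by (simp add: Hom_iff)
  then show "\<exists>\<beta>\<in>Hom \<A> (ob (cx T Sub) q) E.
      \<beta> \<cdot> df (cx T Sub) (q - 1) = Zero \<A> (ob (cx T Sub) (q - 1)) E \<and> \<beta> \<cdot> m Sub q = \<alpha>"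
    using 1 2 by blast
qed

text \<open>The five lemma for monics, in dual form. The restriction of \<open>\<alpha>\<close> to
  the subcomplex is extended to the target; the difference lives on the quotient complex and is
  extended there; the two extensions are added.\<close>

lemma extends_Mid:
  assumes S: "is_ses S" and T: "split_target S T m"
    and ex: "extends (cx S Sub) (cx T Sub) (m Sub) q" "extends (cx S Quo) (cx T Quo) (m Quo) q"
  shows "extends (cx S Mid) (cx T Mid) (m Mid) q"
  unfolding extends_def
proof (intro allI impI)
  have T': "is_ses T" "ses_map S T m" using T by (auto simp: split_target_def)
  have m: "chain_map \<A> (cx S i) (cx T i) (m i)" "inc T q \<cdot> m Sub q = m Mid q \<cdot> inc S q"
     "prj T q \<cdot> m Mid q = m Quo q \<cdot> prj S q" for i
    using T'(2) by (auto simp: ses_map_def)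
  note [simp] = is_ses_simps[OF S] is_ses_simps[OF T'(1)] chain_map_Arr[OF m(1)]
  fix E \<alpha> assume E: "injective_object \<A> E" and \<alpha>: "\<alpha> \<in> Hom \<A> (ob (cx S Mid) q) E"
  have [simp]: "\<alpha> \<in> Arr \<A>" "Dom \<A> \<alpha> = ob (cx S Mid) q" "Cod \<A> \<alpha> = E" using \<alpha> by (auto simp: Hom_iff)
  have "\<alpha> \<cdot> inc S q \<in> Hom \<A> (ob (cx S Sub) q) E" by (simp add: Hom_iff)
  then obtain \<beta> where \<beta>: "\<beta> \<in> Hom \<A> (ob (cx T Sub) q) E" "\<beta> \<cdot> m Sub q = \<alpha> \<cdot> inc S q"
    using extendsE[OF ex(1) E] by blast
  obtain \<gamma> where \<gamma>: "\<gamma> \<in> Hom \<A> (ob (cx T Mid) q) E" "\<gamma> \<cdot> inc T q = \<beta>"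
    using injective_objectE[OF E is_sesD(6,4)[OF T'(1)] \<beta>(1)] by blast
  have [simp]: "\<gamma> \<in> Arr \<A>" "Dom \<A> \<gamma> = ob (cx T Mid) q" "Cod \<A> \<gamma> = E" using \<gamma> by (auto simp: Hom_iff)
  let ?d = "diff \<alpha> (\<gamma> \<cdot> m Mid q)"
  have "(\<gamma> \<cdot> m Mid q) \<cdot> inc S q = (\<gamma> \<cdot> inc T q) \<cdot> m Sub q" using m(2) by simp
  then have "(\<gamma> \<cdot> m Mid q) \<cdot> inc S q = \<alpha> \<cdot> inc S q" unfolding \<gamma>(2) \<beta>(2) .
  then have "?d \<cdot> inc S q = Zero \<A> (ob (cx S Sub) q) E" by simp
  moreover have d: "?d \<in> Hom \<A> (ob (cx S Mid) q) E" by (simp add: Hom_iff)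
  ultimately obtain \<delta> where \<delta>: "\<delta> \<in> Hom \<A> (ob (cx S Quo) q) E" "\<delta> \<cdot> prj S q = ?d"
    using exact_atE[OF is_sesD(7,4,5)[OF S] E] by blast
  obtain \<epsilon> where \<epsilon>: "\<epsilon> \<in> Hom \<A> (ob (cx T Quo) q) E" "\<epsilon> \<cdot> m Quo q = \<delta>"
    using extendsE[OF ex(2) E \<delta>(1)] by blast
  have [simp]: "\<epsilon> \<in> Arr \<A>" "Dom \<A> \<epsilon> = ob (cx T Quo) q" "Cod \<A> \<epsilon> = E" using \<epsilon> by (auto simp: Hom_iff)
  have "(\<epsilon> \<cdot> prj T q) \<cdot> m Mid q = (\<epsilon> \<cdot> m Quo q) \<cdot> prj S q" using m(3) by simp
  then have "(\<epsilon> \<cdot> prj T q) \<cdot> m Mid q = ?d" unfolding \<epsilon>(2) \<delta>(2) .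
  then have "Add \<A> (\<epsilon> \<cdot> prj T q) \<gamma> \<cdot> m Mid q = Add \<A> ?d (\<gamma> \<cdot> m Mid q)" by simp
  also have "\<dots> = \<alpha>" by (rule Add_diff_cancel[of _ "ob (cx S Mid) q" E]) (auto simp: Hom_iff)
  finally have "Add \<A> (\<epsilon> \<cdot> prj T q) \<gamma> \<cdot> m Mid q = \<alpha>" .
  moreover have "Add \<A> (\<epsilon> \<cdot> prj T q) \<gamma> \<in> Hom \<A> (ob (cx T Mid) q) E" by (simp add: Hom_iff)
  ultimately show "\<exists>\<beta>\<in>Hom \<A> (ob (cx T Mid) q) E. \<beta> \<cdot> m Mid q = \<alpha>" by blast
qed

definition CE_embedding :: "('a, 'b) ses \<Rightarrow> ('a, 'b) ses \<Rightarrow> (pos \<Rightarrow> int \<Rightarrow> 'b) \<Rightarrow> bool" where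
  "CE_embedding S T m \<longleftrightarrow> split_target S T m \<and>
     (\<forall>i q. extends (cx S i) (cx T i) (m i) q) \<and>
     (\<forall>i q. extends_cocycles (cx S i) (cx T i) (m i) q)"

lemma extends_disc:
  assumes X: "cochain_complex \<A> X" and inj: "\<And>q. injective_object \<A> (E q)"
    and u: "\<And>q. u q \<in> Hom \<A> (ob X q) (E q)"
    and ext: "\<And>E' y. \<lbrakk>injective_object \<A> E'; y \<in> Hom \<A> (ob X q) E'\<rbrakk> \<Longrightarrow> \<exists>\<epsilon>\<in>Hom \<A> (E q) E'. \<epsilon> \<cdot> u q = y"
  shows "extends X (disc E) (disc_map X u) q"
  unfolding extends_def
proof (intro allI impI)
  note [simp] = complex_Arr[OF X] injective_object_Obj[OF inj]
  have [simp]: "u q \<in> Arr \<A>" "Dom \<A> (u q) = ob X q" "Cod \<A> (u q) = E q" for q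
    using u[of q] by (auto simp: Hom_iff)
  fix E' \<alpha> assume E': "injective_object \<A> E'" and \<alpha>: "\<alpha> \<in> Hom \<A> (ob X q) E'"
  obtain \<epsilon> where \<epsilon>: "\<epsilon> \<in> Hom \<A> (E q) E'" "\<epsilon> \<cdot> u q = \<alpha>" using ext[OF E' \<alpha>] by blast
  have "(\<epsilon> \<cdot> pr1 (E q) (E (q + 1))) \<cdot> disc_map X u q = \<alpha>"
    using \<epsilon> by (simp add: disc_map_def Hom_iff)
  moreover have "\<epsilon> \<cdot> pr1 (E q) (E (q + 1)) \<in> Hom \<A> (ob (disc E) q) E'"
    using \<epsilon> by (simp add: disc_def Hom_iff)
  ultimately show "\<exists>\<beta>\<in>Hom \<A> (ob (disc E) q) E'. \<beta> \<cdot> disc_map X u q = \<alpha>" by blast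
qed

text \<open>On a complex with zero differential every map kills the coboundaries, so a plain
  extension along \<open>u q\<close> is all that is required.\<close>

lemma extends_cocycles_sphere:
  assumes X: "cochain_complex \<A> X" and inj: "\<And>q. injective_object \<A> (E q)"
    and ext: "\<And>E' y. \<lbrakk>injective_object \<A> E'; y \<in> Hom \<A> (ob X q) E';
        y \<cdot> df X (q - 1) = Zero \<A> (ob X (q - 1)) E'\<rbrakk> \<Longrightarrow> \<exists>\<epsilon>\<in>Hom \<A> (E q) E'. \<epsilon> \<cdot> u q = y"
  shows "extends_cocycles X (sphere E) u q"
  unfolding extends_cocycles_def
proof (intro allI impI)
  fix E' \<alpha> assume E': "injective_object \<A> E'" and \<alpha>: "\<alpha> \<in> Hom \<A> (ob X q) E'"
    "\<alpha> \<cdot> df X (q - 1) = Zero \<A> (ob X (q - 1)) E'"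
  obtain \<epsilon> where \<epsilon>: "\<epsilon> \<in> Hom \<A> (E q) E'" "\<epsilon> \<cdot> u q = \<alpha>" using ext[OF E' \<alpha>] by blast
  then show "\<exists>\<beta>\<in>Hom \<A> (ob (sphere E) q) E'.
      \<beta> \<cdot> df (sphere E) (q - 1) = Zero \<A> (ob (sphere E) (q - 1)) E' \<and> \<beta> \<cdot> u q = \<alpha>"
    using injective_object_Obj[OF inj] by (intro bexI[of _ \<epsilon>]) (auto simp: sphere_def Hom_iff)
qed

lemma extends_precompose:
  assumes e: "extends X I \<eta> q" and X: "cochain_complex \<A> X" and I: "cochain_complex \<A> I"
    and \<eta>: "chain_map \<A> X I \<eta>" and i: "i q \<in> Hom \<A> (ob A q) (ob X q)" "monic \<A> (i q)"
  shows "extends A I (\<lambda>q. \<eta> q \<cdot> i q) q"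
  unfolding extends_def
proof (intro allI impI)
  note [simp] = complex_Arr[OF X] complex_Arr[OF I] chain_map_Arr[OF \<eta>]
  fix E \<alpha> assume E: "injective_object \<A> E" and \<alpha>: "\<alpha> \<in> Hom \<A> (ob A q) E"
  obtain \<gamma> where \<gamma>: "\<gamma> \<in> Hom \<A> (ob X q) E" "\<gamma> \<cdot> i q = \<alpha>"
    using injective_objectE[OF E i(2,1) \<alpha>] by blast
  obtain \<beta> where \<beta>: "\<beta> \<in> Hom \<A> (ob I q) E" "\<beta> \<cdot> \<eta> q = \<gamma>" using extendsE[OF e E \<gamma>(1)] by blast
  have "\<beta> \<cdot> (\<eta> q \<cdot> i q) = (\<beta> \<cdot> \<eta> q) \<cdot> i q" using \<beta>(1) i(1) by (simp add: Hom_iff)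
  then have "\<beta> \<cdot> (\<eta> q \<cdot> i q) = \<alpha>" unfolding \<beta>(2) \<gamma>(2) .
  then show "\<exists>\<beta>\<in>Hom \<A> (ob I q) E. \<beta> \<cdot> (\<eta> q \<cdot> i q) = \<alpha>" using \<beta>(1) by blast
qed

text \<open>Each piece serves one requirement: \<open>m1\<close> and \<open>m2\<close> the extension
  of cocycle maps on \<open>?B\<close> and \<open>?C\<close>, \<open>m3\<close> and
  \<open>m4\<close> plain extension on \<open>?A\<close> and \<open>?C\<close>, and
  \<open>m5\<close> the extension of cocycle maps on \<open>?A\<close>. Plain extension on
  \<open>?B\<close> follows from the outer two. The first two pieces work in every degree, the
  others where \<open>P\<close> fails; where \<open>P\<close> holds, the first two imply what the
  others would give.\<close>

lemma ex_CE_embedding: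
  assumes S: "is_ses S"
  shows "\<exists>T m. CE_embedding S T m"
proof -
  let ?A = "cx S Sub" and ?B = "cx S Mid" and ?C = "cx S Quo"
  note c = is_sesD(1)[OF S]
  note [simp] = is_ses_simps[OF S]
  obtain N where N: "is_zero_object \<A> N" using ex_zero_object by blast
  \<comment> \<open>\<open>P q\<close> looks one degree down because a disc or shift piece built on
    \<open>E q\<close> contains \<open>E q\<close> in degree \<open>q - 1\<close> too.\<close>
  define P where "P q = zero_at S (q - 1)" for q
  have z: "is_zero_object \<A> (ob (cx S i) q)" if "zero_at S q" for i q
    using that by (simp add: zero_at_def)
  have P: "is_zero_object \<A> (ob (cx S i) (q - 1))" if "P q" for i q
    using that by (simp add: P_def z)
  have fB: "df ?B (q - 1) \<in> Hom \<A> (ob ?B (q - 1)) (ob ?B q)" for q by (simp add: Hom_iff)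
  have fC: "df ?C (q - 1) \<in> Hom \<A> (ob ?C (q - 1)) (ob ?C q)" for q by (simp add: Hom_iff)
  have ZB: "Zero \<A> (ob ?B q) (ob ?B q) \<in> Hom \<A> (ob ?B q) (ob ?B q)" for q by (simp add: Hom_iff)
  have ZC: "Zero \<A> (ob ?C q) (ob ?C q) \<in> Hom \<A> (ob ?C q) (ob ?C q)" for q by (simp add: Hom_iff)
  have fA: "df ?B (q - 1) \<cdot> inc S (q - 1) \<in> Hom \<A> (ob ?A (q - 1)) (ob ?B q)" for q by (simp add: Hom_iff)
  obtain E1 u1 where h1: "\<And>q. weak_hull False (df ?B (q - 1)) (E1 q) (u1 q)"
    using ex_weak_hull_family[where P = "\<lambda>_. False" and f = "\<lambda>q. df ?B (q - 1)"] by auto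
  obtain E2 u2 where h2: "\<And>q. weak_hull False (df ?C (q - 1)) (E2 q) (u2 q)"
    using ex_weak_hull_family[where P = "\<lambda>_. False" and f = "\<lambda>q. df ?C (q - 1)"] by auto
  \<comment> \<open>Every map out of \<open>ob ?B q\<close> kills the zero endomorphism. So, where
    \<open>P\<close> fails, \<open>u3 q\<close> simply embeds \<open>ob ?B q\<close> into an
    injective object, and likewise \<open>u4 q\<close> for \<open>?C\<close>.\<close>
  obtain E3 u3 where h3: "\<And>q. weak_hull (P q) (Zero \<A> (ob ?B q) (ob ?B q)) (E3 q) (u3 q)"
    using ex_weak_hull_family[where P = "P" and f = "\<lambda>q. Zero \<A> (ob ?B q) (ob ?B q)"] by auto
  obtain E4 u4 where h4: "\<And>q. weak_hull (P q) (Zero \<A> (ob ?C q) (ob ?C q)) (E4 q) (u4 q)"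
    using ex_weak_hull_family[where P = "P" and f = "\<lambda>q. Zero \<A> (ob ?C q) (ob ?C q)"] by auto
  \<comment> \<open>Only the coboundaries coming from the subcomplex are divided out. A map on
    \<open>?A\<close> that kills coboundaries extends to \<open>?B\<close>, and these are the
    coboundaries the extension is known to kill.\<close>
  obtain E5 u5 where h5: "\<And>q. weak_hull (P q) (df ?B (q - 1) \<cdot> inc S (q - 1)) (E5 q) (u5 q)"
    using ex_weak_hull_family[where P = "P" and f = "\<lambda>q. df ?B (q - 1) \<cdot> inc S (q - 1)"] by auto
  note D1 = weak_hullD[OF h1 fB] and D2 = weak_hullD[OF h2 fC] and D3 = weak_hullD[OF h3 ZB]
    and D4 = weak_hullD[OF h4 ZC] and D5 = weak_hullD[OF h5 fA]
  \<comment> \<open>The summand \<open>E (q + 1)\<close> is covered by \<open>P (q + 1)\<close>,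
    which is vanishing of the sequence in degree \<open>q\<close>.\<close>
  have zd: "is_zero_object \<A> (ob (disc E) q)"
    if "\<And>q. P q \<Longrightarrow> is_zero_object \<A> (E q)" "\<And>q. is_zero_object \<A> (ob (cx S i) q) \<Longrightarrow> is_zero_object \<A> (E q)"
      "zero_at S q" for E i q
    using that(1)[of "q + 1"] that(2)[of q] that(3) z[of q i]
    by (simp add: disc_def P_def zero_object_Bi)

  define m1 where "m1 = case_pos (\<lambda>q. u1 q \<cdot> inc S q) u1 (\<lambda>q. Zero \<A> (ob ?C q) N)"
  have t1: "split_target S (sub_target N (sphere E1)) m1"
    unfolding m1_def
    by (rule split_target_sub[OF S N split_injective_complex_sphere chain_map_sphere])
      (use D1 c z in \<open>auto simp: sphere_def\<close>)
  have x1: "extends_cocycles ?B (cx (sub_target N (sphere E1)) Mid) (m1 Mid) q" for q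
    using extends_cocycles_sphere[OF c D1(1), where u = u1] D1(6) by (simp add: m1_def sub_target_def)

  define m2 where "m2 = case_pos (\<lambda>q. Zero \<A> (ob ?A q) N) (\<lambda>q. u2 q \<cdot> prj S q) u2"
  have t2: "split_target S (quo_target N (sphere E2)) m2"
    unfolding m2_def
    by (rule split_target_quo[OF S N split_injective_complex_sphere chain_map_sphere])
      (use D2 c z in \<open>auto simp: sphere_def\<close>)
  have x2: "extends_cocycles ?C (cx (quo_target N (sphere E2)) Quo) (m2 Quo) q" for q
    using extends_cocycles_sphere[OF c D2(1), where u = u2] D2(6) by (simp add: m2_def quo_target_def)

  define m3 where "m3 = case_pos (\<lambda>q. disc_map ?B u3 q \<cdot> inc S q) (disc_map ?B u3) (\<lambda>q. Zero \<A> (ob ?C q) N)"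
  have s3: "split_injective_complex (disc E3)" and c3: "chain_map \<A> ?B (disc E3) (disc_map ?B u3)"
    by (rule split_injective_complex_disc[OF D3(1)], rule chain_map_disc[OF D3(1) c D3(2)])
  have t3: "split_target S (sub_target N (disc E3)) m3"
    unfolding m3_def
    by (rule split_target_sub[OF S N s3 c3]) (rule zd[of E3 Mid, OF D3(4,5)])
  have e3: "extends ?B (disc E3) (disc_map ?B u3) q" if "\<not> P q" for q
  proof (rule extends_disc[OF c D3(1,2)])
    fix E y assume E: "injective_object \<A> E" and y: "y \<in> Hom \<A> (ob ?B q) E"
    then have "y \<cdot> Zero \<A> (ob ?B q) (ob ?B q) = Zero \<A> (ob ?B q) E" by (simp add: Hom_iff)
    then show "\<exists>\<epsilon>\<in>Hom \<A> (E3 q) E. \<epsilon> \<cdot> u3 q = y" using D3(6)[OF that E y] by blast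
  qed
  have x3: "extends ?A (cx (sub_target N (disc E3)) Sub) (m3 Sub) q" if "\<not> P q" for q
    using extends_precompose[where i = "inc S", OF e3[OF that] c _ c3 is_sesD(4)[OF S] is_sesD(6)[OF S]] s3
    by (simp add: m3_def sub_target_def split_injective_complex_def)

  define m4 where "m4 = case_pos (\<lambda>q. Zero \<A> (ob ?A q) N) (\<lambda>q. disc_map ?C u4 q \<cdot> prj S q) (disc_map ?C u4)"
  have s4: "split_injective_complex (disc E4)" and c4: "chain_map \<A> ?C (disc E4) (disc_map ?C u4)"
    by (rule split_injective_complex_disc[OF D4(1)], rule chain_map_disc[OF D4(1) c D4(2)])
  have t4: "split_target S (quo_target N (disc E4)) m4"
    unfolding m4_def
    by (rule split_target_quo[OF S N s4 c4]) (rule zd[of E4 Quo, OF D4(4,5)])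
  have e4: "extends ?C (disc E4) (disc_map ?C u4) q" if "\<not> P q" for q
  proof (rule extends_disc[OF c D4(1,2)])
    fix E y assume E: "injective_object \<A> E" and y: "y \<in> Hom \<A> (ob ?C q) E"
    then have "y \<cdot> Zero \<A> (ob ?C q) (ob ?C q) = Zero \<A> (ob ?C q) E" by (simp add: Hom_iff)
    then show "\<exists>\<epsilon>\<in>Hom \<A> (E4 q) E. \<epsilon> \<cdot> u4 q = y" using D4(6)[OF that E y] by blast
  qed
  have x4: "extends ?C (cx (quo_target N (disc E4)) Quo) (m4 Quo) q" if "\<not> P q" for q
    using e4[OF that] by (simp add: m4_def quo_target_def)

  obtain k where t5': "split_target S (shift_target E5) (case_pos (\<lambda>q. u5 q \<cdot> inc S q) (disc_map ?B u5) k)"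
    by (rule split_target_shift[OF S D5(1,2,3)]) (use D5(4,5) P_def z in auto)
  define m5 where "m5 = case_pos (\<lambda>q. u5 q \<cdot> inc S q) (disc_map ?B u5) k"
  note t5 = t5'[folded m5_def]
  have x5: "extends_cocycles ?A (cx (shift_target E5) Sub) (m5 Sub) q" if nP: "\<not> P q" for q
  proof -
    have [simp]: "u5 q \<in> Arr \<A>" "Dom \<A> (u5 q) = ob ?B q" "Cod \<A> (u5 q) = E5 q" for q
      using D5(2)[of q] by (auto simp: Hom_iff)
    have "extends_cocycles ?A (sphere E5) (\<lambda>q. u5 q \<cdot> inc S q) q"
    proof (rule extends_cocycles_sphere[OF c D5(1)])
      fix E y assume E: "injective_object \<A> E" and y: "y \<in> Hom \<A> (ob ?A q) E"
        and y0: "y \<cdot> df ?A (q - 1) = Zero \<A> (ob ?A (q - 1)) E"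
      obtain w where w: "w \<in> Hom \<A> (ob ?B q) E" "w \<cdot> inc S q = y"
        using injective_objectE[OF E is_sesD(6,4)[OF S] y] by blast
      have "w \<cdot> (df ?B (q - 1) \<cdot> inc S (q - 1)) = (w \<cdot> inc S q) \<cdot> df ?A (q - 1)"
        unfolding chain_map_commute(2)[OF is_sesD(2)[OF S]] using w(1) by (simp add: Hom_iff)
      then obtain \<epsilon> where \<epsilon>: "\<epsilon> \<in> Hom \<A> (E5 q) E" "\<epsilon> \<cdot> u5 q = w"
        using D5(6)[OF nP E w(1)] w(2) y0 by auto
      have "\<epsilon> \<cdot> (u5 q \<cdot> inc S q) = w \<cdot> inc S q" unfolding \<epsilon>(2)[symmetric] using \<epsilon>(1) by (simp add: Hom_iff)
      then show "\<exists>\<epsilon>\<in>Hom \<A> (E5 q) E. \<epsilon> \<cdot> (u5 q \<cdot> inc S q) = y" using \<epsilon>(1) w(2) by auto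
    qed
    then show ?thesis by (simp add: m5_def shift_target_def)
  qed

  note t45 = split_target_ssum[OF S t4 t5] and x45 = extends_ssum[OF S t4 t5]
  note t345 = split_target_ssum[OF S t3 t45] and x345 = extends_ssum[OF S t3 t45]
  note t2345 = split_target_ssum[OF S t2 t345] and x2345 = extends_ssum[OF S t2 t345]
  note t = split_target_ssum[OF S t1 t2345] and x = extends_ssum[OF S t1 t2345]
  let ?T = "ssum (sub_target N (sphere E1)) (ssum (quo_target N (sphere E2))
     (ssum (sub_target N (disc E3)) (ssum (quo_target N (disc E4)) (shift_target E5))))"
  let ?m = "smap_pair m1 (smap_pair m2 (smap_pair m3 (smap_pair m4 m5)))"
  have cMid: "extends_cocycles ?B (cx ?T Mid) (?m Mid) q" for q
    by (rule x(2)) (simp add: x1)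
  have cQuo: "extends_cocycles ?C (cx ?T Quo) (?m Quo) q" for q
    by (rule x(2)) (simp add: x2345(2) x2)
  have cSub: "extends_cocycles ?A (cx ?T Sub) (?m Sub) q" for q
  proof (cases "P q")
    \<comment> \<open>Here \<open>E5 q\<close> is zero and the shift piece contributes nothing in
      its subcomplex; the condition is recovered from the middle complex.\<close>
    case True
    then show ?thesis using extends_cocycles_Sub[OF S t P cMid] by blast
  next
    case False
    then show ?thesis by (intro x(2) disjI2 x2345(2) x345(2) x45(2) x5)
  qed
  have eSub: "extends ?A (cx ?T Sub) (?m Sub) q" for q
  proof (cases "P q")
    case True
    then show ?thesis using extends_of_extends_cocycles[OF c P cSub] by blast
  next
    case False
    then show ?thesis by (intro x(1) disjI2 x2345(1)) (simp add: x345(1) x3)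
  qed
  have eQuo: "extends ?C (cx ?T Quo) (?m Quo) q" for q
  proof (cases "P q")
    case True
    then show ?thesis using extends_of_extends_cocycles[OF c P cQuo] by blast
  next
    case False
    then show ?thesis by (intro x(1) disjI2 x2345(1) x345(1)) (simp add: x45(1) x4)
  qed
  have "CE_embedding S ?T ?m"
    unfolding CE_embedding_def all_pos
    using t cMid cQuo cSub eSub eQuo extends_Mid[OF S t eSub eQuo] by blast
  then show ?thesis by blast
qed

section \<open>Iteration\<close>

text \<open>The columns are exact because the embedding is monic and \<open>p\<close> is its
  cokernel. Exactness of the row of cokernels is the nine lemma, chased with maps into injective
  objects. Its left end uses the extension property of \<open>m Quo\<close>.\<close>

lemma ex_quotient:
  assumes S: "is_ses S" and CE: "CE_embedding S T m"
  shows "\<exists>S' p. is_ses S' \<and> ses_map T S' p \<and>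
     (\<forall>i. CE_short_exact (cx S i) (m i) (cx T i) (p i) (cx S' i)) \<and>
     (\<forall>q. zero_at S q \<longrightarrow> zero_at S' q)"
proof -
  have T: "split_target S T m" and ext: "\<And>i q. extends (cx S i) (cx T i) (m i) q"
    and extc: "\<And>i q. extends_cocycles (cx S i) (cx T i) (m i) q"
    using CE by (auto simp: CE_embedding_def)
  have T': "is_ses T" "ses_map S T m" "\<And>q. zero_at S q \<Longrightarrow> zero_at T q"
    using T by (auto simp: split_target_def)
  have m: "chain_map \<A> (cx S i) (cx T i) (m i)" "inc T q \<cdot> m Sub q = m Mid q \<cdot> inc S q"
     "prj T q \<cdot> m Mid q = m Quo q \<cdot> prj S q" for i q
    using T'(2) by (auto simp: ses_map_def)
  note [simp] = is_ses_simps[OF S] is_ses_simps[OF T'(1)] chain_map_Arr[OF m(1)]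
  have mH: "m i q \<in> Hom \<A> (ob (cx S i) q) (ob (cx T i) q)" for i q by (simp add: Hom_iff)
  define p where "p i q = coker_arr \<A> (m i q)" for i q
  define Q where "Q i q = Cod \<A> (p i q)" for i q
  have pc: "is_cokernel \<A> (m i q) (p i q)" for i q
    unfolding p_def by (rule is_cokernel_coker_arr) simp
  note pD = cokernelD[OF pc mH, folded Q_def]
  have pE: "\<exists>u\<in>Hom \<A> (Q i q) W. u \<cdot> p i q = h"
    if "h \<in> Hom \<A> (ob (cx T i) q) W" "h \<cdot> m i q = Zero \<A> (ob (cx S i) q) W" for h i q W
    using cokernelE[OF pc mH that] unfolding Q_def by blast
  have [simp]: "p i q \<in> Arr \<A>" "Dom \<A> (p i q) = ob (cx T i) q" "Cod \<A> (p i q) = Q i q" "Q i q \<in> Obj \<A>" for i q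
    using pD(1)[of i q] Hom_Obj[OF pD(1)] by (auto simp: Hom_iff)
  have pm: "p i q \<cdot> (m i q \<cdot> h) = Zero \<A> (Dom \<A> h) (Q i q)" if "h \<in> Arr \<A>" "Cod \<A> h = ob (cx S i) q" for i q h
  proof -
    have "p i q \<cdot> (m i q \<cdot> h) = (p i q \<cdot> m i q) \<cdot> h" using that by simp
    then show ?thesis unfolding pD(2) using that by simp
  qed
  have "\<exists>u\<in>Hom \<A> (Q i q) (Q i (q + 1)). u \<cdot> p i q = p i (q + 1) \<cdot> df (cx T i) q" for i q
    by (rule pE) (auto simp: Hom_iff chain_map_commute(1)[OF m(1)] pm)
  then obtain d where d: "\<And>i q. d i q \<in> Hom \<A> (Q i q) (Q i (q + 1))"
      "\<And>i q. d i q \<cdot> p i q = p i (q + 1) \<cdot> df (cx T i) q" by metis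
  have "\<exists>u\<in>Hom \<A> (Q Sub q) (Q Mid q). u \<cdot> p Sub q = p Mid q \<cdot> inc T q" for q
    by (rule pE) (auto simp: Hom_iff m pm)
  then obtain f where f: "\<And>q. f q \<in> Hom \<A> (Q Sub q) (Q Mid q)"
      "\<And>q. f q \<cdot> p Sub q = p Mid q \<cdot> inc T q" by metis
  have "\<exists>u\<in>Hom \<A> (Q Mid q) (Q Quo q). u \<cdot> p Mid q = p Quo q \<cdot> prj T q" for q
    by (rule pE) (auto simp: Hom_iff m pm)
  then obtain g where g: "\<And>q. g q \<in> Hom \<A> (Q Mid q) (Q Quo q)"
      "\<And>q. g q \<cdot> p Mid q = p Quo q \<cdot> prj T q" by metis
  have [simp]: "d i q \<in> Arr \<A>" "Dom \<A> (d i q) = Q i q" "Cod \<A> (d i q) = Q i (q + 1)" for i q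
    using d(1)[of i q] by (auto simp: Hom_iff)
  have [simp]: "f q \<in> Arr \<A>" "Dom \<A> (f q) = Q Sub q" "Cod \<A> (f q) = Q Mid q"
     "g q \<in> Arr \<A>" "Dom \<A> (g q) = Q Mid q" "Cod \<A> (g q) = Q Quo q" for q
    using f(1)[of q] g(1)[of q] by (auto simp: Hom_iff)
  have dp: "d i q \<cdot> (p i q \<cdot> h) = p i (q + 1) \<cdot> (df (cx T i) q \<cdot> h)"
    if "h \<in> Arr \<A>" "Cod \<A> h = ob (cx T i) q" for i q h
    using that by (intro commute_Comp[OF d(2)]) auto
  have fp: "f q \<cdot> (p Sub q \<cdot> h) = p Mid q \<cdot> (inc T q \<cdot> h)"
    if "h \<in> Arr \<A>" "Cod \<A> h = ob (cx T Sub) q" for q h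
    using that by (intro commute_Comp[OF f(2)]) auto
  have gp: "g q \<cdot> (p Mid q \<cdot> h) = p Quo q \<cdot> (prj T q \<cdot> h)"
    if "h \<in> Arr \<A>" "Cod \<A> h = ob (cx T Mid) q" for q h
    using that by (intro commute_Comp[OF g(2)]) auto
  have epi: "x = y" if "x \<in> Hom \<A> (Q i q) W" "y \<in> Hom \<A> (Q i q) W" "x \<cdot> p i q = y \<cdot> p i q" for x y i q W
    using epicD[OF pD(3,1) that] .
  note dinc = chain_map_commute(1)[OF is_sesD(2)[OF T'(1)]] and dprj = chain_map_commute(1)[OF is_sesD(3)[OF T'(1)]]

  define S' where "S' = \<lparr>cx = \<lambda>i. \<lparr>ob = Q i, df = d i\<rparr>, inc = f, prj = g\<rparr>"
  have S'_simps [simp]: "ob (cx S' i) = Q i" "df (cx S' i) = d i" "inc S' = f" "prj S' = g" for i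
    by (simp_all add: S'_def)
  have cS': "cochain_complex \<A> (cx S' i)" for i
    unfolding cochain_complex_def
  proof (intro conjI allI)
    fix q show "df (cx S' i) (q + 1) \<cdot> df (cx S' i) q = Zero \<A> (ob (cx S' i) q) (ob (cx S' i) (q + 1 + 1))"
      by (rule epi[of _ i q]) (auto simp: Hom_iff d dp simp del: add.assoc)
  qed (auto simp: Hom_iff)
  have chp: "chain_map \<A> (cx T i) (cx S' i) (p i)" for i
    by (simp add: chain_map_def Hom_iff d)
  have ch1: "chain_map \<A> (cx S' Sub) (cx S' Mid) f"
    unfolding chain_map_def
  proof (intro conjI allI)
    fix q show "df (cx S' Mid) q \<cdot> f q = f (q + 1) \<cdot> df (cx S' Sub) q"
      by (rule epi[of _ Sub q]) (auto simp: Hom_iff d f dp fp dinc)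
  qed (auto simp: Hom_iff)
  have ch2: "chain_map \<A> (cx S' Mid) (cx S' Quo) g"
    unfolding chain_map_def
  proof (intro conjI allI)
    fix q show "df (cx S' Quo) q \<cdot> g q = g (q + 1) \<cdot> df (cx S' Mid) q"
      by (rule epi[of _ Mid q]) (auto simp: Hom_iff d g dp gp dprj)
  qed (auto simp: Hom_iff)
  have col: "short_exact (ob (cx S i) q) (m i q) (ob (cx T i) q) (p i q) (Q i q)" for i q
    unfolding short_exact_def
  proof (intro conjI)
    show "monic \<A> (m i q)"
      by (rule monicI[OF mH]) (use ext[of i q] in \<open>auto simp: extends_def\<close>)
    show "exact_at \<A> (m i q) (p i q)" by (rule exact_atI[OF mH pD(1,2) pE])
  qed (use mH pD in auto)
  have row: "short_exact (Q Sub q) (f q) (Q Mid q) (g q) (Q Quo q)" for q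
  proof (rule short_exactI)
    show "f q \<in> Hom \<A> (Q Sub q) (Q Mid q)" "g q \<in> Hom \<A> (Q Mid q) (Q Quo q)" by (fact f g)+
    show "g q \<cdot> f q = Zero \<A> (Q Sub q) (Q Quo q)"
      by (rule epi[of _ Sub q]) (auto simp: Hom_iff f gp)
  next
    fix E \<alpha> assume E: "injective_object \<A> E" and \<alpha>: "\<alpha> \<in> Hom \<A> (Q Sub q) E"
    have [simp]: "E \<in> Obj \<A>" using E by (rule injective_object_Obj)
    have [simp]: "\<alpha> \<in> Arr \<A>" "Dom \<A> \<alpha> = Q Sub q" "Cod \<A> \<alpha> = E" using \<alpha> by (auto simp: Hom_iff)
    have "\<alpha> \<cdot> p Sub q \<in> Hom \<A> (ob (cx T Sub) q) E" by (simp add: Hom_iff)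
    then obtain \<beta> where \<beta>: "\<beta> \<in> Hom \<A> (ob (cx T Mid) q) E" "\<beta> \<cdot> inc T q = \<alpha> \<cdot> p Sub q"
      using injective_objectE[OF E is_sesD(6,4)[OF T'(1)]] by blast
    have [simp]: "\<beta> \<in> Arr \<A>" "Dom \<A> \<beta> = ob (cx T Mid) q" "Cod \<A> \<beta> = E" using \<beta> by (auto simp: Hom_iff)
    have "(\<beta> \<cdot> m Mid q) \<cdot> inc S q = (\<beta> \<cdot> inc T q) \<cdot> m Sub q" by (simp add: m(2))
    also have "\<dots> = Zero \<A> (ob (cx S Sub) q) E" unfolding \<beta>(2) by (simp add: pD(2))
    finally have 0: "(\<beta> \<cdot> m Mid q) \<cdot> inc S q = Zero \<A> (ob (cx S Sub) q) E" .
    have "\<beta> \<cdot> m Mid q \<in> Hom \<A> (ob (cx S Mid) q) E" by (simp add: Hom_iff)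
    then obtain \<gamma> where \<gamma>: "\<gamma> \<in> Hom \<A> (ob (cx S Quo) q) E" "\<gamma> \<cdot> prj S q = \<beta> \<cdot> m Mid q"
      using exact_atE[OF is_sesD(7,4,5)[OF S] E _ 0] by blast
    obtain \<delta> where \<delta>: "\<delta> \<in> Hom \<A> (ob (cx T Quo) q) E" "\<delta> \<cdot> m Quo q = \<gamma>"
      using extendsE[OF ext E \<gamma>(1)] by blast
    have [simp]: "\<delta> \<in> Arr \<A>" "Dom \<A> \<delta> = ob (cx T Quo) q" "Cod \<A> \<delta> = E" using \<delta> by (auto simp: Hom_iff)
    \<comment> \<open>Subtracting a map through \<open>prj T q\<close> leaves the restriction to the
      subcomplex unchanged, while \<open>\<delta>\<close> is chosen so that the result kills
      \<open>m Mid q\<close> and descends to \<open>Q Mid q\<close>.\<close>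
    let ?d = "diff \<beta> (\<delta> \<cdot> prj T q)"
    have "(\<delta> \<cdot> prj T q) \<cdot> m Mid q = (\<delta> \<cdot> m Quo q) \<cdot> prj S q" by (simp add: m(3))
    then have "(\<delta> \<cdot> prj T q) \<cdot> m Mid q = \<beta> \<cdot> m Mid q" unfolding \<delta>(2) \<gamma>(2) .
    then have "?d \<cdot> m Mid q = Zero \<A> (ob (cx S Mid) q) E" by simp
    moreover have "?d \<in> Hom \<A> (ob (cx T Mid) q) E" by (simp add: Hom_iff)
    ultimately obtain \<epsilon> where \<epsilon>: "\<epsilon> \<in> Hom \<A> (Q Mid q) E" "\<epsilon> \<cdot> p Mid q = ?d" using pE by blast
    have [simp]: "\<epsilon> \<in> Arr \<A>" "Dom \<A> \<epsilon> = Q Mid q" "Cod \<A> \<epsilon> = E" using \<epsilon> by (auto simp: Hom_iff)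
    have "(\<epsilon> \<cdot> f q) \<cdot> p Sub q = (\<epsilon> \<cdot> p Mid q) \<cdot> inc T q" by (simp add: f(2))
    also have "\<dots> = \<alpha> \<cdot> p Sub q" unfolding \<epsilon>(2) by (simp add: \<beta>(2))
    finally have "\<epsilon> \<cdot> f q = \<alpha>" by - (rule epi[of _ Sub q E]; simp add: Hom_iff)
    then show "\<exists>y\<in>Hom \<A> (Q Mid q) E. y \<cdot> f q = \<alpha>" using \<epsilon>(1) by blast
  next
    fix E \<beta> assume E: "injective_object \<A> E" and \<beta>: "\<beta> \<in> Hom \<A> (Q Mid q) E"
      and \<beta>0: "\<beta> \<cdot> f q = Zero \<A> (Q Sub q) E"
    have [simp]: "E \<in> Obj \<A>" using E by (rule injective_object_Obj)
    have [simp]: "\<beta> \<in> Arr \<A>" "Dom \<A> \<beta> = Q Mid q" "Cod \<A> \<beta> = E" using \<beta> by (auto simp: Hom_iff)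
    have "(\<beta> \<cdot> p Mid q) \<cdot> inc T q = (\<beta> \<cdot> f q) \<cdot> p Sub q" by (simp add: f(2))
    also have "\<dots> = Zero \<A> (ob (cx T Sub) q) E" unfolding \<beta>0 by simp
    finally have 0: "(\<beta> \<cdot> p Mid q) \<cdot> inc T q = Zero \<A> (ob (cx T Sub) q) E" .
    have "\<beta> \<cdot> p Mid q \<in> Hom \<A> (ob (cx T Mid) q) E" by (simp add: Hom_iff)
    then obtain \<gamma> where \<gamma>: "\<gamma> \<in> Hom \<A> (ob (cx T Quo) q) E" "\<gamma> \<cdot> prj T q = \<beta> \<cdot> p Mid q"
      using exact_atE[OF is_sesD(7,4,5)[OF T'(1)] E _ 0] by blast
    have [simp]: "\<gamma> \<in> Arr \<A>" "Dom \<A> \<gamma> = ob (cx T Quo) q" "Cod \<A> \<gamma> = E" using \<gamma> by (auto simp: Hom_iff)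
    have "(\<gamma> \<cdot> m Quo q) \<cdot> prj S q = (\<gamma> \<cdot> prj T q) \<cdot> m Mid q" by (simp add: m(3))
    also have "\<dots> = Zero \<A> (ob (cx S Mid) q) E" unfolding \<gamma>(2) by (simp add: pD(2))
    finally have "\<gamma> \<cdot> m Quo q = Zero \<A> (ob (cx S Quo) q) E"
      by - (rule epicD0[OF is_sesD(8,5)[OF S]]; simp add: Hom_iff)
    then obtain \<delta> where \<delta>: "\<delta> \<in> Hom \<A> (Q Quo q) E" "\<delta> \<cdot> p Quo q = \<gamma>" using pE[OF \<gamma>(1)] by blast
    have [simp]: "\<delta> \<in> Arr \<A>" "Dom \<A> \<delta> = Q Quo q" "Cod \<A> \<delta> = E" using \<delta> by (auto simp: Hom_iff)
    have "(\<delta> \<cdot> g q) \<cdot> p Mid q = (\<delta> \<cdot> p Quo q) \<cdot> prj T q" by (simp add: g(2))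
    also have "\<dots> = \<beta> \<cdot> p Mid q" unfolding \<delta>(2) \<gamma>(2) ..
    finally have "\<delta> \<cdot> g q = \<beta>" by - (rule epi[of _ Mid q E]; simp add: Hom_iff)
    then show "\<exists>z\<in>Hom \<A> (Q Quo q) E. z \<cdot> g q = \<beta>" using \<delta>(1) by blast
  next
    fix E \<gamma> assume E: "injective_object \<A> E" and \<gamma>: "\<gamma> \<in> Hom \<A> (Q Quo q) E"
      and \<gamma>0: "\<gamma> \<cdot> g q = Zero \<A> (Q Mid q) E"
    have [simp]: "E \<in> Obj \<A>" using E by (rule injective_object_Obj)
    have [simp]: "\<gamma> \<in> Arr \<A>" "Dom \<A> \<gamma> = Q Quo q" "Cod \<A> \<gamma> = E" using \<gamma> by (auto simp: Hom_iff)
    have "(\<gamma> \<cdot> p Quo q) \<cdot> prj T q = (\<gamma> \<cdot> g q) \<cdot> p Mid q" by (simp add: g(2))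
    also have "\<dots> = Zero \<A> (ob (cx T Mid) q) E" unfolding \<gamma>0 by simp
    finally have "\<gamma> \<cdot> p Quo q = Zero \<A> (ob (cx T Quo) q) E"
      by - (rule epicD0[OF is_sesD(8,5)[OF T'(1)]]; simp add: Hom_iff)
    then show "\<gamma> = Zero \<A> (Q Quo q) E" by - (rule epicD0[OF pD(3,1)]; simp add: Hom_iff)
  qed
  have "is_ses S'" unfolding is_ses_iff using cS' ch1 ch2 row by simp
  moreover have "ses_map T S' p" unfolding ses_map_def using chp f g by simp
  moreover have "CE_short_exact (cx S i) (m i) (cx T i) (p i) (cx S' i)" for i
    unfolding CE_short_exact_def using is_sesD(1)[OF S] is_sesD(1)[OF T'(1)] cS' m(1) chp col extc by auto
  moreover have "zero_at S' q" if "zero_at S q" for q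
    using T'(3)[OF that] zero_object_epic[OF _ pD(3,1)] by (simp add: zero_at_def)
  ultimately show ?thesis by blast
qed

text \<open>Row \<open>n\<close> of the resolutions is the target \<open>T n\<close> chosen for the
  \<open>n\<close>-th cokernel sequence \<open>U n\<close>. Its own inclusion and projection serve
  as the maps between the resolutions, so exactness of the rows is part of the construction.\<close>

lemma ex_CE_resolutions:
  assumes S: "is_ses S"
  shows "\<exists>R \<phi> \<psi>. (\<forall>i. CE_resolution \<A> (cx S i) (R i)) \<and>
     coresolution_map \<A> (inc S) (R Sub) (R Mid) \<phi> \<and> coresolution_map \<A> (prj S) (R Mid) (R Quo) \<psi> \<and>
     (\<forall>p. short_exact_complexes \<A> (cpx (R Sub) p) (\<phi> p) (cpx (R Mid) p) (\<psi> p) (cpx (R Quo) p)) \<and>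
     (\<forall>p q i. zero_at S q \<longrightarrow> is_zero_object \<A> (ob (cpx (R i) p) q))"
proof -
  \<comment> \<open>The state consists of a sequence to resolve, its target and the embedding.
    Vanishing is compared with the original \<open>S\<close>, so it can be handed on at every stage;
    the last clause pins down the start.\<close>
  define good where "good n x \<longleftrightarrow> (case x of (U, T, m) \<Rightarrow>
      is_ses U \<and> CE_embedding U T m \<and> (\<forall>q. zero_at S q \<longrightarrow> zero_at U q) \<and> (n = 0 \<longrightarrow> U = S))" for n :: nat and x
  \<comment> \<open>The quotient maps relate consecutive states and therefore belong to the
    transition; they are chosen afterwards, for all stages at once.\<close>
  define nxt where "nxt x y \<longleftrightarrow> (case x of (U, T, m) \<Rightarrow> \<exists>p. ses_map T (fst y) p \<and>
      (\<forall>i. CE_short_exact (cx U i) (m i) (cx T i) (p i) (cx (fst y) i)))" for x y :: "('a, 'b) ses \<times> ('a, 'b) ses \<times> (pos \<Rightarrow> int \<Rightarrow> 'b)"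
  have "\<exists>x. good 0 x" using ex_CE_embedding[OF S] S by (auto simp: good_def)
  moreover have "\<exists>y. good (Suc n) y \<and> nxt x y" if "good n x" for x n
  proof -
    obtain U T m where x: "x = (U, T, m)" by (cases x)
    have U: "is_ses U" "CE_embedding U T m" "\<And>q. zero_at S q \<Longrightarrow> zero_at U q"
      using that by (auto simp: good_def x)
    obtain U' p where U': "is_ses U'" "ses_map T U' p"
      "\<And>i. CE_short_exact (cx U i) (m i) (cx T i) (p i) (cx U' i)" "\<And>q. zero_at U q \<Longrightarrow> zero_at U' q"
      using ex_quotient[OF U(1,2)] by blast
    obtain T' m' where "CE_embedding U' T' m'" using ex_CE_embedding[OF U'(1)] by blast
    then have "good (Suc n) (U', T', m')" "nxt x (U', T', m')"
      using U U' by (auto simp: good_def nxt_def x)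
    then show ?thesis by blast
  qed
  ultimately obtain F where F: "\<And>n. good n (F n)" "\<And>n. nxt (F n) (F (Suc n))"
    using dependent_nat_choice[of good "\<lambda>_. nxt"] by blast
  define U where "U n = fst (F n)" for n
  define T where "T n = fst (snd (F n))" for n
  define m where "m n = snd (snd (F n))" for n
  have G: "is_ses (U n)" "CE_embedding (U n) (T n) (m n)" "\<And>q. zero_at S q \<Longrightarrow> zero_at (U n) q" for n
    using F(1)[of n] by (auto simp: good_def U_def T_def m_def split_beta)
  have U0: "U 0 = S" using F(1)[of 0] by (auto simp: good_def U_def split_beta)
  have "\<exists>p. ses_map (T n) (U (Suc n)) p \<and>
      (\<forall>i. CE_short_exact (cx (U n) i) (m n i) (cx (T n) i) (p i) (cx (U (Suc n)) i))" for n
    using F(2)[of n] by (auto simp: nxt_def U_def T_def m_def split_beta)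
  then obtain p where p: "\<And>n. ses_map (T n) (U (Suc n)) (p n)"
      "\<And>n i. CE_short_exact (cx (U n) i) (m n i) (cx (T n) i) (p n i) (cx (U (Suc n)) i)" by metis
  have T: "is_ses (T n)" "\<And>i. split_injective_complex (cx (T n) i)" "ses_map (U n) (T n) (m n)"
      "\<And>q. zero_at S q \<Longrightarrow> zero_at (T n) q" for n
    using G(2)[of n] G(3)[of _ n] by (auto simp: CE_embedding_def split_target_def)
  have mc: "chain_map \<A> (cx (U n) i) (cx (T n) i) (m n i)"
     "inc (T n) q \<cdot> m n Sub q = m n Mid q \<cdot> inc (U n) q"
     "prj (T n) q \<cdot> m n Mid q = m n Quo q \<cdot> prj (U n) q" for n i q
    using T(3)[of n] by (auto simp: ses_map_def)
  have pc: "chain_map \<A> (cx (T n) i) (cx (U (Suc n)) i) (p n i)"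
     "inc (U (Suc n)) q \<cdot> p n Sub q = p n Mid q \<cdot> inc (T n) q"
     "prj (U (Suc n)) q \<cdot> p n Mid q = p n Quo q \<cdot> prj (T n) q" for n i q
    using p(1)[of n] by (auto simp: ses_map_def)
  note [simp] = is_ses_simps[OF G(1)] is_ses_simps[OF T(1)] chain_map_Arr[OF mc(1)] chain_map_Arr[OF pc(1)]
  define R where "R i = \<lparr>cpx = \<lambda>n. cx (T n) i, aug = m 0 i, step = \<lambda>n q. m (Suc n) i q \<cdot> p n i q\<rparr>" for i
  have "CE_resolution \<A> (cx S i) (R i)" for i
    using CE_resolutionI[of "\<lambda>n. cx (U n) i" "\<lambda>n. m n i" "\<lambda>n. cx (T n) i" "\<lambda>n. p n i"] p(2) T(2)
    by (simp add: U0 R_def)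
  moreover have "coresolution_map \<A> (inc S) (R Sub) (R Mid) (\<lambda>n. inc (T n))"
    unfolding coresolution_map_def R_def
  proof (intro conjI allI; simp only: coresolution.simps)
    fix n q
    show "chain_map \<A> (cx (T n) Sub) (cx (T n) Mid) (inc (T n))" using is_sesD(2)[OF T(1)] .
    show "inc (T 0) q \<cdot> m 0 Sub q = m 0 Mid q \<cdot> inc S q" using mc(2)[of 0 q] by (simp add: U0)
    \<comment> \<open>A step of the resolution passes through \<open>U (Suc n)\<close>, so its
      square is pasted from those of \<open>p n\<close> and \<open>m (Suc n)\<close>.\<close>
    have "inc (T (Suc n)) q \<cdot> (m (Suc n) Sub q \<cdot> p n Sub q) = m (Suc n) Mid q \<cdot> (inc (U (Suc n)) q \<cdot> p n Sub q)"
      by (intro commute_Comp[OF mc(2)]) auto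
    then show "inc (T (Suc n)) q \<cdot> (m (Suc n) Sub q \<cdot> p n Sub q) = m (Suc n) Mid q \<cdot> p n Mid q \<cdot> inc (T n) q"
      by (simp add: pc(2))
  qed
  moreover have "coresolution_map \<A> (prj S) (R Mid) (R Quo) (\<lambda>n. prj (T n))"
    unfolding coresolution_map_def R_def
  proof (intro conjI allI; simp only: coresolution.simps)
    fix n q
    show "chain_map \<A> (cx (T n) Mid) (cx (T n) Quo) (prj (T n))" using is_sesD(3)[OF T(1)] .
    show "prj (T 0) q \<cdot> m 0 Mid q = m 0 Quo q \<cdot> prj S q" using mc(3)[of 0 q] by (simp add: U0)
    have "prj (T (Suc n)) q \<cdot> (m (Suc n) Mid q \<cdot> p n Mid q) = m (Suc n) Quo q \<cdot> (prj (U (Suc n)) q \<cdot> p n Mid q)"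
      by (intro commute_Comp[OF mc(3)]) auto
    then show "prj (T (Suc n)) q \<cdot> (m (Suc n) Mid q \<cdot> p n Mid q) = m (Suc n) Quo q \<cdot> p n Quo q \<cdot> prj (T n) q"
      by (simp add: pc(3))
  qed
  moreover have "short_exact_complexes \<A> (cpx (R Sub) n) (inc (T n)) (cpx (R Mid) n) (prj (T n)) (cpx (R Quo) n)" for n
    using T(1)[of n] by (simp add: R_def is_ses_def)
  moreover have "is_zero_object \<A> (ob (cpx (R i) n) q)" if "zero_at S q" for i n q
    using T(4)[OF that] by (simp add: R_def zero_at_def)
  ultimately show ?thesis by blast
qed

end

theorem theorem2p3:
  fixes \<A> :: "('o, 'm) category"
    and A B C :: "('o, 'm) cochain"
    and f g :: "int \<Rightarrow> 'm"
  assumes "abelian_category \<A>"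
    and "enough_injectives \<A>"
    and "short_exact_complexes \<A> A f B g C"
  shows "(\<exists>I J K \<phi> \<psi>.
            CE_resolution \<A> A I \<and> CE_resolution \<A> B J \<and> CE_resolution \<A> C K \<and>
            coresolution_map \<A> f I J \<phi> \<and> coresolution_map \<A> g J K \<psi> \<and>
            (\<forall>p. short_exact_complexes \<A> (cpx I p) (\<phi> p) (cpx J p) (\<psi> p) (cpx K p))) \<and>
         ((\<forall>q<0. is_zero_object \<A> (ob A q) \<and> is_zero_object \<A> (ob B q) \<and>
                 is_zero_object \<A> (ob C q)) \<longrightarrow>
          (\<exists>I J K \<phi> \<psi>.
            CE_resolution \<A> A I \<and> CE_resolution \<A> B J \<and> CE_resolution \<A> C K \<and>
            coresolution_map \<A> f I J \<phi> \<and> coresolution_map \<A> g J K \<psi> \<and>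
            (\<forall>p. short_exact_complexes \<A> (cpx I p) (\<phi> p) (cpx J p) (\<psi> p) (cpx K p)) \<and>
            (\<forall>p. \<forall>q<0. is_zero_object \<A> (ob (cpx I p) q) \<and>
               is_zero_object \<A> (ob (cpx J p) q) \<and> is_zero_object \<A> (ob (cpx K p) q))))"
proof -
  interpret abelian_category \<A> by fact
  interpret abelian_enough_injectives \<A> by unfold_locales fact
  define S where "S = \<lparr>cx = case_pos A B C, inc = f, prj = g\<rparr>"
  have "is_ses S" using assms(3) by (simp add: is_ses_def S_def)
  from ex_CE_resolutions[OF this] obtain R \<phi> \<psi> where
    R: "\<And>i. CE_resolution \<A> (cx S i) (R i)" "coresolution_map \<A> f (R Sub) (R Mid) \<phi>"
      "coresolution_map \<A> g (R Mid) (R Quo) \<psi>"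
      "\<And>p. short_exact_complexes \<A> (cpx (R Sub) p) (\<phi> p) (cpx (R Mid) p) (\<psi> p) (cpx (R Quo) p)"
    and zero: "\<And>p q i. zero_at S q \<Longrightarrow> is_zero_object \<A> (ob (cpx (R i) p) q)"
    unfolding S_def by fastforce
  have CE: "CE_resolution \<A> A (R Sub)" "CE_resolution \<A> B (R Mid)" "CE_resolution \<A> C (R Quo)"
    using R(1)[of Sub] R(1)[of Mid] R(1)[of Quo] by (simp_all add: S_def)
  have "zero_at S q" if "\<forall>q<0. is_zero_object \<A> (ob A q) \<and> is_zero_object \<A> (ob B q) \<and>
      is_zero_object \<A> (ob C q)" "q < 0" for q
    using that by (simp add: zero_at_def all_pos S_def)
  \<comment> \<open>The same resolutions serve both claims: they vanish in every degree in which the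
    given sequence does, and negative degrees are a special case.\<close>
  then show ?thesis using CE R(2-4) zero by blast
qed

end
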